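(* Fix $p>1$, and let $u$ and $v$ be weights on $\mathbb R^n$ such that $u\in A_p^{\mathcal R}$, $uv^p\in A_\infty$, and for some $0<\varepsilon\leq1$, $uv^{p-\varepsilon}$ is a weight and $[v^{-\varepsilon}]_{RH_\infty(uv^p)}<\infty$. Then there exists a constant $C>0$ such that for every measurable function $f$ on $\mathbb R^n$, $$\left\Vert\frac{M(fuv^{p-1})}{u}\right\Vert_{L^{p',\infty}(u)}\leq C\,\Vert f\Vert_{L^{p',1}(uv^p)}.$$
   Context: A weight is a positive, locally integrable function on $\mathbb R^n$. Cubes have sides parallel to the axes. For a weight $w$ and a measurable set $E$, $w(E)=\int_E w(x)\,dx$, and $\frac1p+\frac1{p'}=1$. The Hardy-Littlewood maximal operator is $Mf(x)=\sup_{Q\ni x}\frac1{|Q|}\int_Q|f|$, the supremum being over all cubes $Q$ containing $x$. For a weight $w$ (identified with the measure $w(x)\,dx$), put $\lambda_f^w(y)=w(\{x:|f(x)|>y\})$. For $q>0$: $\Vert f\Vert_{L^{q,1}(w)}=q\int_0^\infty \lambda_f^w(y)^{1/q}\,dy$ and $\Vert f\Vert_{L^{q,\infty}(w)}=\sup_{y>0} y\,\lambda_f^w(y)^{1/q}$. $w\in A_p^{\mathcal R}$ means $[w]_{A_p^{\mathcal R}}=\sup_Q w(Q)^{1/p}\,\frac{\Vert \chi_Q w^{-1}\Vert_{L^{p',\infty}(w)}}{|Q|}<\infty$ (supremum over all cubes). $A_\infty=\bigcup_{q\ge1}A_q$, where $A_q$ denotes the Muckenhoupt classes. For weights $w$ and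 $v$, $[v^{-\varepsilon}]_{RH_\infty(w)}=\sup_Q\frac{w(Q)}{wv^{-\varepsilon}(Q)}\Vert\chi_Qv^{-\varepsilon}\Vert_{L^\infty(w)}$, where $wv^{-\varepsilon}(Q)=\int_Qwv^{-\varepsilon}$. *)

theory Defs
  imports "HOL-Analysis.Analysis" "HOL-Probability.Essential_Supremum"
begin

text \<open>
  All suprema, averages and (quasi-)norms below take values in \<^typ>\<open>ennreal\<close>, so that
  \<open>< \<infinity>\<close> expresses finiteness. Measurability is Lebesgue measurability.
\<close>

definition is_weight :: "(real ^ 'n \<Rightarrow> real) \<Rightarrow> bool" where
  "is_weight w \<longleftrightarrow>
     (\<forall>x. 0 < w x) \<and> (\<forall>K. compact K \<longrightarrow> set_integrable lebesgue K w)"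

definition weight_meas :: "(real ^ 'n \<Rightarrow> real) \<Rightarrow> (real ^ 'n) set \<Rightarrow> ennreal" where
  "weight_meas w E = (\<integral>\<^sup>+ x\<in>E. ennreal (w x) \<partial>lebesgue)"

text \<open>Cubes are closed and nondegenerate; faces are null sets, so this choice does not
  affect any of the suprema over cubes below.\<close>

definition cubes :: "(real ^ 'n) set set" where
  "cubes = {cbox a (\<chi> i. a $ i + l) | a l. 0 < l}"

definition cube_avg :: "(real ^ 'n \<Rightarrow> real) \<Rightarrow> (real ^ 'n) set \<Rightarrow> ennreal" where
  "cube_avg f Q = (\<integral>\<^sup>+ x\<in>Q. ennreal \<bar>f x\<bar> \<partial>lebesgue) / emeasure lebesgue Q"

definition HL_maximal :: "(real ^ 'n \<Rightarrow> real) \<Rightarrow> real ^ 'n \<Rightarrow> ennreal" where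
  "HL_maximal f x = (SUP Q\<in>{Q \<in> cubes. x \<in> Q}. cube_avg f Q)"

text \<open>Only used for \<open>p > 1\<close>.\<close>

definition conj_exponent :: "real \<Rightarrow> real" where
  "conj_exponent p = p / (p - 1)"

lemma conj_exponent_eq: "1 / p + 1 / conj_exponent p = 1" if "1 < p"
  using that by (simp add: conj_exponent_def field_simps)

text \<open>Only used for exponents \<open>r > 0\<close>, where \<open>\<infinity>\<close> to the power \<open>r\<close> is \<open>\<infinity>\<close>.\<close>

definition ennreal_pow :: "ennreal \<Rightarrow> real \<Rightarrow> ennreal" where
  "ennreal_pow a r = (if a = \<infinity> then \<infinity> else ennreal (enn2real a powr r))"

text \<open>The functions measured below are nonnegative and may take the value \<open>\<infinity>\<close> (as maximal
  functions do); for a real function \<open>f\<close> one passes \<open>\<lambda>x. ennreal \<bar>f x\<bar>\<close>.\<close>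

definition distr_fun :: "(real ^ 'n \<Rightarrow> real) \<Rightarrow> (real ^ 'n \<Rightarrow> ennreal) \<Rightarrow> real \<Rightarrow> ennreal" where
  "distr_fun w g y = weight_meas w {x. ennreal y < g x}"

definition lorentz_strong :: "real \<Rightarrow> (real ^ 'n \<Rightarrow> real) \<Rightarrow> (real ^ 'n \<Rightarrow> ennreal) \<Rightarrow> ennreal" where
  "lorentz_strong q w g =
     ennreal q * (\<integral>\<^sup>+ y\<in>{0<..}. ennreal_pow (distr_fun w g y) (1 / q) \<partial>lborel)"

definition lorentz_weak :: "real \<Rightarrow> (real ^ 'n \<Rightarrow> real) \<Rightarrow> (real ^ 'n \<Rightarrow> ennreal) \<Rightarrow> ennreal" where
  "lorentz_weak q w g = (SUP y\<in>{0<..}. ennreal y * ennreal_pow (distr_fun w g y) (1 / q))"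

definition linfty_norm :: "(real ^ 'n \<Rightarrow> real) \<Rightarrow> (real ^ 'n \<Rightarrow> ennreal) \<Rightarrow> ennreal" where
  "linfty_norm w g = esssup (density lebesgue (\<lambda>x. ennreal (w x))) g"

definition ApR_const :: "real \<Rightarrow> (real ^ 'n \<Rightarrow> real) \<Rightarrow> ennreal" where
  "ApR_const p w = (SUP Q\<in>cubes.
     ennreal_pow (weight_meas w Q) (1 / p) *
       (lorentz_weak (conj_exponent p) w (\<lambda>x. indicator Q x * ennreal (1 / w x))
         / emeasure lebesgue Q))"

definition ApR :: "real \<Rightarrow> (real ^ 'n \<Rightarrow> real) set" where
  "ApR p = {w. is_weight w \<and> ApR_const p w < \<infinity>}"

text \<open>The Muckenhoupt constant for \<open>q > 1\<close>.\<close>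

definition Aq_const :: "real \<Rightarrow> (real ^ 'n \<Rightarrow> real) \<Rightarrow> ennreal" where
  "Aq_const q w = (SUP Q\<in>cubes.
     cube_avg w Q *
       ennreal_pow (cube_avg (\<lambda>x. w x powr (1 - conj_exponent q)) Q) (q - 1))"

definition Aq :: "real \<Rightarrow> (real ^ 'n \<Rightarrow> real) set" where
  "Aq q = {w. is_weight w \<and>
     (if q = 1 then \<exists>C::real. AE x in lebesgue. HL_maximal w x \<le> ennreal (C * w x)
      else Aq_const q w < \<infinity>)}"

definition A_infty :: "(real ^ 'n \<Rightarrow> real) set" where
  "A_infty = (\<Union>q\<in>{1..}. Aq q)"

text \<open>\<open>RH_infty_const w g\<close> is the constant of \<open>g\<close> in the reverse Hoelder class of exponent
  \<open>\<infinity>\<close> with respect to the measure \<open>w(x) dx\<close>.\<close>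

definition RH_infty_const :: "(real ^ 'n \<Rightarrow> real) \<Rightarrow> (real ^ 'n \<Rightarrow> real) \<Rightarrow> ennreal" where
  "RH_infty_const w g = (SUP Q\<in>cubes.
     (weight_meas w Q / weight_meas (\<lambda>x. w x * g x) Q) *
       linfty_norm w (\<lambda>x. indicator Q x * ennreal (g x)))"

end

theory Submission
  imports Defs
begin

text \<open>
  Write \<open>w = u v^p\<close>, \<open>g = f u v^(p-1) = (f / v) w\<close>, and let \<open>G = {M g > y u}\<close>. The idea is to
  linearise the maximal function on one dyadic grid by a sparse sum, to move that sum by duality
  onto the indicator of \<open>G\<close>, and to bound it there by a Sawyer-type inequality for sets.
  
  Linearisation. On a grid, let \<open>R\<close> be the cells at which the logarithmic size of the average of
  \<open>g\<close> exceeds that at all larger cells. Then \<open>M g\<close> is at most a constant times the sum over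
  \<open>R\<close> of \<open>g_Q 1_Q\<close> (\<open>principal_cells\<close>), so \<open>y u(G)\<close> is at most a constant times the integral
  over \<open>G\<close> of that sum. By Tonelli the latter is the integral of \<open>f (A / v)\<close> against \<open>w\<close>, where
  \<open>A\<close> is the sum over \<open>R\<close> of \<open>(|G \<inter> Q| / |Q|) 1_Q\<close>. If \<open>A / v\<close> has weak \<open>L^p(w)\<close> norm at
  most a constant times \<open>u(G)^(1/p)\<close>, then a layer-cake decomposition of \<open>f\<close> and Kolmogorov's inequality
  (\<open>weak_type_set_integral\<close>) give the Lorentz norm on the right-hand side of the theorem.
  
  Weak type of \<open>A / v\<close>. On a set \<open>H\<close> where \<open>A > t v\<close>, subadditivity of the power \<open>\<epsilon> \<le> 1\<close>
  reduces the bound to the sum over \<open>R\<close> of \<open>(|G \<inter> Q| / |Q|)^\<epsilon>\<close> times the \<open>\<rho>\<close>-measure of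
  \<open>H \<inter> Q\<close>, with \<open>\<rho> = w v^(-\<epsilon>)\<close>. The reverse Hoelder condition bounds that measure by
  \<open>\<rho>(Q) w(H \<inter> Q) / w(Q)\<close>. Since \<open>\<rho>\<close> is an \<open>A_\<infinity>\<close> measure, sparseness of \<open>R\<close> replaces the
  sum by an integral (\<open>sparse_sum\<close>): what remains is the pairing of \<open>(M 1_G / v)^\<epsilon>\<close> with the
  maximal function of \<open>1_H\<close> relative to \<open>w\<close> (\<open>maximal_pairing\<close>, \<open>sparse_operator_weak_type\<close>).
  
  Sawyer-type inequality. It remains to bound \<open>w(M 1_G > s v)\<close> by \<open>s^(-p) u(G)\<close>. The condition
  \<open>A_p^R\<close> implies that \<open>|G \<inter> Q| / |Q|\<close> is at most a constant times the power \<open>1/p\<close> of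
  \<open>u(G \<inter> Q) / u(Q)\<close>, so it is enough to bound \<open>w(M_u 1_G > s v^p)\<close>, where \<open>M_u\<close> uses
  averages relative to \<open>u\<close> and \<open>v^p\<close> is the density of \<open>w\<close> with respect to \<open>u\<close>. This is
  \<open>mixed_weak_type\<close>; it uses that \<open>u\<close> and \<open>w\<close> are \<open>A_\<infinity>\<close> relative to each other.
  
  The quantitative absolute continuity behind these steps is the relation \<open>dominated\<close>. The hypotheses give
  it from \<open>u\<close> and from \<open>w\<close> to Lebesgue measure and from \<open>w\<close> to \<open>\<rho>\<close>; the Coifman-Fefferman
  argument \<open>reverse_dominated\<close> turns the first two around. The full maximal operator is controlled by
  \<open>2^n\<close> shifted grids (\<open>cube_in_grid_cell\<close>).
\<close>

section \<open>Weak-type estimates and nested grids of cells\<close>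

text \<open>
  Kolmogorov's inequality. Above a threshold \<open>y0\<close>, the function is bounded by the sum of
  \<open>2^(j+1) y0\<close> over those \<open>j\<close> at which it exceeds \<open>2^j y0\<close>, and the weak-type bound makes the
  integrals of these terms a geometric series. The choice \<open>y0 = (A / \<mu>(H))^(1/q)\<close> balances this
  series against the contribution \<open>y0 \<mu>(H)\<close> of the values below the threshold.
\<close>

lemma weak_type_set_integral:
  fixes \<phi> :: "'a \<Rightarrow> ennreal" and q A :: real
  assumes [measurable]: "\<phi> \<in> borel_measurable \<mu>" "H \<in> sets \<mu>" and q: "1 < q" and A: "0 < A"
    and weak: "\<And>y. 0 < y \<Longrightarrow> emeasure \<mu> {x \<in> space \<mu>. ennreal y < \<phi> x} \<le> ennreal (A * y powr (- q))"
    and fin: "emeasure \<mu> H < \<infinity>"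
  shows "(\<integral>\<^sup>+x\<in>H. \<phi> x \<partial>\<mu>)
    \<le> ennreal ((1 + 2 / (1 - 2 powr (1 - q))) * A powr (1 / q) * measure \<mu> H powr (1 - 1 / q))"
proof (cases "measure \<mu> H = 0")
  case True
  then have "emeasure \<mu> H = 0"
    using fin by (simp add: emeasure_eq_ennreal_measure less_top)
  then have "AE x in \<mu>. x \<notin> H"
    by (intro AE_not_in null_setsI) auto
  then have "(\<integral>\<^sup>+x\<in>H. \<phi> x \<partial>\<mu>) = 0"
    by (subst nn_integral_0_iff_AE) auto
  then show ?thesis by simp
next
  case False
  define h where "h = measure \<mu> H"
  have h: "0 < h" using False unfolding h_def by (simp add: zero_less_measure_iff)
  have emH: "emeasure \<mu> H = ennreal h"
    using fin by (simp add: emeasure_eq_ennreal_measure less_top h_def)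
  define y0 where "y0 = (A / h) powr (1 / q)"
  have y0: "0 < y0" using A h by (simp add: y0_def)
  let ?S = "\<lambda>j. {x \<in> space \<mu>. ennreal (y0 * 2 ^ j) < \<phi> x}"
  let ?s = "\<lambda>x. (\<Sum>j. ennreal (y0 * 2 ^ Suc j) * indicator (?S j) x)"
  have key: "ennreal r \<le> ennreal y0 + ?s x" if x: "x \<in> space \<mu>" and r: "ennreal r \<le> \<phi> x" for r x
  proof (cases "r \<le> y0")
    case True
    then show ?thesis by (simp add: add_increasing2 ennreal_leI)
  next
    case False
    define P where "P = (\<lambda>j. r \<le> y0 * 2 ^ Suc j)"
    obtain n where n: "r / y0 < 2 ^ n" using real_arch_pow[of 2 "r / y0"] by auto
    then have "r < y0 * 2 ^ n" using y0 by (simp add: field_simps)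
    also have "\<dots> \<le> y0 * 2 ^ Suc n" using y0 by simp
    finally have "P n" by (simp add: P_def)
    define j where "j = (LEAST j. P j)"
    have Pj: "P j" unfolding j_def using \<open>P n\<close> by (rule LeastI)
    have "y0 * 2 ^ j < r"
    proof (cases j)
      case 0
      then show ?thesis using False by simp
    next
      case (Suc i)
      then have "\<not> P i" unfolding j_def by (metis lessI not_less_Least)
      then show ?thesis using Suc by (simp add: P_def)
    qed
    then have "ennreal (y0 * 2 ^ j) < ennreal r"
      using y0 by (simp add: ennreal_less_iff)
    then have "x \<in> ?S j" using x r by auto
    then have "ennreal r \<le> (\<Sum>i\<in>{j}. ennreal (y0 * 2 ^ Suc i) * indicator (?S i) x)"
      using Pj by (simp add: P_def ennreal_leI)
    also have "\<dots> \<le> ?s x" by (rule sum_le_suminf) auto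
    finally show ?thesis by (simp add: add_increasing)
  qed
  have pw: "\<phi> x \<le> ennreal y0 + ?s x" if x: "x \<in> space \<mu>" for x
  proof (cases "\<phi> x")
    case (real r)
    then show ?thesis using key[OF x, of r] by simp
  next
    case top
    have "ennreal y0 + ?s x = top"
    proof (rule ccontr)
      assume "ennreal y0 + ?s x \<noteq> top"
      then obtain t where t: "ennreal y0 + ?s x = ennreal t" "0 \<le> t"
        by (cases "ennreal y0 + ?s x" rule: ennreal_cases) auto
      have "ennreal (t + 1) \<le> ennreal t"
        unfolding t(1)[symmetric] by (rule key[OF x]) (simp add: top)
      then show False using t(2) by (simp add: ennreal_le_iff)
    qed
    then show ?thesis by simp
  qed
  have geo: "(\<lambda>j. (2 * A * y0 powr (1 - q)) * (2 powr (1 - q)) ^ j) sums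
       ((2 * A * y0 powr (1 - q)) * (1 / (1 - 2 powr (1 - q))))"
  proof -
    have "2 powr (1 - q) < (1::real)" using q by (simp add: powr_less_one)
    then show ?thesis by (intro sums_mult geometric_sums) simp
  qed
  have "(\<integral>\<^sup>+x\<in>H. \<phi> x \<partial>\<mu>) \<le> (\<integral>\<^sup>+x. ennreal y0 * indicator H x + ?s x \<partial>\<mu>)"
  proof (intro nn_integral_mono)
    fix x assume "x \<in> space \<mu>"
    then show "\<phi> x * indicator H x \<le> ennreal y0 * indicator H x + ?s x"
      using pw[of x] by (cases "x \<in> H") simp_all
  qed
  also have "\<dots> = (\<integral>\<^sup>+x. ennreal y0 * indicator H x \<partial>\<mu>) + (\<integral>\<^sup>+x. ?s x \<partial>\<mu>)"
    by (rule nn_integral_add) measurable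
  also have "(\<integral>\<^sup>+x. ?s x \<partial>\<mu>) = (\<Sum>j. ennreal (y0 * 2 ^ Suc j) * emeasure \<mu> (?S j))"
    by (subst nn_integral_suminf) (auto simp: nn_integral_cmult)
  also have "\<dots> \<le> (\<Sum>j. ennreal ((2 * A * y0 powr (1 - q)) * (2 powr (1 - q)) ^ j))"
  proof (rule suminf_le)
    fix j
    have "ennreal (y0 * 2 ^ Suc j) * emeasure \<mu> (?S j)
        \<le> ennreal (y0 * 2 ^ Suc j) * ennreal (A * (y0 * 2 ^ j) powr (- q))"
      using y0 by (intro mult_left_mono weak) auto
    also have "\<dots> = ennreal ((y0 * 2 ^ Suc j) * (A * (y0 * 2 ^ j) powr (- q)))"
      using y0 A by (intro ennreal_mult[symmetric]) auto
    also have "(y0 * 2 ^ Suc j) * (A * (y0 * 2 ^ j) powr (- q))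
        = 2 * A * ((y0 * 2 ^ j) * (y0 * 2 ^ j) powr (- q))" by simp
    also have "(y0 * 2 ^ j) * (y0 * 2 ^ j) powr (- q) = (y0 * 2 ^ j) powr (1 - q)"
      using y0 by (simp add: powr_mult_base)
    also have "\<dots> = y0 powr (1 - q) * (2 powr (1 - q)) ^ j"
      using y0 by (simp add: powr_mult powr_power powr_realpow[symmetric] powr_powr mult.commute)
    finally show "ennreal (y0 * 2 ^ Suc j) * emeasure \<mu> (?S j)
        \<le> ennreal ((2 * A * y0 powr (1 - q)) * (2 powr (1 - q)) ^ j)" by (simp add: mult.assoc)
  qed auto
  also have "\<dots> = ennreal ((2 * A * y0 powr (1 - q)) * (1 / (1 - 2 powr (1 - q))))"
    using A by (intro suminf_ennreal_eq[OF _ geo]) auto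
  also have "(\<integral>\<^sup>+x. ennreal y0 * indicator H x \<partial>\<mu>) = ennreal (y0 * h)"
    using y0 h by (simp add: nn_integral_cmult emH ennreal_mult)
  also have "ennreal (y0 * h) + ennreal ((2 * A * y0 powr (1 - q)) * (1 / (1 - 2 powr (1 - q))))
     = ennreal (y0 * h + (2 * A * y0 powr (1 - q)) * (1 / (1 - 2 powr (1 - q))))"
  proof (rule ennreal_plus[symmetric])
    have "2 powr (1 - q) < (1::real)" using q by (simp add: powr_less_one)
    then show "0 \<le> (2 * A * y0 powr (1 - q)) * (1 / (1 - 2 powr (1 - q)))" using A by simp
  qed (use y0 h in auto)
  also have "A * y0 powr (1 - q) = y0 * h"
  proof -
    have "y0 powr (1 - q) = y0 * y0 powr (- q)" using y0 by (simp add: powr_mult_base)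
    also have "y0 powr (- q) = h / A"
      unfolding y0_def using q A h by (simp add: powr_powr powr_minus field_simps)
    finally show ?thesis using A by simp
  qed
  then have "y0 * h + (2 * A * y0 powr (1 - q)) * (1 / (1 - 2 powr (1 - q)))
     = (1 + 2 / (1 - 2 powr (1 - q))) * (y0 * h)"
    by (simp add: algebra_simps)
  also have "y0 * h = A powr (1 / q) * h powr (1 - 1 / q)"
    unfolding y0_def using A h by (simp add: powr_divide powr_diff)
  finally show ?thesis by (simp add: h_def mult.assoc)
qed

text \<open>
  This reduces testing against functions of the Lorentz space \<open>L^{q,1}\<close> to testing against sets.
\<close>

lemma nn_integral_layer_cake:
  fixes f :: "'a \<Rightarrow> real" and h :: "'a \<Rightarrow> ennreal"
  assumes "sigma_finite_measure \<mu>"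
    and [measurable]: "f \<in> borel_measurable \<mu>" "h \<in> borel_measurable \<mu>"
  shows "(\<integral>\<^sup>+x. ennreal (f x) * h x \<partial>\<mu>)
    = (\<integral>\<^sup>+s\<in>{0<..}. (\<integral>\<^sup>+x\<in>{x \<in> space \<mu>. s < f x}. h x \<partial>\<mu>) \<partial>lborel)"
proof -
  interpret \<mu>: sigma_finite_measure \<mu> by fact
  interpret pair_sigma_finite lborel \<mu> ..
  have "(\<integral>\<^sup>+x. ennreal (f x) * h x \<partial>\<mu>)
      = (\<integral>\<^sup>+x. (\<integral>\<^sup>+s. indicator {0<..} s * (h x * (if s < f x then 1 else 0)) \<partial>lborel) \<partial>\<mu>)"
  proof (rule nn_integral_cong)
    fix x
    have "(\<integral>\<^sup>+s. indicator {0<..} s * (h x * (if s < f x then 1 else 0)) \<partial>lborel)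
       = (\<integral>\<^sup>+s. h x * indicator {0<..<f x} s \<partial>lborel)"
      by (intro nn_integral_cong) (auto split: split_indicator)
    also have "\<dots> = h x * emeasure lborel {0<..<f x}"
      by (subst nn_integral_cmult) auto
    also have "\<dots> = ennreal (f x) * h x"
      by (cases "0 \<le> f x") (auto simp: mult.commute ennreal_neg)
    finally show "ennreal (f x) * h x
       = (\<integral>\<^sup>+s. indicator {0<..} s * (h x * (if s < f x then 1 else 0)) \<partial>lborel)" ..
  qed
  also have "\<dots> = (\<integral>\<^sup>+s. (\<integral>\<^sup>+x. indicator {0<..} s * (h x * (if s < f x then 1 else 0)) \<partial>\<mu>) \<partial>lborel)"
    by (rule Fubini') measurable
  also have "\<dots> = (\<integral>\<^sup>+s\<in>{0<..}. (\<integral>\<^sup>+x\<in>{x \<in> space \<mu>. s < f x}. h x \<partial>\<mu>) \<partial>lborel)"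
    by (intro nn_integral_cong)
       (auto simp: nn_integral_cmult mult.commute[of "indicator _ _"] intro!: nn_integral_cong
         split: split_indicator)
  finally show ?thesis .
qed

text \<open>
  The generations start at \<open>0\<close>, so a cell has only finitely many supercells and maximal cells of
  any family exist. A cell is identified with its set of points: the same set may occur in several
  generations.
\<close>

locale cell_grid =
  fixes M :: "'a measure" and cell :: "nat \<Rightarrow> 'a \<Rightarrow> 'a set"
  assumes space_M: "space M = UNIV"
    and cell_self: "x \<in> cell k x"
    and cell_eq: "y \<in> cell k x \<Longrightarrow> cell k y = cell k x"
    and cell_Suc: "cell (Suc k) x \<subseteq> cell k x"
    and countable_range_cell: "countable (range (cell k))"
    and sets_cell [measurable]: "cell k x \<in> sets M"
begin

definition cells :: "'a set set" where
  "cells = {cell k x | k x. True}"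

definition cell_measure :: "'a measure \<Rightarrow> bool" where
  "cell_measure \<mu> \<longleftrightarrow> sets \<mu> = sets M \<and> (\<forall>Q\<in>cells. 0 < emeasure \<mu> Q \<and> emeasure \<mu> Q < \<infinity>)"

lemma cell_in_cells [simp]: "cell k x \<in> cells"
  by (auto simp: cells_def)

lemma countable_cells: "countable cells"
proof -
  have "cells = (\<Union>k. range (cell k))" by (auto simp: cells_def)
  then show ?thesis by (simp add: countable_range_cell)
qed

lemma sets_cells [measurable]: "Q \<in> cells \<Longrightarrow> Q \<in> sets M"
  by (auto simp: cells_def)

lemma cell_antimono: "j \<le> k \<Longrightarrow> cell k x \<subseteq> cell j x"
  by (induction k rule: dec_induct) (use cell_Suc in blast)+

lemma cells_at: "Q \<in> cells \<Longrightarrow> x \<in> Q \<Longrightarrow> \<exists>k. Q = cell k x"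
  using cell_eq by (fastforce simp: cells_def)

lemma cells_nonempty: "Q \<in> cells \<Longrightarrow> Q \<noteq> {}"
  using cell_self by (auto simp: cells_def)

lemma cells_laminar: "Q \<in> cells \<Longrightarrow> R \<in> cells \<Longrightarrow> x \<in> Q \<Longrightarrow> x \<in> R \<Longrightarrow> Q \<subseteq> R \<or> R \<subseteq> Q"
  using cells_at cell_antimono nat_le_linear by metis

lemma finite_supercells: "Q \<in> cells \<Longrightarrow> finite {P \<in> cells. Q \<subseteq> P}"
proof -
  assume Q: "Q \<in> cells"
  then obtain k x where k: "Q = cell k x" by (auto simp: cells_def)
  have "{P \<in> cells. Q \<subseteq> P} \<subseteq> (\<lambda>j. cell j x) ` {..k}"
  proof safe
    fix P assume P: "P \<in> cells" "Q \<subseteq> P"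
    then have "x \<in> P" using k cell_self by blast
    then obtain j where j: "P = cell j x" using cells_at P by blast
    show "P \<in> (\<lambda>j. cell j x) ` {..k}"
    proof (cases "j \<le> k")
      case False
      then have "P \<subseteq> Q" using cell_antimono[of k j x] k j by simp
      then show ?thesis using P k by auto
    qed (use j in auto)
  qed
  then show ?thesis using finite_surj[of "{..k}"] by blast
qed

lemma ex_largest_cell:
  assumes "F \<subseteq> cells" "Q \<in> F"
  obtains P where "P \<in> F" "Q \<subseteq> P" "\<And>R. R \<in> F \<Longrightarrow> P \<subseteq> R \<Longrightarrow> R = P"
proof -
  have "finite {P \<in> F. Q \<subseteq> P}"
    by (rule finite_subset[OF _ finite_supercells[of Q]]) (use assms in auto)
  from finite_has_maximal2[OF this, of Q] assms(2)
  obtain P where "P \<in> F" "Q \<subseteq> P" "\<forall>R\<in>{P \<in> F. Q \<subseteq> P}. P \<subseteq> R \<longrightarrow> P = R" by auto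
  then show ?thesis by (intro that) auto
qed

lemma sets_Union_cells: "F \<subseteq> cells \<Longrightarrow> \<Union>F \<in> sets M"
  by (rule sets.countable_Union) (auto intro: countable_subset countable_cells)

text \<open>
  The maximal cells of \<open>F\<close> are pairwise disjoint and cover \<open>\<Union>F\<close>, so the cellwise inequality
  can be summed over them. All weak type (1,1) bounds for dyadic maximal functions used here are instances.
\<close>

lemma cover_le:
  assumes F: "F \<subseteq> cells" and sets: "sets \<mu> = sets M" "sets \<nu> = sets M"
    and le: "\<And>Q. Q \<in> F \<Longrightarrow> emeasure \<nu> Q \<le> c * emeasure \<mu> Q"
  shows "emeasure \<nu> (\<Union>F) \<le> c * emeasure \<mu> (\<Union>F)"
proof -
  define F' where "F' = {P \<in> F. \<forall>R\<in>F. P \<subseteq> R \<longrightarrow> R = P}"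
  have F'F: "F' \<subseteq> F" by (auto simp: F'_def)
  have ctbl: "countable F'" using F F'F countable_cells by (meson countable_subset)
  have un: "\<Union>F = (\<Union>P\<in>F'. P)"
  proof
    show "\<Union>F \<subseteq> (\<Union>P\<in>F'. P)"
    proof
      fix x assume "x \<in> \<Union>F"
      then obtain Q where Q: "Q \<in> F" "x \<in> Q" by auto
      obtain P where "P \<in> F" "Q \<subseteq> P" "\<And>R. R \<in> F \<Longrightarrow> P \<subseteq> R \<Longrightarrow> R = P"
        using ex_largest_cell[OF F Q(1)] by blast
      then show "x \<in> (\<Union>P\<in>F'. P)" using Q by (auto simp: F'_def)
    qed
  qed (use F'F in auto)
  have disj: "disjoint_family_on (\<lambda>P. P) F'"
    unfolding disjoint_family_on_def
  proof (intro ballI impI)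
    fix P R assume PR: "P \<in> F'" "R \<in> F'" "P \<noteq> R"
    then have "\<not> P \<subseteq> R" "\<not> R \<subseteq> P" by (auto simp: F'_def)
    then show "P \<inter> R = {}" using PR F'F F cells_laminar by blast
  qed
  have meas: "P \<in> sets M" if "P \<in> F'" for P using that F'F F sets_cells by blast
  have e: "emeasure \<nu>' (\<Union>F) = (\<integral>\<^sup>+P. emeasure \<nu>' P \<partial>count_space F')" if "sets \<nu>' = sets M" for \<nu>'
    unfolding un by (rule emeasure_UN_countable) (use ctbl disj meas that in auto)
  have "emeasure \<nu> (\<Union>F) \<le> (\<integral>\<^sup>+P. c * emeasure \<mu> P \<partial>count_space F')"
    unfolding e[OF sets(2)] using F'F by (intro nn_integral_mono) (auto intro: le)
  also have "\<dots> = c * emeasure \<mu> (\<Union>F)"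
    unfolding e[OF sets(1)] by (rule nn_integral_cmult) simp
  finally show ?thesis .
qed

text \<open>
  Let \<open>E Q\<close> be the part of \<open>Q\<close> not covered by the cells of \<open>R\<close> inside \<open>Q\<close> that lie at
  least \<open>N\<close> levels deeper. It carries half of the mass of \<open>Q\<close>, so \<open>Q\<close> may be replaced by
  \<open>E Q\<close> at the cost of a factor 2. At most \<open>N\<close> of the sets \<open>E Q\<close> contain a given point:
  the cells of \<open>R\<close> around the point form a chain on which the level is injective, and the levels of
  those with the point in \<open>E Q\<close> lie in a window of length \<open>N\<close>.
\<close>

lemma sparse_sum:
  fixes \<kappa> :: "'a set \<Rightarrow> int" and N :: nat and \<psi> :: "'a \<Rightarrow> ennreal" and c :: "'a set \<Rightarrow> ennreal"
  assumes R: "R \<subseteq> cells" and \<nu>: "cell_measure \<nu>"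
    and mono: "\<And>P Q. P \<in> R \<Longrightarrow> Q \<in> R \<Longrightarrow> Q \<subset> P \<Longrightarrow> \<kappa> P < \<kappa> Q"
    and small: "\<And>Q. Q \<in> R \<Longrightarrow>
      emeasure \<nu> (\<Union>{Q' \<in> R. Q' \<subseteq> Q \<and> \<kappa> Q + int N \<le> \<kappa> Q'}) \<le> ennreal (1 / 2) * emeasure \<nu> Q"
    and c: "\<And>Q x. Q \<in> R \<Longrightarrow> x \<in> Q \<Longrightarrow> c Q \<le> \<psi> x"
    and \<psi> [measurable]: "\<psi> \<in> borel_measurable M"
  shows "(\<integral>\<^sup>+Q. c Q * emeasure \<nu> Q \<partial>count_space R) \<le> 2 * of_nat N * (\<integral>\<^sup>+x\<in>\<Union>R. \<psi> x \<partial>\<nu>)"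
proof -
  have sets_\<nu> [measurable_cong]: "sets \<nu> = sets M" using \<nu> by (simp add: cell_measure_def)
  define D where "D Q = \<Union>{Q' \<in> R. Q' \<subseteq> Q \<and> \<kappa> Q + int N \<le> \<kappa> Q'}" for Q
  define E where "E Q = Q - D Q" for Q
  have ctbl: "countable R" using R countable_cells by (rule countable_subset)
  have [measurable]: "D Q \<in> sets M" for Q
    unfolding D_def using R by (intro sets_Union_cells) auto
  have Qs [measurable]: "Q \<in> sets M" if "Q \<in> R" for Q using that R sets_cells by auto
  have Es [measurable]: "E Q \<in> sets M" if "Q \<in> R" for Q using that unfolding E_def by measurable
  have URs [measurable]: "\<Union>R \<in> sets M" using R by (rule sets_Union_cells)
  have half: "emeasure \<nu> Q \<le> 2 * emeasure \<nu> (E Q)" if Q: "Q \<in> R" for Q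
  proof -
    have fin: "emeasure \<nu> Q < \<infinity>" using \<nu> Q R by (auto simp: cell_measure_def)
    have DQ: "D Q \<subseteq> Q" by (auto simp: D_def)
    have s: "emeasure \<nu> (D Q) \<le> ennreal (1 / 2) * emeasure \<nu> Q" using small[OF Q] by (simp add: D_def)
    have "emeasure \<nu> Q = emeasure \<nu> (D Q) + emeasure \<nu> (E Q)"
    proof -
      have "Q = D Q \<union> E Q" "D Q \<inter> E Q = {}" using DQ by (auto simp: E_def)
      then show ?thesis using plus_emeasure[of "D Q" \<nu> "E Q"] Q by (simp add: sets_\<nu>)
    qed
    moreover have "emeasure \<nu> (D Q) < \<infinity>" "emeasure \<nu> (E Q) < \<infinity>"
      using fin calculation by (auto simp: less_top)
    moreover obtain d where d: "emeasure \<nu> (D Q) = ennreal d" "0 \<le> d"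
      using calculation(2) by (cases "emeasure \<nu> (D Q)") auto
    moreover obtain e where e: "emeasure \<nu> (E Q) = ennreal e" "0 \<le> e"
      using calculation(3) by (cases "emeasure \<nu> (E Q)") auto
    ultimately have Qde: "emeasure \<nu> Q = ennreal (d + e)" by (simp add: ennreal_plus)
    have "ennreal d \<le> ennreal (1 / 2) * ennreal (d + e)" using s unfolding d(1) Qde .
    also have "\<dots> = ennreal (1 / 2 * (d + e))" using d e by (intro ennreal_mult[symmetric]) auto
    finally have "ennreal d \<le> ennreal (1 / 2 * (d + e))" .
    then have "d \<le> 1 / 2 * (d + e)" using d e by (subst (asm) ennreal_le_iff) auto
    then have "ennreal (d + e) \<le> ennreal (2 * e)" by (intro ennreal_leI) simp
    then show ?thesis using Qde e by (simp add: ennreal_mult')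
  qed
  have count: "(\<integral>\<^sup>+Q. indicator (E Q) x \<partial>count_space R) \<le> of_nat N * indicator (\<Union>R) x" for x
  proof -
    define S where "S = {Q \<in> R. x \<in> E Q}"
    have chain: "\<kappa> Q' < \<kappa> Q + int N" if "Q \<in> S" "Q' \<in> S" for Q Q'
    proof (rule ccontr)
      assume "\<not> ?thesis"
      then have k: "\<kappa> Q + int N \<le> \<kappa> Q'" by simp
      have in_R: "Q \<in> R" "Q' \<in> R" "x \<in> Q" "x \<in> Q'" "x \<notin> D Q" using that by (auto simp: S_def E_def)
      then consider "Q' \<subseteq> Q" | "Q \<subset> Q'" using cells_laminar[of Q Q' x] R by auto
      then show False
      proof cases
        case 1
        then have "x \<in> D Q" using in_R k by (auto simp: D_def)
        then show False using in_R by simp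
      next
        case 2
        then show False using mono[of Q' Q] in_R k by simp
      qed
    qed
    have inj: "inj_on \<kappa> S"
    proof (rule inj_onI)
      fix Q Q' assume S: "Q \<in> S" "Q' \<in> S" "\<kappa> Q = \<kappa> Q'"
      then have "Q \<subseteq> Q' \<or> Q' \<subseteq> Q" using cells_laminar[of Q Q' x] R by (auto simp: S_def E_def)
      then show "Q = Q'" using mono[of Q Q'] mono[of Q' Q] S by (auto simp: S_def)
    qed
    have card: "finite S \<and> card S \<le> N"
    proof (cases "S = {}")
      case False
      then obtain Q0 where Q0: "Q0 \<in> S" by auto
      have sub: "\<kappa> ` S \<subseteq> {\<kappa> Q0 - int N..\<kappa> Q0 + int N}" using chain Q0 by force
      then have fin: "finite (\<kappa> ` S)" by (rule finite_subset) simp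
      define m where "m = Min (\<kappa> ` S)"
      obtain Q1 where Q1: "Q1 \<in> S" "\<kappa> Q1 = m"
      proof -
        have "m \<in> \<kappa> ` S" unfolding m_def using fin False by (intro Min_in) auto
        then obtain Q1 where "m = \<kappa> Q1" "Q1 \<in> S" by (rule imageE)
        then show ?thesis by (intro that) simp_all
      qed
      have "\<kappa> ` S \<subseteq> {m..<m + int N}"
        using chain[OF Q1(1)] Q1(2) Min_le[OF fin] unfolding m_def by auto
      then have "card (\<kappa> ` S) \<le> card {m..<m + int N}" by (intro card_mono) auto
      then show ?thesis using card_image[OF inj] finite_imageD[OF fin inj] by simp
    qed simp
    have "(\<integral>\<^sup>+Q. indicator (E Q) x \<partial>count_space R) = (\<integral>\<^sup>+Q. indicator S Q \<partial>count_space R)"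
      by (intro nn_integral_cong) (auto simp: S_def split: split_indicator)
    also have "\<dots> = of_nat (card S)"
      using card by (subst nn_integral_indicator) (auto simp: S_def)
    also have "\<dots> \<le> of_nat N * indicator (\<Union>R) x"
    proof (cases "x \<in> \<Union>R")
      case False
      then have "S = {}" by (auto simp: S_def E_def)
      then show ?thesis by simp
    qed (use card in simp)
    finally show ?thesis .
  qed
  have "(\<integral>\<^sup>+Q. c Q * emeasure \<nu> Q \<partial>count_space R)
      \<le> (\<integral>\<^sup>+Q. 2 * (\<integral>\<^sup>+x. \<psi> x * indicator (E Q) x \<partial>\<nu>) \<partial>count_space R)"
  proof (rule nn_integral_mono)
    fix Q assume "Q \<in> space (count_space R)"
    then have Q: "Q \<in> R" by simp
    have "c Q * emeasure \<nu> Q \<le> c Q * (2 * emeasure \<nu> (E Q))" by (intro mult_left_mono half Q) simp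
    also have "\<dots> = 2 * (c Q * emeasure \<nu> (E Q))" by (simp add: mult_ac)
    also have "c Q * emeasure \<nu> (E Q) = (\<integral>\<^sup>+x. c Q * indicator (E Q) x \<partial>\<nu>)"
      using Q by (subst nn_integral_cmult_indicator) auto
    also have "\<dots> \<le> (\<integral>\<^sup>+x. \<psi> x * indicator (E Q) x \<partial>\<nu>)"
      by (intro nn_integral_mono) (auto split: split_indicator simp: E_def intro: c[OF Q])
    finally show "c Q * emeasure \<nu> Q \<le> 2 * (\<integral>\<^sup>+x. \<psi> x * indicator (E Q) x \<partial>\<nu>)"
      by (simp add: mult_left_mono)
  qed
  also have "\<dots> = 2 * (\<integral>\<^sup>+x. (\<integral>\<^sup>+Q. \<psi> x * indicator (E Q) x \<partial>count_space R) \<partial>\<nu>)"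
  proof -
    have "(\<integral>\<^sup>+x. (\<integral>\<^sup>+Q. \<psi> x * indicator (E Q) x \<partial>count_space R) \<partial>\<nu>)
        = (\<integral>\<^sup>+Q. (\<integral>\<^sup>+x. \<psi> x * indicator (E Q) x \<partial>\<nu>) \<partial>count_space R)"
      by (rule nn_integral_count_space_nn_integral[OF ctbl]) measurable
    then show ?thesis by (simp only:) (rule nn_integral_cmult, simp)
  qed
  also have "\<dots> = 2 * (\<integral>\<^sup>+x. \<psi> x * (\<integral>\<^sup>+Q. indicator (E Q) x \<partial>count_space R) \<partial>\<nu>)"
    by (subst nn_integral_cmult) auto
  also have "\<dots> \<le> 2 * (\<integral>\<^sup>+x. \<psi> x * (of_nat N * indicator (\<Union>R) x) \<partial>\<nu>)"
    by (intro mult_left_mono nn_integral_mono count zero_le)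
  also have "(\<integral>\<^sup>+x. \<psi> x * (of_nat N * indicator (\<Union>R) x) \<partial>\<nu>)
      = (\<integral>\<^sup>+x. of_nat N * (\<psi> x * indicator (\<Union>R) x) \<partial>\<nu>)"
    by (simp only: mult.left_commute)
  also have "\<dots> = of_nat N * (\<integral>\<^sup>+x\<in>\<Union>R. \<psi> x \<partial>\<nu>)"
    by (rule nn_integral_cmult) measurable
  also have "2 * \<dots> = 2 * of_nat N * (\<integral>\<^sup>+x\<in>\<Union>R. \<psi> x \<partial>\<nu>)"
    by (simp only: mult.assoc)
  finally show ?thesis .
qed

end

section \<open>A mixed weak-type inequality on a grid\<close>

text \<open>
  Quantitative absolute continuity of \<open>\<nu>\<close> with respect to \<open>\<mu>\<close>, uniformly over the sets in
  \<open>\<Q>\<close>. For cubes and Lebesgue measure as \<open>\<mu>\<close> this is one of the equivalent forms of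
  \<open>A_\<infinity>\<close>.
\<close>

definition dominated :: "'a set set \<Rightarrow> real \<Rightarrow> real \<Rightarrow> 'a measure \<Rightarrow> 'a measure \<Rightarrow> bool" where
  "dominated \<Q> C \<delta> \<mu> \<nu> \<longleftrightarrow> (\<forall>Q\<in>\<Q>. \<forall>E\<in>sets \<mu>. E \<subseteq> Q \<longrightarrow>
     measure \<nu> E \<le> C * (measure \<mu> E / measure \<mu> Q) powr \<delta> * measure \<nu> Q)"

lemma dominatedD:
  "dominated \<Q> C \<delta> \<mu> \<nu> \<Longrightarrow> Q \<in> \<Q> \<Longrightarrow> E \<in> sets \<mu> \<Longrightarrow> E \<subseteq> Q \<Longrightarrow>
    measure \<nu> E \<le> C * (measure \<mu> E / measure \<mu> Q) powr \<delta> * measure \<nu> Q"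
  by (auto simp: dominated_def)

lemma emeasure_UN_le_count_space:
  assumes "countable I" and [measurable]: "\<And>i. i \<in> I \<Longrightarrow> X i \<in> sets M"
  shows "emeasure M (\<Union>i\<in>I. X i) \<le> (\<integral>\<^sup>+i. emeasure M (X i) \<partial>count_space I)"
proof -
  have [measurable]: "(\<Union>i\<in>I. X i) \<in> sets M" using assms by (intro sets.countable_UN') auto
  have "emeasure M (\<Union>i\<in>I. X i) = (\<integral>\<^sup>+x. indicator (\<Union>i\<in>I. X i) x \<partial>M)" by simp
  also have "\<dots> \<le> (\<integral>\<^sup>+x. (\<integral>\<^sup>+i. indicator (X i) x \<partial>count_space I) \<partial>M)"
  proof (rule nn_integral_mono)
    fix x
    show "indicator (\<Union>i\<in>I. X i) x \<le> (\<integral>\<^sup>+i. indicator (X i) x \<partial>count_space I)"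
    proof (cases "x \<in> (\<Union>i\<in>I. X i)")
      case True
      then obtain i where i: "i \<in> I" "x \<in> X i" by auto
      have "(1::ennreal) = (\<integral>\<^sup>+j. indicator {i} j \<partial>count_space I)"
        using i by (subst nn_integral_indicator) auto
      also have "\<dots> \<le> (\<integral>\<^sup>+i. indicator (X i) x \<partial>count_space I)"
        using i by (intro nn_integral_mono) (auto split: split_indicator)
      finally show ?thesis by (simp add: indicator_def)
    qed simp
  qed
  also have "\<dots> = (\<integral>\<^sup>+i. (\<integral>\<^sup>+x. indicator (X i) x \<partial>M) \<partial>count_space I)"
    by (rule nn_integral_count_space_nn_integral) (use assms in auto)
  also have "\<dots> = (\<integral>\<^sup>+i. emeasure M (X i) \<partial>count_space I)"
    by (intro nn_integral_cong) auto
  finally show ?thesis .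
qed

lemma powr_floor_log:
  fixes a r :: real
  assumes "1 < a" "0 < r"
  shows "a powr of_int \<lfloor>log a r\<rfloor> \<le> r" "r < a powr (of_int \<lfloor>log a r\<rfloor> + 1)"
proof -
  have "a powr of_int \<lfloor>log a r\<rfloor> \<le> a powr (log a r)" using assms by (intro powr_mono) auto
  then show "a powr of_int \<lfloor>log a r\<rfloor> \<le> r" using assms by simp
  have "a powr (log a r) < a powr (of_int \<lfloor>log a r\<rfloor> + 1)" using assms by (intro powr_less_mono) auto
  then show "r < a powr (of_int \<lfloor>log a r\<rfloor> + 1)" using assms by simp
qed

context cell_grid
begin

lemma cell_measure_emeasure:
  assumes "cell_measure \<mu>" "Q \<in> cells" "A \<subseteq> Q"
  shows "emeasure \<mu> A = ennreal (measure \<mu> A)"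
proof -
  have "emeasure \<mu> A \<le> emeasure \<mu> Q" using assms by (intro emeasure_mono) (auto simp: cell_measure_def)
  also have "\<dots> < \<infinity>" using assms by (auto simp: cell_measure_def)
  finally show ?thesis by (intro emeasure_eq_ennreal_measure) auto
qed

lemma cell_measure_pos:
  assumes "cell_measure \<mu>" "Q \<in> cells"
  shows "0 < measure \<mu> Q"
  using assms cell_measure_emeasure[OF assms order_refl]
  by (metis cell_measure_def ennreal_less_zero_iff)

lemma cell_measure_mono:
  assumes "cell_measure \<mu>" "Q \<in> cells" "A \<subseteq> B" "B \<subseteq> Q" "B \<in> sets M"
  shows "measure \<mu> A \<le> measure \<mu> B"
proof -
  have "emeasure \<mu> A \<le> emeasure \<mu> B" using assms by (intro emeasure_mono) (auto simp: cell_measure_def)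
  then show ?thesis
    using assms cell_measure_emeasure[of \<mu> Q A] cell_measure_emeasure[of \<mu> Q B] by (simp add: ennreal_le_iff)
qed

text \<open>
  The case of \<open>cover_le\<close> in which the cells are selected by their averages of an indicator function.
\<close>

lemma cover_le_inter:
  assumes F: "F \<subseteq> cells" and sets: "sets \<mu> = sets M" "sets \<nu> = sets M" and S: "S \<in> sets M"
    and le: "\<And>Q. Q \<in> F \<Longrightarrow> emeasure \<nu> Q \<le> c * emeasure \<mu> (S \<inter> Q)"
  shows "emeasure \<nu> (\<Union>F) \<le> c * emeasure \<mu> (S \<inter> \<Union>F)"
proof -
  let ?\<mu> = "density \<mu> (indicator S)"
  have e: "emeasure ?\<mu> A = emeasure \<mu> (S \<inter> A)" if "A \<in> sets M" for A
    using S that sets by (simp add: emeasure_density indicator_inter_arith[symmetric])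
  have "emeasure \<nu> (\<Union>F) \<le> c * emeasure ?\<mu> (\<Union>F)"
  proof (rule cover_le[OF F])
    fix Q assume "Q \<in> F"
    then show "emeasure \<nu> Q \<le> c * emeasure ?\<mu> Q" using le F by (subst e) (auto intro: sets_cells)
  qed (use sets in auto)
  then show ?thesis using e[OF sets_Union_cells[OF F]] by simp
qed

text \<open>
  A restricted Sawyer-type inequality. Let \<open>h Q = \<mu>(F \<inter> Q) / \<mu>(Q)\<close> and
  \<open>W Q = \<omega>(Q) / \<mu>(Q)\<close>. A point of the level set has a cell around it with \<open>V < h Q\<close>; up to
  rounding \<open>h\<close> to powers of \<open>a\<close>, the largest such cell is a record, i.e. its rounded average exceeds
  those of all larger cells. If \<open>W Q \<le> h Q\<close>, then \<open>\<omega>(Q) \<le> \<mu>(F \<inter> Q)\<close>, and these cells are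
  handled by the covering lemma. The other records are split into layers \<open>Rl l\<close>, in which
  \<open>W Q\<close> is about \<open>a^l h Q\<close>. There the points with \<open>V < h Q\<close> have a density about
  \<open>a^l\<close> times below average, so by the \<open>A_\<infinity>\<close> relations they form only a portion of size
  \<open>a^(-l (1 + \<delta>1))\<close> of the \<open>\<omega>\<close>-measure of \<open>Q\<close>. Within one layer, the averages \<open>W\<close> grow
  geometrically along nested records, so the layer is sparse for \<open>\<omega>\<close>, and the sum of \<open>\<omega>(Q)\<close> is
  at most a constant times \<open>a^l \<mu>(F)\<close>. The products of the two powers of \<open>a\<close> are summable over
  \<open>l\<close>.
\<close>

lemma mixed_weak_type_unit:
  fixes V :: "'a \<Rightarrow> real"
  assumes \<mu>: "cell_measure \<mu>" and \<omega>: "cell_measure \<omega>"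
    and \<omega>_eq: "\<omega> = density \<mu> (\<lambda>x. ennreal (V x))"
    and V [measurable]: "V \<in> borel_measurable M" and V_nonneg: "\<And>x. 0 \<le> V x"
    and dom1: "dominated cells C1 \<delta>1 \<omega> \<mu>" and C1: "0 < C1" "0 < \<delta>1"
    and dom2: "dominated cells C2 \<delta>2 \<mu> \<omega>" and C2: "0 < C2" "0 < \<delta>2"
    and a: "1 < a" and aC: "C2 * (1 / a) powr \<delta>2 \<le> 1 / 2"
    and F [measurable]: "F \<in> sets M"
  shows "emeasure \<omega> {x. \<exists>k. V x * measure \<mu> (cell k x) < measure \<mu> (F \<inter> cell k x)}
     \<le> ennreal (1 + 6 * C1 * a powr (2 + \<delta>1) / (1 - a powr (- \<delta>1))) * emeasure \<mu> F"
proof -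
  have sets_\<mu> [measurable_cong]: "sets \<mu> = sets M" using \<mu> by (simp add: cell_measure_def)
  have sets_\<omega> [measurable_cong]: "sets \<omega> = sets M" using \<omega> by (simp add: cell_measure_def)
  note em\<mu> = cell_measure_emeasure[OF \<mu>] and em\<omega> = cell_measure_emeasure[OF \<omega>]
  note pos\<mu> = cell_measure_pos[OF \<mu>] and pos\<omega> = cell_measure_pos[OF \<omega>]
  define h where "h Q = measure \<mu> (F \<inter> Q) / measure \<mu> Q" for Q
  define W where "W Q = measure \<omega> Q / measure \<mu> Q" for Q
  define \<kappa> where "\<kappa> Q = \<lfloor>log a (h Q)\<rfloor>" for Q
  define hh where "hh Q = a powr (of_int (\<kappa> Q) + 1)" for Q
  have \<kappa>: "a powr of_int (\<kappa> Q) \<le> h Q" "h Q < hh Q" if "0 < h Q" for Q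
    using powr_floor_log[OF a that] by (auto simp: \<kappa>_def hh_def)
  have hh_le: "hh Q \<le> a * h Q" if "0 < h Q" for Q
    using \<kappa>(1)[OF that] a by (simp add: hh_def powr_add)
  have h_eq: "measure \<mu> (F \<inter> Q) = h Q * measure \<mu> Q" if "Q \<in> cells" for Q
    using pos\<mu>[OF that] by (simp add: h_def)
  have W_eq: "measure \<omega> Q = W Q * measure \<mu> Q" if "Q \<in> cells" for Q
    using pos\<mu>[OF that] by (simp add: W_def)
  have W_pos: "0 < W Q" if "Q \<in> cells" for Q
    using pos\<mu>[OF that] pos\<omega>[OF that] by (simp add: W_def)
  define R where "R = {Q \<in> cells. 0 < h Q \<and> (\<forall>P\<in>cells. Q \<subset> P \<longrightarrow> \<kappa> P < \<kappa> Q)}"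
  define Rl where "Rl l = {Q \<in> R. a ^ l * h Q \<le> W Q \<and> W Q < a ^ Suc l * h Q}" for l :: nat
  define Fm where "Fm = {Q \<in> cells. measure \<omega> Q \<le> measure \<mu> (F \<inter> Q)}"
  define E where "E Q = {x \<in> Q. V x < hh Q}" for Q
  have R_cells: "R \<subseteq> cells" and Rl_R: "Rl l \<subseteq> R" for l by (auto simp: R_def Rl_def)
  have Rl_cells: "Rl l \<subseteq> cells" for l using R_cells Rl_R by blast
  have E_sets [measurable]: "E Q \<in> sets M" if "Q \<in> cells" for Q
  proof -
    have "{x \<in> space M. V x < hh Q} \<in> sets M" by measurable
    moreover have "E Q = {x \<in> space M. V x < hh Q} \<inter> Q" by (auto simp: E_def space_M)
    ultimately show ?thesis using that by auto
  qed
  let ?B = "{x. \<exists>k. V x * measure \<mu> (cell k x) < measure \<mu> (F \<inter> cell k x)}"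
  \<comment> \<open>The largest cell around the point that satisfies the rounded inequality is a record, because
    \<open>\<mu>(F \<inter> P')\<close> is positive for every larger cell \<open>P'\<close>.\<close>
  have cover: "?B \<subseteq> \<Union>Fm \<union> (\<Union>l. \<Union>Q\<in>Rl l. E Q)"
  proof
    fix x assume "x \<in> ?B"
    then obtain k where k: "V x * measure \<mu> (cell k x) < measure \<mu> (F \<inter> cell k x)" by auto
    define S where "S = {P \<in> cells. x \<in> P \<and> 0 < h P \<and> V x < hh P}"
    have "V x < h (cell k x)" using k pos\<mu>[of "cell k x"] by (simp add: h_def field_simps)
    then have "0 < h (cell k x)" "V x < hh (cell k x)"
      using V_nonneg[of x] \<kappa>(2)[of "cell k x"] by auto
    then have "cell k x \<in> S" using cell_self by (simp add: S_def)
    then obtain P where P: "P \<in> S" "\<And>P'. P' \<in> S \<Longrightarrow> P \<subseteq> P' \<Longrightarrow> P' = P"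
      by (rule ex_largest_cell[rotated]) (auto simp: S_def)
    have PR: "P \<in> R"
      unfolding R_def
    proof (intro CollectI conjI ballI impI)
      show "P \<in> cells" "0 < h P" using P by (auto simp: S_def)
      fix P' assume P': "P' \<in> cells" "P \<subset> P'"
      have "measure \<mu> (F \<inter> P) \<le> measure \<mu> (F \<inter> P')"
        using P' F by (intro cell_measure_mono[OF \<mu> P'(1)]) auto
      moreover have "0 < measure \<mu> (F \<inter> P)"
        using \<open>0 < h P\<close> pos\<mu>[OF \<open>P \<in> cells\<close>] by (simp add: h_eq[OF \<open>P \<in> cells\<close>])
      ultimately have "0 < h P'" using pos\<mu>[OF P'(1)] by (simp add: h_def)
      moreover have "x \<in> P'" using P P' by (auto simp: S_def)
      ultimately have "\<not> V x < hh P'" using P(2)[of P'] P' by (auto simp: S_def)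
      then have "hh P' < hh P" using P(1) by (auto simp: S_def)
      then show "\<kappa> P' < \<kappa> P" using a by (simp add: hh_def)
    qed
    have Pc: "P \<in> cells" "x \<in> P" "0 < h P" "V x < hh P" using P by (auto simp: S_def)
    show "x \<in> \<Union>Fm \<union> (\<Union>l. \<Union>Q\<in>Rl l. E Q)"
    proof (cases "W P \<le> h P")
      case True
      then have "P \<in> Fm"
        using Pc pos\<mu>[OF Pc(1)] by (auto simp: Fm_def W_eq[OF Pc(1)] h_eq[OF Pc(1)])
      then show ?thesis using Pc by auto
    next
      case False
      define r where "r = W P / h P"
      have r: "1 < r" using False Pc by (simp add: r_def)
      define l where "l = nat \<lfloor>log a r\<rfloor>"
      have l: "\<lfloor>log a r\<rfloor> = int l" using r a by (simp add: l_def)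
      have "a ^ l \<le> r" "r < a ^ Suc l"
        using powr_floor_log[of a r] a r unfolding l by (auto simp: powr_realpow powr_add mult.commute)
      then have "P \<in> Rl l" using PR Pc by (auto simp: Rl_def r_def field_simps)
      then show ?thesis using Pc by (auto simp: E_def)
    qed
  qed
  have first: "emeasure \<omega> (\<Union>Fm) \<le> emeasure \<mu> F"
  proof -
    have "emeasure \<omega> (\<Union>Fm) \<le> 1 * emeasure \<mu> (F \<inter> \<Union>Fm)"
    proof (rule cover_le_inter)
      fix Q assume Q: "Q \<in> Fm"
      then have "Q \<in> cells" by (simp add: Fm_def)
      then show "emeasure \<omega> Q \<le> 1 * emeasure \<mu> (F \<inter> Q)"
        using Q by (subst em\<omega>[of Q], simp_all, subst em\<mu>[of Q]) (auto simp: Fm_def ennreal_leI)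
    qed (auto simp: Fm_def sets_\<mu> sets_\<omega>)
    also have "\<dots> \<le> emeasure \<mu> F" by (simp, intro emeasure_mono) auto
    finally show ?thesis .
  qed
  have layer: "emeasure \<omega> (\<Union>Q\<in>Rl l. E Q)
      \<le> ennreal (6 * C1 * a powr (2 + \<delta>1) * (a powr (- \<delta>1)) ^ l) * emeasure \<mu> F" for l
  proof -
    define c where "c = C1 * a powr ((1 - real l) * (1 + \<delta>1))"
    have c0: "0 \<le> c" using C1 by (simp add: c_def)
    have ctbl: "countable (Rl l)" using Rl_cells countable_cells by (rule countable_subset)
    \<comment> \<open>On \<open>E Q\<close> the density is at most \<open>a^(1-l) W Q\<close>. Used once, this bounds the \<open>\<omega>\<close>-portion of
      \<open>E Q\<close> by \<open>a^(1-l)\<close>; \<open>dom1\<close> then makes the \<open>\<mu>\<close>-portion small, and using the density bound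
      again improves the estimate of the \<open>\<omega>\<close>-portion to \<open>c\<close>.\<close>
    have EQ: "emeasure \<omega> (E Q) \<le> ennreal c * emeasure \<omega> Q" if Q: "Q \<in> Rl l" for Q
    proof -
      have Qc: "Q \<in> cells" and hQ: "0 < h Q" and Wl: "a ^ l * h Q \<le> W Q"
        using Q by (auto simp: Rl_def R_def)
      define t where "t = a powr (1 - real l)"
      have t: "0 < t" using a by (simp add: t_def)
      have "a * h Q = t * (a ^ l * h Q)"
        using a by (simp add: t_def powr_diff powr_realpow)
      also have "\<dots> \<le> t * W Q" using Wl t by simp
      finally have hhW: "hh Q \<le> t * W Q" using hh_le[OF hQ] by simp
      have "emeasure \<omega> (E Q) = (\<integral>\<^sup>+x\<in>E Q. ennreal (V x) \<partial>\<mu>)"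
        unfolding \<omega>_eq using Qc by (subst emeasure_density) auto
      also have "\<dots> \<le> (\<integral>\<^sup>+x. ennreal (t * W Q) * indicator (E Q) x \<partial>\<mu>)"
        using hhW by (intro nn_integral_mono) (auto split: split_indicator simp: E_def intro!: ennreal_leI)
      also have "\<dots> = ennreal (t * W Q) * emeasure \<mu> (E Q)"
        using Qc by (subst nn_integral_cmult_indicator) auto
      also have "\<dots> = ennreal (t * W Q * measure \<mu> (E Q))"
        using t W_pos[OF Qc] by (subst em\<mu>[OF Qc]) (auto simp: E_def ennreal_mult)
      finally have 1: "measure \<omega> (E Q) \<le> t * W Q * measure \<mu> (E Q)"
        using t W_pos[OF Qc] by (subst (asm) em\<omega>[OF Qc]) (auto simp: E_def ennreal_le_iff)
      have "measure \<mu> (E Q) \<le> measure \<mu> Q"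
        using Qc by (intro cell_measure_mono[OF \<mu> Qc]) (auto simp: E_def)
      then have "t * W Q * measure \<mu> (E Q) \<le> t * W Q * measure \<mu> Q"
        using t W_pos[OF Qc] by (intro mult_left_mono) auto
      then have 2: "measure \<omega> (E Q) / measure \<omega> Q \<le> t"
        using 1 pos\<omega>[OF Qc] by (simp add: W_eq[OF Qc] field_simps)
      have "measure \<mu> (E Q) \<le> C1 * (measure \<omega> (E Q) / measure \<omega> Q) powr \<delta>1 * measure \<mu> Q"
        using Qc by (intro dominatedD[OF dom1]) (auto simp: E_def sets_\<omega>)
      also have "\<dots> \<le> C1 * t powr \<delta>1 * measure \<mu> Q"
        using 2 C1 by (intro mult_right_mono mult_left_mono powr_mono2) auto
      finally have "t * W Q * measure \<mu> (E Q) \<le> t * W Q * (C1 * t powr \<delta>1 * measure \<mu> Q)"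
        using t W_pos[OF Qc] by (intro mult_left_mono) auto
      also have "\<dots> = (C1 * (t * t powr \<delta>1)) * measure \<omega> Q"
        by (simp add: W_eq[OF Qc])
      also have "C1 * (t * t powr \<delta>1) = c"
        using a by (simp add: t_def c_def powr_powr powr_add[symmetric] algebra_simps)
      finally have "measure \<omega> (E Q) \<le> c * measure \<omega> Q" using 1 by simp
      then show ?thesis
        using c0 Qc by (subst em\<omega>[OF Qc], force simp: E_def, subst em\<omega>[OF Qc order_refl])
          (simp add: ennreal_mult[symmetric] ennreal_leI)
    qed
    \<comment> \<open>Three levels are needed: rounding \<open>h\<close> and the width of the layer each lose one power of \<open>a\<close>, and
      the third one is the gain \<open>a W Q \<le> W Q'\<close>.\<close>
    have sparse: "(\<integral>\<^sup>+Q. 1 * emeasure \<omega> Q \<partial>count_space (Rl l))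
       \<le> 2 * of_nat 3 * (\<integral>\<^sup>+x\<in>\<Union>(Rl l). 1 \<partial>\<omega>)"
    proof (rule sparse_sum[OF Rl_cells \<omega>, where \<kappa> = \<kappa>])
      fix P Q assume "P \<in> Rl l" "Q \<in> Rl l" "Q \<subset> P"
      then show "\<kappa> P < \<kappa> Q" by (auto simp: Rl_def R_def)
    next
      fix Q assume Q: "Q \<in> Rl l"
      then have Qc: "Q \<in> cells" and hQ: "0 < h Q" and Wl: "W Q < a ^ Suc l * h Q"
        by (auto simp: Rl_def R_def)
      let ?F = "{Q' \<in> Rl l. Q' \<subseteq> Q \<and> \<kappa> Q + int 3 \<le> \<kappa> Q'}"
      have Fc: "?F \<subseteq> cells" using Rl_cells by auto
      have DQ: "\<Union>?F \<subseteq> Q" by auto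
      have Dm [measurable]: "\<Union>?F \<in> sets M" using Fc by (rule sets_Union_cells)
      have "emeasure \<mu> (\<Union>?F) \<le> ennreal (1 / (a * W Q)) * emeasure \<omega> (\<Union>?F)"
      proof (rule cover_le[OF Fc sets_\<omega> sets_\<mu>])
        fix Q' assume Q': "Q' \<in> ?F"
        then have Qc': "Q' \<in> cells" and hQ': "0 < h Q'" and Wl': "a ^ l * h Q' \<le> W Q'"
          by (auto simp: Rl_def R_def)
        have "a * W Q \<le> a * (a ^ Suc l * h Q)" using Wl a by simp
        also have "\<dots> \<le> a * (a ^ Suc l * hh Q)" using \<kappa>(2)[OF hQ] a by simp
        also have "\<dots> = a ^ l * a powr (of_int (\<kappa> Q + int 3))"
          using a by (simp add: hh_def powr_add eval_nat_numeral)
        also have "\<dots> \<le> a ^ l * a powr (of_int (\<kappa> Q'))"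
          using Q' a by (intro mult_left_mono powr_mono) auto
        also have "\<dots> \<le> a ^ l * h Q'" using \<kappa>(1)[OF hQ'] a by (intro mult_left_mono) auto
        finally have "a * W Q \<le> W Q'" using Wl' by simp
        then have "measure \<mu> Q' \<le> 1 / (a * W Q) * measure \<omega> Q'"
          using a W_pos[OF Qc] pos\<mu>[OF Qc'] by (simp add: W_eq[OF Qc'] field_simps)
        then show "emeasure \<mu> Q' \<le> ennreal (1 / (a * W Q)) * emeasure \<omega> Q'"
          using a W_pos[OF Qc] unfolding em\<mu>[OF Qc' order_refl] em\<omega>[OF Qc' order_refl]
          by (subst ennreal_mult[symmetric]) (auto intro: ennreal_leI)
      qed
      also have "\<dots> \<le> ennreal (1 / (a * W Q)) * emeasure \<omega> Q"
        using Qc DQ by (intro mult_left_mono emeasure_mono) (auto simp: sets_\<omega>)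
      also have "\<dots> = ennreal (1 / a * measure \<mu> Q)"
        unfolding em\<omega>[OF Qc order_refl] using a W_pos[OF Qc]
        by (subst ennreal_mult[symmetric]) (auto simp: W_eq[OF Qc] field_simps)
      finally have "measure \<mu> (\<Union>?F) \<le> 1 / a * measure \<mu> Q"
        using a pos\<mu>[OF Qc] by (subst (asm) em\<mu>[OF Qc DQ]) (simp add: ennreal_le_iff)
      then have frac: "measure \<mu> (\<Union>?F) / measure \<mu> Q \<le> 1 / a"
        using pos\<mu>[OF Qc] a by (simp add: field_simps)
      have "measure \<omega> (\<Union>?F) \<le> C2 * (measure \<mu> (\<Union>?F) / measure \<mu> Q) powr \<delta>2 * measure \<omega> Q"
        by (rule dominatedD[OF dom2 Qc _ DQ]) (simp only: sets_\<mu> Dm)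
      also have "\<dots> \<le> C2 * (1 / a) powr \<delta>2 * measure \<omega> Q"
        using frac C2 by (intro mult_right_mono mult_left_mono powr_mono2) auto
      also have "\<dots> \<le> 1 / 2 * measure \<omega> Q" using aC by (intro mult_right_mono) auto
      finally show "emeasure \<omega> (\<Union>?F) \<le> ennreal (1 / 2) * emeasure \<omega> Q"
        unfolding em\<omega>[OF Qc DQ] em\<omega>[OF Qc order_refl]
        by (subst ennreal_mult[symmetric]) (auto intro: ennreal_leI)
    qed auto
    have top_cells: "emeasure \<omega> (\<Union>(Rl l)) \<le> ennreal (a ^ Suc l) * emeasure \<mu> F"
    proof -
      have "emeasure \<omega> (\<Union>(Rl l)) \<le> ennreal (a ^ Suc l) * emeasure \<mu> (F \<inter> \<Union>(Rl l))"
      proof (rule cover_le_inter[OF Rl_cells sets_\<mu> sets_\<omega> F])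
        fix Q assume "Q \<in> Rl l"
        then have Qc: "Q \<in> cells" and Wl: "W Q < a ^ Suc l * h Q"
          by (auto simp: Rl_def R_def)
        have "measure \<omega> Q \<le> a ^ Suc l * measure \<mu> (F \<inter> Q)"
          using Wl pos\<mu>[OF Qc] by (simp add: W_eq[OF Qc] h_eq[OF Qc])
        then show "emeasure \<omega> Q \<le> ennreal (a ^ Suc l) * emeasure \<mu> (F \<inter> Q)"
          using a em\<mu>[OF Qc, of "F \<inter> Q"] unfolding em\<omega>[OF Qc order_refl]
          by (simp add: ennreal_mult[symmetric] ennreal_leI)
      qed
      also have "\<dots> \<le> ennreal (a ^ Suc l) * emeasure \<mu> F"
        by (intro mult_left_mono emeasure_mono) auto
      finally show ?thesis .
    qed
    have "emeasure \<omega> (\<Union>Q\<in>Rl l. E Q) \<le> (\<integral>\<^sup>+Q. emeasure \<omega> (E Q) \<partial>count_space (Rl l))"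
    proof (rule emeasure_UN_le_count_space[OF ctbl])
      show "E Q \<in> sets \<omega>" if "Q \<in> Rl l" for Q
        using that Rl_cells[of l] E_sets[of Q] by (auto simp: sets_\<omega>)
    qed
    also have "\<dots> \<le> (\<integral>\<^sup>+Q. ennreal c * emeasure \<omega> Q \<partial>count_space (Rl l))"
      by (intro nn_integral_mono) (auto intro: EQ)
    also have "\<dots> = ennreal c * (\<integral>\<^sup>+Q. 1 * emeasure \<omega> Q \<partial>count_space (Rl l))"
      by (simp add: nn_integral_cmult)
    also have "\<dots> \<le> ennreal c * (2 * of_nat 3 * (\<integral>\<^sup>+x\<in>\<Union>(Rl l). 1 \<partial>\<omega>))"
      by (intro mult_left_mono sparse) simp
    also have "(\<integral>\<^sup>+x\<in>\<Union>(Rl l). 1 \<partial>\<omega>) = emeasure \<omega> (\<Union>(Rl l))"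
      using sets_Union_cells[OF Rl_cells] by (simp add: sets_\<omega>)
    also have "ennreal c * (2 * of_nat 3 * emeasure \<omega> (\<Union>(Rl l)))
        \<le> ennreal c * (2 * of_nat 3 * (ennreal (a ^ Suc l) * emeasure \<mu> F))"
      by (intro mult_left_mono top_cells) simp_all
    also have "\<dots> = ennreal c * ennreal 6 * ennreal (a ^ Suc l) * emeasure \<mu> F"
      by (simp add: mult.assoc)
    also have "ennreal c * ennreal 6 * ennreal (a ^ Suc l) = ennreal (c * 6 * a ^ Suc l)"
      using c0 a by (simp add: ennreal_mult del: power_Suc)
    also have "c * 6 * a ^ Suc l = 6 * C1 * a powr (2 + \<delta>1) * (a powr (- \<delta>1)) ^ l"
    proof -
      have "a ^ Suc l = a powr (real (Suc l))" "(a powr (- \<delta>1)) ^ l = a powr (- \<delta>1 * real l)"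
        using a by (simp_all only: powr_realpow powr_power) (simp_all add: mult.commute)
      then have "c * 6 * a ^ Suc l = 6 * C1 * a powr ((1 - real l) * (1 + \<delta>1) + real (Suc l))"
        by (simp add: c_def powr_add)
      also have "(1 - real l) * (1 + \<delta>1) + real (Suc l) = (2 + \<delta>1) + (- \<delta>1 * real l)"
        by (simp add: algebra_simps)
      finally show ?thesis
        unfolding \<open>(a powr (- \<delta>1)) ^ l = a powr (- \<delta>1 * real l)\<close>
        by (simp only: powr_add[of a "2 + \<delta>1" "- \<delta>1 * real l"] mult.assoc)
    qed
    finally show ?thesis .
  qed
  have lt1: "a powr (- \<delta>1) < 1" using a C1 by (simp add: powr_less_one)
  have geo: "(\<lambda>l. 6 * C1 * a powr (2 + \<delta>1) * (a powr (- \<delta>1)) ^ l) sums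
      (6 * C1 * a powr (2 + \<delta>1) * (1 / (1 - a powr (- \<delta>1))))"
    using lt1 by (intro sums_mult geometric_sums) simp
  have Fm_c: "Fm \<subseteq> cells" by (auto simp: Fm_def)
  have UFm [measurable]: "\<Union>Fm \<in> sets M" using Fm_c by (rule sets_Union_cells)
  have UE [measurable]: "(\<Union>Q\<in>Rl l. E Q) \<in> sets M" for l
  proof -
    have "countable (Rl l)" using Rl_cells countable_cells by (rule countable_subset)
    moreover have "E Q \<in> sets M" if "Q \<in> Rl l" for Q
      using that Rl_cells[of l] E_sets[of Q] by auto
    ultimately show ?thesis by (intro sets.countable_UN') auto
  qed
  have "emeasure \<omega> (\<Union>l. \<Union>Q\<in>Rl l. E Q) \<le> (\<Sum>l. emeasure \<omega> (\<Union>Q\<in>Rl l. E Q))"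
    by (rule emeasure_subadditive_countably) (auto simp: sets_\<omega> intro: UE)
  also have "\<dots> \<le> (\<Sum>l. ennreal (6 * C1 * a powr (2 + \<delta>1) * (a powr (- \<delta>1)) ^ l) * emeasure \<mu> F)"
    by (intro suminf_le layer) auto
  also have "\<dots> = ennreal (6 * C1 * a powr (2 + \<delta>1) * (1 / (1 - a powr (- \<delta>1)))) * emeasure \<mu> F"
    unfolding ennreal_suminf_multc by (subst suminf_ennreal_eq[OF _ geo]) (use C1 in auto)
  finally have second: "emeasure \<omega> (\<Union>l. \<Union>Q\<in>Rl l. E Q)
      \<le> ennreal (6 * C1 * a powr (2 + \<delta>1) * (1 / (1 - a powr (- \<delta>1)))) * emeasure \<mu> F" .
  have "emeasure \<omega> ?B \<le> emeasure \<omega> (\<Union>Fm \<union> (\<Union>l. \<Union>Q\<in>Rl l. E Q))"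
    by (rule emeasure_mono[OF cover]) measurable
  also have "\<dots> \<le> emeasure \<omega> (\<Union>Fm) + emeasure \<omega> (\<Union>l. \<Union>Q\<in>Rl l. E Q)"
    by (rule emeasure_subadditive) measurable
  also have "\<dots> \<le> emeasure \<mu> F
      + ennreal (6 * C1 * a powr (2 + \<delta>1) * (1 / (1 - a powr (- \<delta>1)))) * emeasure \<mu> F"
    by (intro add_mono first second)
  also have "\<dots> = ennreal (1 + 6 * C1 * a powr (2 + \<delta>1) / (1 - a powr (- \<delta>1))) * emeasure \<mu> F"
    using lt1 C1 by (subst ennreal_plus) (auto simp: algebra_simps)
  finally show ?thesis .
qed

text \<open>
  The parameter \<open>s\<close> comes for free, since \<open>dominated\<close> does not change when \<open>\<omega>\<close> is multiplied by
  a positive constant.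
\<close>

lemma mixed_weak_type:
  fixes V :: "'a \<Rightarrow> real"
  assumes \<mu>: "cell_measure \<mu>" and \<omega>: "cell_measure \<omega>"
    and \<omega>_eq: "\<omega> = density \<mu> (\<lambda>x. ennreal (V x))"
    and V [measurable]: "V \<in> borel_measurable M" and V_nonneg: "\<And>x. 0 \<le> V x"
    and dom1: "dominated cells C1 \<delta>1 \<omega> \<mu>" and C1: "0 < C1" "0 < \<delta>1"
    and dom2: "dominated cells C2 \<delta>2 \<mu> \<omega>" and C2: "0 < C2" "0 < \<delta>2"
    and a: "1 < a" and aC: "C2 * (1 / a) powr \<delta>2 \<le> 1 / 2"
    and F [measurable]: "F \<in> sets M" and s: "0 < s"
  shows "emeasure \<omega> {x. \<exists>k. s * V x * measure \<mu> (cell k x) < measure \<mu> (F \<inter> cell k x)}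
     \<le> ennreal ((1 + 6 * C1 * a powr (2 + \<delta>1) / (1 - a powr (- \<delta>1))) / s) * emeasure \<mu> F"
    (is "emeasure \<omega> ?B \<le> ennreal (?K / s) * _")
proof -
  have sets_\<mu> [measurable_cong]: "sets \<mu> = sets M" using \<mu> by (simp add: cell_measure_def)
  have sets_\<omega> [measurable_cong]: "sets \<omega> = sets M" using \<omega> by (simp add: cell_measure_def)
  define \<omega>' where "\<omega>' = density \<mu> (\<lambda>x. ennreal (s * V x))"
  have sets_\<omega>' [measurable_cong]: "sets \<omega>' = sets M" by (simp add: \<omega>'_def sets_\<mu>)
  have V\<mu> [measurable]: "V \<in> borel_measurable \<mu>" by measurable
  have e: "emeasure \<omega>' A = ennreal s * emeasure \<omega> A" for A
  proof (cases "A \<in> sets M")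
    case True
    then have [measurable]: "A \<in> sets \<mu>" by (simp add: sets_\<mu>)
    have "emeasure \<omega>' A = (\<integral>\<^sup>+x. ennreal s * (ennreal (V x) * indicator A x) \<partial>\<mu>)"
      unfolding \<omega>'_def using s V_nonneg by (simp add: emeasure_density ennreal_mult mult.assoc)
    also have "\<dots> = ennreal s * emeasure \<omega> A"
      unfolding \<omega>_eq by (simp add: emeasure_density nn_integral_cmult)
    finally show ?thesis .
  qed (simp add: emeasure_notin_sets sets_\<omega> sets_\<omega>')
  have m: "measure \<omega>' A = s * measure \<omega> A" for A
    using s by (simp add: measure_def e enn2real_mult)
  have \<omega>': "cell_measure \<omega>'"
    using \<omega> s by (auto simp: cell_measure_def e sets_\<omega>' ennreal_zero_less_mult_iff ennreal_mult_less_top)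
  have d1: "dominated cells C1 \<delta>1 \<omega>' \<mu>" and d2: "dominated cells C2 \<delta>2 \<mu> \<omega>'"
    using dom1 dom2 s by (auto simp: dominated_def m sets_\<omega> sets_\<omega>' mult.assoc mult.left_commute[of _ s])
  have "emeasure \<omega>' ?B \<le> ennreal ?K * emeasure \<mu> F"
    using s V_nonneg
    by (intro mixed_weak_type_unit[OF \<mu> \<omega>' \<omega>'_def _ _ d1 C1 d2 C2 a aC F]) auto
  then have "ennreal (1 / s) * (ennreal s * emeasure \<omega> ?B) \<le> ennreal (1 / s) * (ennreal ?K * emeasure \<mu> F)"
    unfolding e by (rule mult_left_mono) simp
  also have "ennreal (1 / s) * (ennreal s * emeasure \<omega> ?B) = emeasure \<omega> ?B"
    using s by (simp add: mult.assoc[symmetric] ennreal_mult[symmetric])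
  also have "ennreal (1 / s) * (ennreal ?K * emeasure \<mu> F) = ennreal (?K / s) * emeasure \<mu> F"
    using s by (simp add: mult.assoc[symmetric] ennreal_mult'[symmetric])
  finally show ?thesis .
qed

end

section \<open>Sparse sums and their weak-type bound\<close>

text \<open>
  If the sum \<open>s\<close> of the powers is finite, then each \<open>\<tau> i\<close> is at most \<open>s^(1/\<epsilon>)\<close>, hence at most
  \<open>s^((1-\<epsilon>)/\<epsilon>)\<close> times its own power \<open>\<epsilon>\<close>. Summation gives that the sum of the \<open>\<tau> i\<close>
  is at most \<open>s^(1/\<epsilon>)\<close>.
\<close>

lemma powr_count_space_subadditive:
  fixes \<tau> :: "'b \<Rightarrow> real"
  assumes \<tau>: "\<And>i. i \<in> I \<Longrightarrow> 0 \<le> \<tau> i" and \<epsilon>: "0 < \<epsilon>" "\<epsilon> \<le> 1" and c: "0 < c"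
    and less: "ennreal c < (\<integral>\<^sup>+i. ennreal (\<tau> i) \<partial>count_space I)"
  shows "ennreal (c powr \<epsilon>) \<le> (\<integral>\<^sup>+i. ennreal (\<tau> i powr \<epsilon>) \<partial>count_space I)" (is "_ \<le> ?S")
proof (rule ccontr)
  assume "\<not> ?thesis"
  then have lt: "?S < ennreal (c powr \<epsilon>)" by simp
  then obtain s where s: "?S = ennreal s" "0 \<le> s" by (cases ?S) auto
  have sc: "s < c powr \<epsilon>" using lt s by (simp add: ennreal_less_iff)
  have le: "ennreal (\<tau> i) \<le> ennreal (s powr ((1 - \<epsilon>) / \<epsilon>)) * ennreal (\<tau> i powr \<epsilon>)" if i: "i \<in> I" for i
  proof (cases "\<tau> i = 0")
    case False
    then have pos: "0 < \<tau> i" using \<tau>[OF i] by simp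
    have "ennreal (\<tau> i powr \<epsilon>) \<le> ennreal s"
      unfolding s(1)[symmetric] using i by (rule nn_integral_ge_point)
    then have "\<tau> i powr \<epsilon> \<le> s" using s by (simp add: ennreal_le_iff)
    then have "(\<tau> i powr \<epsilon>) powr ((1 - \<epsilon>) / \<epsilon>) \<le> s powr ((1 - \<epsilon>) / \<epsilon>)"
      using \<epsilon> by (intro powr_mono2) auto
    then have "\<tau> i powr (1 - \<epsilon>) \<le> s powr ((1 - \<epsilon>) / \<epsilon>)" using \<epsilon> by (simp add: powr_powr)
    then have "\<tau> i powr (1 - \<epsilon>) * \<tau> i powr \<epsilon> \<le> s powr ((1 - \<epsilon>) / \<epsilon>) * \<tau> i powr \<epsilon>"
      by (rule mult_right_mono) simp
    moreover have "\<tau> i powr (1 - \<epsilon>) * \<tau> i powr \<epsilon> = \<tau> i" using pos by (simp add: powr_add[symmetric])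
    ultimately show ?thesis by (simp add: ennreal_mult[symmetric] ennreal_leI)
  qed simp
  have "(\<integral>\<^sup>+i. ennreal (\<tau> i) \<partial>count_space I)
      \<le> (\<integral>\<^sup>+i. ennreal (s powr ((1 - \<epsilon>) / \<epsilon>)) * ennreal (\<tau> i powr \<epsilon>) \<partial>count_space I)"
    by (intro nn_integral_mono) (auto intro: le)
  also have "\<dots> = ennreal (s powr ((1 - \<epsilon>) / \<epsilon>)) * ennreal s"
    by (simp add: nn_integral_cmult s)
  also have "\<dots> = ennreal (s powr ((1 - \<epsilon>) / \<epsilon>) * s)" using s by (simp add: ennreal_mult)
  also have "s powr ((1 - \<epsilon>) / \<epsilon>) * s = s powr (1 / \<epsilon>)"
  proof (cases "s = 0")
    case False
    then have "s powr ((1 - \<epsilon>) / \<epsilon>) * s powr 1 = s powr ((1 - \<epsilon>) / \<epsilon> + 1)" by (simp add: powr_add)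
    also have "(1 - \<epsilon>) / \<epsilon> + 1 = 1 / \<epsilon>" using \<epsilon> by (simp add: field_simps)
    finally show ?thesis using False s by simp
  qed simp
  also have "ennreal (s powr (1 / \<epsilon>)) \<le> ennreal ((c powr \<epsilon>) powr (1 / \<epsilon>))"
    using s sc \<epsilon> by (intro ennreal_leI powr_mono2) auto
  also have "(c powr \<epsilon>) powr (1 / \<epsilon>) = c" using c \<epsilon> by (simp add: powr_powr)
  finally show False using less by simp
qed

context cell_grid
begin

lemma ex_cell_eq_Union: "{x. \<exists>k. P (cell k x)} = \<Union>{Q \<in> cells. P Q}"
proof (intro set_eqI iffI)
  fix x assume "x \<in> {x. \<exists>k. P (cell k x)}"
  then obtain k where "P (cell k x)" by auto
  then show "x \<in> \<Union>{Q \<in> cells. P Q}" using cell_self[of x k] by (intro UnionI[of "cell k x"]) auto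
next
  fix x assume "x \<in> \<Union>{Q \<in> cells. P Q}"
  then obtain Q where "Q \<in> cells" "P Q" "x \<in> Q" by auto
  then show "x \<in> {x. \<exists>k. P (cell k x)}" using cells_at[of Q x] by auto
qed

lemma borel_measurable_cell_fun:
  fixes G :: "'a set \<Rightarrow> 'b::topological_space"
  shows "(\<lambda>x. G (cell k x)) \<in> borel_measurable M"
proof (rule measurableI)
  fix A :: "'b set" assume "A \<in> sets borel"
  have "(\<lambda>x. G (cell k x)) -` A \<inter> space M = \<Union>{Q \<in> range (cell k). G Q \<in> A}"
    using cell_self cell_eq by (fastforce simp: space_M)
  moreover have "\<Union>{Q \<in> range (cell k). G Q \<in> A} \<in> sets M"
    by (rule sets_Union_cells) auto
  ultimately show "(\<lambda>x. G (cell k x)) -` A \<inter> space M \<in> sets M" by simp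
qed simp

text \<open>
  The maximal function \<open>ms\<close> of the indicator of \<open>H\<close> is at most 1 and of weak type (1,1), so it is
  dominated by the sum of \<open>2^(-j)\<close> times indicators of sets \<open>X j\<close> of measure at most
  \<open>2^(j+1) \<omega>(H)\<close>. Kolmogorov's inequality on \<open>X j\<close> costs the factor \<open>2^((j+1)(1-1/q))\<close>,
  which leaves the convergent series of \<open>2^(-j/q)\<close>. This is the duality of weak \<open>L^q\<close> with a
  Lorentz space, in the one case that is needed.
\<close>

lemma maximal_pairing:
  fixes \<phi> :: "'a \<Rightarrow> ennreal" and ms :: "'a \<Rightarrow> real"
  assumes \<omega>: "cell_measure \<omega>" and H: "H \<in> sets M" "emeasure \<omega> H < \<infinity>"
    and q: "1 < q" and A: "0 < A" and \<phi> [measurable]: "\<phi> \<in> borel_measurable M"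
    and weak: "\<And>y. 0 < y \<Longrightarrow> emeasure \<omega> {x. ennreal y < \<phi> x} \<le> ennreal (A * y powr (- q))"
    and ms: "\<And>x. ms x = (SUP k. measure \<omega> (H \<inter> cell k x) / measure \<omega> (cell k x))"
  shows "(\<integral>\<^sup>+x. \<phi> x * ennreal (ms x) \<partial>\<omega>)
    \<le> ennreal ((1 + 2 / (1 - 2 powr (1 - q))) * 2 powr (1 - 1 / q) / (1 - 2 powr (- (1 / q)))
         * A powr (1 / q) * measure \<omega> H powr (1 - 1 / q))"
proof -
  define K where "K = 1 + 2 / (1 - 2 powr (1 - q))"
  define h where "h = measure \<omega> H"
  define \<theta> where "\<theta> = 1 - 1 / q"
  have K: "0 < K" unfolding K_def using q by (intro add_pos_nonneg) (auto simp: powr_less_one less_imp_le)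
  have \<theta>: "0 < \<theta>" "\<theta> < 1" using q by (auto simp: \<theta>_def)
  have sets_\<omega> [measurable_cong]: "sets \<omega> = sets M" using \<omega> by (simp add: cell_measure_def)
  have space_\<omega>: "space \<omega> = UNIV" using sets_eq_imp_space_eq[OF sets_\<omega>] space_M by simp
  have emH: "emeasure \<omega> H = ennreal h" using H by (simp add: h_def emeasure_eq_ennreal_measure less_top)
  let ?r = "\<lambda>Q. measure \<omega> (H \<inter> Q) / measure \<omega> Q"
  have r01: "0 \<le> ?r Q" "?r Q \<le> 1" if "Q \<in> cells" for Q
  proof -
    have "measure \<omega> (H \<inter> Q) \<le> measure \<omega> Q"
      using that by (intro cell_measure_mono[OF \<omega> that]) auto
    then show "?r Q \<le> 1" using cell_measure_pos[OF \<omega> that] by simp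
  qed simp
  have bdd: "bdd_above (range (\<lambda>k. ?r (cell k x)))" for x
    using r01 by (intro bdd_aboveI[of _ 1]) auto
  have ms_less: "c < ms x \<longleftrightarrow> (\<exists>k. c < ?r (cell k x))" for c x
    unfolding ms using bdd by (subst less_cSUP_iff) auto
  have ms01: "0 \<le> ms x" "ms x \<le> 1" for x
  proof -
    have "?r (cell 0 x) \<le> ms x" unfolding ms using bdd by (intro cSUP_upper) auto
    then show "0 \<le> ms x" by (rule order_trans[rotated]) simp
    show "ms x \<le> 1" unfolding ms using r01 by (intro cSUP_least) auto
  qed
  define X where "X j = {x. (1/2) ^ Suc j < ms x}" for j
  have X_eq: "X j = \<Union>{Q \<in> cells. (1/2) ^ Suc j < ?r Q}" for j
    unfolding X_def ms_less by (rule ex_cell_eq_Union)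
  have X_sets [measurable]: "X j \<in> sets M" for j
    unfolding X_eq by (rule sets_Union_cells) auto
  have X_le: "emeasure \<omega> (X j) \<le> ennreal (2 ^ Suc j * h)" for j
  proof -
    have "emeasure \<omega> (X j) \<le> ennreal (2 ^ Suc j) * emeasure \<omega> (H \<inter> X j)"
      unfolding X_eq
    proof (rule cover_le_inter[OF _ sets_\<omega> sets_\<omega> H(1)])
      fix Q assume "Q \<in> {Q \<in> cells. (1/2) ^ Suc j < ?r Q}"
      then have Q: "Q \<in> cells" "(1/2) ^ Suc j < ?r Q" by auto
      then have "measure \<omega> Q \<le> 2 ^ Suc j * measure \<omega> (H \<inter> Q)"
        using cell_measure_pos[OF \<omega> Q(1)] by (simp add: field_simps power_divide)
      then show "emeasure \<omega> Q \<le> ennreal (2 ^ Suc j) * emeasure \<omega> (H \<inter> Q)"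
        using cell_measure_emeasure[OF \<omega> Q(1), of "H \<inter> Q"] cell_measure_emeasure[OF \<omega> Q(1) order_refl]
        by (simp add: ennreal_mult[symmetric] ennreal_leI del: power_Suc)
    qed auto
    also have "\<dots> \<le> ennreal (2 ^ Suc j) * emeasure \<omega> H"
      using H by (intro mult_left_mono emeasure_mono) (auto simp: sets_\<omega>)
    finally show ?thesis by (simp add: emH ennreal_mult h_def)
  qed
  have pw: "ennreal (ms x) \<le> (\<Sum>j. ennreal ((1/2) ^ j) * indicator (X j) x)" for x
  proof (cases "ms x = 0")
    case False
    then have pos: "0 < ms x" using ms01[of x] by simp
    have ex: "\<exists>j. (1/2) ^ Suc j < ms x"
    proof -
      obtain n where "(1/2) ^ n < ms x" using real_arch_pow_inv[OF pos, of "1/2"] by auto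
      then have "(1/2) ^ Suc n < ms x" by simp (use zero_le_power[of "1/2::real" n] in linarith)
      then show ?thesis by blast
    qed
    define j where "j = (LEAST j. (1/2) ^ Suc j < ms x)"
    have j: "(1/2) ^ Suc j < ms x" unfolding j_def using ex by (rule LeastI_ex)
    have "ms x \<le> (1/2) ^ j"
    proof (cases j)
      case 0
      then show ?thesis using ms01[of x] by simp
    next
      case (Suc i)
      then have "\<not> (1/2) ^ Suc i < ms x" unfolding j_def by (metis lessI not_less_Least)
      then show ?thesis using Suc by simp
    qed
    then have "ennreal (ms x) \<le> (\<Sum>i\<in>{j}. ennreal ((1/2) ^ i) * indicator (X i) x)"
      using j by (simp add: X_def ennreal_leI)
    also have "\<dots> \<le> (\<Sum>j. ennreal ((1/2) ^ j) * indicator (X j) x)" by (rule sum_le_suminf) auto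
    finally show ?thesis .
  qed simp
  define D where "D = K * A powr (1 / q) * 2 powr \<theta> * h powr \<theta>"
  have D: "0 \<le> D" using K by (simp add: D_def)
  have \<phi>X: "(\<integral>\<^sup>+x\<in>X j. \<phi> x \<partial>\<omega>) \<le> ennreal (D * (2 powr \<theta>) ^ j)" for j
  proof -
    have fin: "emeasure \<omega> (X j) < \<infinity>" using X_le[of j] by (auto intro: le_less_trans)
    have "(\<integral>\<^sup>+x\<in>X j. \<phi> x \<partial>\<omega>) \<le> ennreal (K * A powr (1 / q) * measure \<omega> (X j) powr \<theta>)"
      unfolding K_def \<theta>_def
      by (rule weak_type_set_integral[OF _ _ q A _ fin]) (use weak in \<open>auto simp: space_\<omega>\<close>)
    also have "\<dots> \<le> ennreal (K * A powr (1 / q) * (2 ^ Suc j * h) powr \<theta>)"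
    proof (intro ennreal_leI mult_left_mono powr_mono2)
      show "measure \<omega> (X j) \<le> 2 ^ Suc j * h"
        using X_le[of j] fin by (simp add: emeasure_eq_ennreal_measure less_top h_def ennreal_le_iff del: power_Suc)
    qed (use \<theta> K in auto)
    also have "(2 ^ Suc j * h) powr \<theta> = 2 powr \<theta> * (2 powr \<theta>) ^ j * h powr \<theta>"
    proof -
      have "(2 ^ Suc j) powr \<theta> = (2 powr \<theta>) ^ Suc j"
        by (simp only: powr_realpow[symmetric] zero_less_numeral powr_powr powr_power mult.commute)
      then show ?thesis by (simp add: powr_mult h_def)
    qed
    finally show ?thesis by (simp add: D_def mult_ac)
  qed
  have lt1: "2 powr (- (1 / q)) < (1::real)" using q by (simp add: powr_less_one)
  have geo: "(\<lambda>j. D * (2 powr (- (1 / q))) ^ j) sums (D * (1 / (1 - 2 powr (- (1 / q)))))"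
    using lt1 by (intro sums_mult geometric_sums) simp
  have "(\<integral>\<^sup>+x. \<phi> x * ennreal (ms x) \<partial>\<omega>)
      \<le> (\<integral>\<^sup>+x. (\<Sum>j. ennreal ((1/2) ^ j) * (\<phi> x * indicator (X j) x)) \<partial>\<omega>)"
  proof (rule nn_integral_mono)
    fix x
    have "\<phi> x * ennreal (ms x) \<le> \<phi> x * (\<Sum>j. ennreal ((1/2) ^ j) * indicator (X j) x)"
      by (intro mult_left_mono pw) simp
    also have "\<dots> = (\<Sum>j. \<phi> x * (ennreal ((1/2) ^ j) * indicator (X j) x))"
      by (rule ennreal_suminf_cmult[symmetric])
    finally show "\<phi> x * ennreal (ms x) \<le> (\<Sum>j. ennreal ((1/2) ^ j) * (\<phi> x * indicator (X j) x))"
      by (simp only: mult.left_commute)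
  qed
  also have "\<dots> = (\<Sum>j. ennreal ((1/2) ^ j) * (\<integral>\<^sup>+x\<in>X j. \<phi> x \<partial>\<omega>))"
    by (subst nn_integral_suminf) (auto simp: nn_integral_cmult)
  also have "\<dots> \<le> (\<Sum>j. ennreal (D * (2 powr (- (1 / q))) ^ j))"
  proof (rule suminf_le)
    fix j
    have "ennreal ((1/2) ^ j) * (\<integral>\<^sup>+x\<in>X j. \<phi> x \<partial>\<omega>) \<le> ennreal ((1/2) ^ j) * ennreal (D * (2 powr \<theta>) ^ j)"
      by (intro mult_left_mono \<phi>X) simp
    also have "\<dots> = ennreal (D * ((1/2) * 2 powr \<theta>) ^ j)"
      using D by (simp only: power_mult_distrib) (simp add: ennreal_mult[symmetric] mult_ac)
    also have "(1/2) * 2 powr \<theta> = (2 powr (- (1 / q)) :: real)"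
      by (simp add: \<theta>_def powr_diff powr_minus field_simps)
    finally show "ennreal ((1/2) ^ j) * (\<integral>\<^sup>+x\<in>X j. \<phi> x \<partial>\<omega>) \<le> ennreal (D * (2 powr (- (1 / q))) ^ j)" .
  qed auto
  also have "\<dots> = ennreal (D * (1 / (1 - 2 powr (- (1 / q)))))"
    using D by (intro suminf_ennreal_eq[OF _ geo]) auto
  finally show ?thesis
    by (simp add: D_def K_def h_def \<theta>_def mult_ac)
qed

end

text \<open>
  Two weights on one grid. Here \<open>\<omega>\<close> is the measure \<open>u v^p\<close>, the condition \<open>dom1\<close> comes from
  \<open>u \<in> A_p^R\<close>, \<open>dom3\<close> from the reverse Hoelder condition on \<open>v^(-\<epsilon>)\<close>, and \<open>dom4\<close> says
  that \<open>\<rho>\<close> is an \<open>A_\<infinity>\<close> measure. The constant \<open>a\<close> is the ratio of consecutive levels in the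
  selection of principal cells; \<open>aC\<close> makes that selection sparse for \<open>\<rho>\<close>. The assumption \<open>weak\<close>
  is the conclusion of the mixed weak-type inequality. All constants are parameters, so that they can be
  chosen independently of the grid.
\<close>

locale weighted_grid = cell_grid M cell
  for M :: "'a measure" and cell :: "nat \<Rightarrow> 'a \<Rightarrow> 'a set" +
  fixes u v :: "'a \<Rightarrow> real" and p \<epsilon> C1 C3 C4 \<delta>4 a K :: real and \<mu> \<omega> \<rho> :: "'a measure"
  assumes p: "1 < p" and \<epsilon>: "0 < \<epsilon>" "\<epsilon> \<le> 1"
    and u [measurable]: "u \<in> borel_measurable M" and u_pos: "\<And>x. 0 < u x"
    and v [measurable]: "v \<in> borel_measurable M" and v_pos: "\<And>x. 0 < v x"
    and cM: "cell_measure M" and c\<mu>: "cell_measure \<mu>" and c\<omega>: "cell_measure \<omega>" and c\<rho>: "cell_measure \<rho>"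
    and \<mu>_eq: "\<mu> = density M (\<lambda>x. ennreal (u x))"
    and \<omega>_eq: "\<omega> = density \<mu> (\<lambda>x. ennreal (v x powr p))"
    and \<rho>_eq: "\<rho> = density \<omega> (\<lambda>x. ennreal (v x powr (- \<epsilon>)))"
    and dom1: "dominated cells C1 (1 / p) \<mu> M" and C1: "0 < C1"
    and dom3: "dominated cells C3 1 \<omega> \<rho>" and C3: "0 < C3"
    and dom4: "dominated cells C4 \<delta>4 M \<rho>" and C4: "0 < C4" "0 < \<delta>4"
    and a: "1 < a" and aC: "C4 * (1 / a) powr \<delta>4 \<le> 1 / 2"
    and K: "0 < K"
    and weak: "\<And>s G. 0 < s \<Longrightarrow> G \<in> sets M \<Longrightarrow> emeasure \<omega>
        {x. \<exists>k. s * v x powr p * measure \<mu> (cell k x) < measure \<mu> (G \<inter> cell k x)}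
          \<le> ennreal (K / s) * emeasure \<mu> G"
begin

lemma sets_\<mu> [measurable_cong]: "sets \<mu> = sets M"
  and sets_\<omega> [measurable_cong]: "sets \<omega> = sets M"
  and sets_\<rho> [measurable_cong]: "sets \<rho> = sets M"
  using c\<mu> c\<omega> c\<rho> by (simp_all add: cell_measure_def)

lemma space_\<omega>: "space \<omega> = UNIV"
  using sets_eq_imp_space_eq[OF sets_\<omega>] space_M by simp

text \<open>
  Let \<open>\<tau> Q = |G \<inter> Q| / |Q|\<close>. On \<open>H\<close>, the \<open>\<epsilon>\<close>-th power of the sum of \<open>\<tau> Q\<close> is at most
  the sum of the \<open>\<epsilon>\<close>-th powers; integration against \<open>\<omega>\<close> with the factor \<open>v^(-\<epsilon>)\<close> produces
  \<open>\<rho>(H \<inter> Q)\<close>, which \<open>dom3\<close> compares with \<open>\<rho>(Q)\<close>. After sparseness has turned the sum into an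
  integral, the factor \<open>v^(-\<epsilon>)\<close> in \<open>\<rho>\<close> recombines with the maximal function \<open>mg\<close> of the indicator
  of \<open>G\<close> to \<open>(mg / v)^\<epsilon>\<close>. This function is in weak \<open>L^{p/\<epsilon>}(\<omega>)\<close> by \<open>dom1\<close> and
  \<open>weak\<close>. The result is \<open>t^\<epsilon> \<omega>(H) \<le> D m^(1/q) \<omega>(H)^(1-1/q)\<close>, in which the finite
  quantity \<open>\<omega>(H)^(1-1/q)\<close> cancels.
\<close>

lemma sparse_operator_weak_type:
  fixes t :: real
  defines "q \<equiv> p / \<epsilon>"
  assumes t: "0 < t"
    and G: "G \<in> sets M" "emeasure \<mu> G = ennreal m" "0 < m"
    and R: "R \<subseteq> cells"
    and sparse: "\<And>c \<psi>. (\<And>Q x. Q \<in> R \<Longrightarrow> x \<in> Q \<Longrightarrow> c Q \<le> \<psi> x) \<Longrightarrow> \<psi> \<in> borel_measurable M \<Longrightarrow>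
        (\<integral>\<^sup>+Q. c Q * emeasure \<rho> Q \<partial>count_space R) \<le> 4 * (\<integral>\<^sup>+x. \<psi> x \<partial>\<rho>)"
    and H: "H \<in> sets M" "emeasure \<omega> H < \<infinity>"
    and level: "\<And>x. x \<in> H \<Longrightarrow> ennreal (t * v x) <
        (\<integral>\<^sup>+Q. ennreal (measure M (G \<inter> Q) / measure M Q) * indicator Q x \<partial>count_space R)"
  shows "measure \<omega> H * t powr p \<le>
     (4 * C3 * ((1 + 2 / (1 - 2 powr (1 - q))) * 2 powr (1 - 1 / q) / (1 - 2 powr (- (1 / q))))
        * (K * C1 powr p) powr (1 / q)) powr q * m"
proof -
  have q: "1 < q" using p \<epsilon> by (simp add: q_def)
  define K2 where "K2 = (1 + 2 / (1 - 2 powr (1 - q))) * 2 powr (1 - 1 / q) / (1 - 2 powr (- (1 / q)))"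
  define h where "h = measure \<omega> H"
  note [measurable] = G(1) H(1)
  define \<tau> where "\<tau> Q = measure M (G \<inter> Q) / measure M Q" for Q
  define r where "r Q = measure \<omega> (H \<inter> Q) / measure \<omega> Q" for Q
  have \<tau>01: "0 \<le> \<tau> Q" "\<tau> Q \<le> 1" if "Q \<in> cells" for Q
  proof -
    have "measure M (G \<inter> Q) \<le> measure M Q"
      using that by (intro cell_measure_mono[OF cM that]) auto
    then show "\<tau> Q \<le> 1" using cell_measure_pos[OF cM that] by (simp add: \<tau>_def)
  qed (simp add: \<tau>_def)
  have r01: "0 \<le> r Q" "r Q \<le> 1" if "Q \<in> cells" for Q
  proof -
    have "measure \<omega> (H \<inter> Q) \<le> measure \<omega> Q"
      using that by (intro cell_measure_mono[OF c\<omega> that]) auto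
    then show "r Q \<le> 1" using cell_measure_pos[OF c\<omega> that] by (simp add: r_def)
  qed (simp add: r_def)
  define mg where "mg x = (SUP k. \<tau> (cell k x))" for x
  define ms where "ms x = (SUP k. r (cell k x))" for x
  have bdd_\<tau>: "bdd_above (range (\<lambda>k. \<tau> (cell k x)))" and bdd_r: "bdd_above (range (\<lambda>k. r (cell k x)))" for x
    using \<tau>01 r01 by (auto intro!: bdd_aboveI[of _ 1])
  have [measurable]: "(\<lambda>x. \<tau> (cell k x)) \<in> borel_measurable M" "(\<lambda>x. r (cell k x)) \<in> borel_measurable M" for k
    by (rule borel_measurable_cell_fun)+
  have mg_meas [measurable]: "mg \<in> borel_measurable M" and ms_meas [measurable]: "ms \<in> borel_measurable M"
    unfolding mg_def ms_def using bdd_\<tau> bdd_r by (intro borel_measurable_cSUP; auto)+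
  have mg_ge: "\<tau> Q \<le> mg x" and ms_ge: "r Q \<le> ms x" if Qx: "Q \<in> cells" "x \<in> Q" for Q x
  proof -
    obtain k where "Q = cell k x" using cells_at[OF Qx] by auto
    then show "\<tau> Q \<le> mg x" "r Q \<le> ms x"
      unfolding mg_def ms_def using bdd_\<tau> bdd_r by (auto intro!: cSUP_upper)
  qed
  have mg0: "0 \<le> mg x" and ms0: "0 \<le> ms x" for x
    using mg_ge[of "cell 0 x" x] \<tau>01[of "cell 0 x"] ms_ge[of "cell 0 x" x] r01[of "cell 0 x"] cell_self by fastforce+
  have ctbl: "countable R" using R countable_cells by (rule countable_subset)
  have Rs [measurable]: "Q \<in> sets M" if "Q \<in> R" for Q using that R sets_cells by auto
  have lower: "ennreal (t powr \<epsilon>) \<le>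
      (\<integral>\<^sup>+Q. ennreal (\<tau> Q powr \<epsilon>) * (ennreal (v x powr (- \<epsilon>)) * indicator Q x) \<partial>count_space R)"
    if x: "x \<in> H" for x
  proof -
    have "ennreal (t * v x) < (\<integral>\<^sup>+Q. ennreal (\<tau> Q * indicator Q x) \<partial>count_space R)"
      using level[OF x] unfolding \<tau>_def[symmetric]
      by (rule less_le_trans) (intro nn_integral_mono, auto split: split_indicator)
    then have "ennreal ((t * v x) powr \<epsilon>) \<le> (\<integral>\<^sup>+Q. ennreal ((\<tau> Q * indicator Q x) powr \<epsilon>) \<partial>count_space R)"
      using R \<tau>01 t v_pos[of x] by (intro powr_count_space_subadditive \<epsilon>) auto
    then have "ennreal (v x powr (- \<epsilon>)) * ennreal ((t * v x) powr \<epsilon>)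
        \<le> ennreal (v x powr (- \<epsilon>)) * (\<integral>\<^sup>+Q. ennreal ((\<tau> Q * indicator Q x) powr \<epsilon>) \<partial>count_space R)"
      by (rule mult_left_mono) simp
    also have "ennreal (v x powr (- \<epsilon>)) * ennreal ((t * v x) powr \<epsilon>) = ennreal (t powr \<epsilon>)"
      using t v_pos[of x]
      by (simp add: ennreal_mult[symmetric] powr_mult powr_minus less_imp_neq[symmetric] field_simps)
    also have "ennreal (v x powr (- \<epsilon>)) * (\<integral>\<^sup>+Q. ennreal ((\<tau> Q * indicator Q x) powr \<epsilon>) \<partial>count_space R)
       = (\<integral>\<^sup>+Q. ennreal (v x powr (- \<epsilon>)) * ennreal ((\<tau> Q * indicator Q x) powr \<epsilon>) \<partial>count_space R)"
      by (rule nn_integral_cmult[symmetric]) simp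
    also have "\<dots> = (\<integral>\<^sup>+Q. ennreal (\<tau> Q powr \<epsilon>) * (ennreal (v x powr (- \<epsilon>)) * indicator Q x) \<partial>count_space R)"
      using \<epsilon> by (intro nn_integral_cong) (auto split: split_indicator simp: mult.commute)
    finally show ?thesis .
  qed
  have \<rho>_int: "emeasure \<rho> (H \<inter> Q) = (\<integral>\<^sup>+x\<in>H. (ennreal (v x powr (- \<epsilon>)) * indicator Q x) \<partial>\<omega>)"
    if "Q \<in> R" for Q
    unfolding \<rho>_eq using that Rs[OF that]
    by (subst emeasure_density) (auto intro!: nn_integral_cong split: split_indicator)
  have "ennreal (t powr \<epsilon>) * emeasure \<omega> H = (\<integral>\<^sup>+x\<in>H. ennreal (t powr \<epsilon>) \<partial>\<omega>)"
    by (simp add: nn_integral_cmult_indicator)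
  also have "\<dots> \<le> (\<integral>\<^sup>+x. (\<integral>\<^sup>+Q. ennreal (\<tau> Q powr \<epsilon>) * (ennreal (v x powr (- \<epsilon>)) * indicator Q x * indicator H x)
        \<partial>count_space R) \<partial>\<omega>)"
    by (intro nn_integral_mono) (auto split: split_indicator dest: lower)
  also have "\<dots> = (\<integral>\<^sup>+Q. (\<integral>\<^sup>+x. ennreal (\<tau> Q powr \<epsilon>) * (ennreal (v x powr (- \<epsilon>)) * indicator Q x * indicator H x)
        \<partial>\<omega>) \<partial>count_space R)"
    by (rule nn_integral_count_space_nn_integral[OF ctbl]) measurable
  also have "\<dots> = (\<integral>\<^sup>+Q. ennreal (\<tau> Q powr \<epsilon>) * emeasure \<rho> (H \<inter> Q) \<partial>count_space R)"
  proof (rule nn_integral_cong)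
    fix Q assume "Q \<in> space (count_space R)"
    then have Q: "Q \<in> R" by simp
    note [measurable] = Rs[OF Q]
    show "(\<integral>\<^sup>+x. ennreal (\<tau> Q powr \<epsilon>) * (ennreal (v x powr (- \<epsilon>)) * indicator Q x * indicator H x) \<partial>\<omega>)
      = ennreal (\<tau> Q powr \<epsilon>) * emeasure \<rho> (H \<inter> Q)"
      unfolding \<rho>_int[OF Q] by (rule nn_integral_cmult) measurable
  qed
  also have "\<dots> \<le> (\<integral>\<^sup>+Q. ennreal (C3 * \<tau> Q powr \<epsilon> * r Q) * emeasure \<rho> Q \<partial>count_space R)"
  proof (rule nn_integral_mono)
    fix Q assume "Q \<in> space (count_space R)"
    then have Q: "Q \<in> cells" using R by auto
    have "measure \<rho> (H \<inter> Q) \<le> C3 * (measure \<omega> (H \<inter> Q) / measure \<omega> Q) powr 1 * measure \<rho> Q"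
      using Q by (intro dominatedD[OF dom3 Q]) (auto simp: sets_\<omega>)
    then have "measure \<rho> (H \<inter> Q) \<le> C3 * r Q * measure \<rho> Q" using r01[OF Q] by (simp add: r_def)
    then have "\<tau> Q powr \<epsilon> * measure \<rho> (H \<inter> Q) \<le> \<tau> Q powr \<epsilon> * (C3 * r Q * measure \<rho> Q)"
      by (rule mult_left_mono) simp
    then have "ennreal (\<tau> Q powr \<epsilon> * measure \<rho> (H \<inter> Q)) \<le> ennreal (C3 * \<tau> Q powr \<epsilon> * r Q * measure \<rho> Q)"
      by (intro ennreal_leI) (simp add: mult_ac)
    then show "ennreal (\<tau> Q powr \<epsilon>) * emeasure \<rho> (H \<inter> Q) \<le> ennreal (C3 * \<tau> Q powr \<epsilon> * r Q) * emeasure \<rho> Q"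
      unfolding cell_measure_emeasure[OF c\<rho> Q Int_lower2] cell_measure_emeasure[OF c\<rho> Q order_refl]
      using C3 r01[OF Q] by (simp add: ennreal_mult)
  qed
  also have "\<dots> \<le> 4 * (\<integral>\<^sup>+x. ennreal (C3 * mg x powr \<epsilon> * ms x) \<partial>\<rho>)"
  proof (rule sparse)
    fix Q x assume "Q \<in> R" "x \<in> Q"
    then have Q: "Q \<in> cells" "x \<in> Q" using R by auto
    show "ennreal (C3 * \<tau> Q powr \<epsilon> * r Q) \<le> ennreal (C3 * mg x powr \<epsilon> * ms x)"
      using mg_ge[OF Q] ms_ge[OF Q] \<tau>01[OF Q(1)] r01[OF Q(1)] C3 \<epsilon>
      by (intro ennreal_leI mult_mono powr_mono2 mult_nonneg_nonneg) auto
  qed measurable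
  also have "(\<integral>\<^sup>+x. ennreal (C3 * mg x powr \<epsilon> * ms x) \<partial>\<rho>)
      = (\<integral>\<^sup>+x. ennreal C3 * (ennreal ((mg x / v x) powr \<epsilon>) * ennreal (ms x)) \<partial>\<omega>)"
    unfolding \<rho>_eq
  proof (subst nn_integral_density)
    show "(\<integral>\<^sup>+x. ennreal (v x powr (- \<epsilon>)) * ennreal (C3 * mg x powr \<epsilon> * ms x) \<partial>\<omega>)
      = (\<integral>\<^sup>+x. ennreal C3 * (ennreal ((mg x / v x) powr \<epsilon>) * ennreal (ms x)) \<partial>\<omega>)"
    proof (rule nn_integral_cong)
      fix x
      have "v x powr (- \<epsilon>) * (C3 * mg x powr \<epsilon> * ms x) = C3 * ((mg x / v x) powr \<epsilon> * ms x)"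
        using mg0[of x] v_pos[of x] by (simp add: powr_divide powr_minus field_simps)
      then show "ennreal (v x powr (- \<epsilon>)) * ennreal (C3 * mg x powr \<epsilon> * ms x)
         = ennreal C3 * (ennreal ((mg x / v x) powr \<epsilon>) * ennreal (ms x))"
        using C3 ms0[of x] by (simp add: ennreal_mult[symmetric])
    qed
  qed measurable
  also have "\<dots> = ennreal C3 * (\<integral>\<^sup>+x. ennreal ((mg x / v x) powr \<epsilon>) * ennreal (ms x) \<partial>\<omega>)"
    by (rule nn_integral_cmult) measurable
  also have "(\<integral>\<^sup>+x. ennreal ((mg x / v x) powr \<epsilon>) * ennreal (ms x) \<partial>\<omega>)
      \<le> ennreal (K2 * (K * C1 powr p * m) powr (1 / q) * measure \<omega> H powr (1 - 1 / q))"
    unfolding K2_def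
  proof (rule maximal_pairing[OF c\<omega> H q])
    show "0 < K * C1 powr p * m" using K C1 G by simp
    show "ms x = (SUP k. measure \<omega> (H \<inter> cell k x) / measure \<omega> (cell k x))" for x
      by (simp add: ms_def r_def)
    fix y :: real assume y: "0 < y"
    \<comment> \<open>The inequality \<open>\<tau> Q \<le> C1 h^(1/p)\<close> turns \<open>y^(1/\<epsilon>) v < \<tau> Q\<close> into \<open>s v^p < h\<close>, where
      \<open>h = \<mu>(G \<inter> Q) / \<mu>(Q)\<close>.\<close>
    define s where "s = (y powr (1 / \<epsilon>) / C1) powr p"
    have s: "0 < s" using y C1 by (simp add: s_def)
    have "{x. ennreal y < ennreal ((mg x / v x) powr \<epsilon>)}
       \<subseteq> {x. \<exists>k. s * v x powr p * measure \<mu> (cell k x) < measure \<mu> (G \<inter> cell k x)}" (is "_ \<subseteq> ?B")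
    proof
      fix x assume "x \<in> {x. ennreal y < ennreal ((mg x / v x) powr \<epsilon>)}"
      then have "y < (mg x / v x) powr \<epsilon>" using y by (simp add: ennreal_less_iff)
      then have "y powr (1 / \<epsilon>) < ((mg x / v x) powr \<epsilon>) powr (1 / \<epsilon>)"
        using y \<epsilon> by (intro powr_less_mono2) auto
      also have "\<dots> = mg x / v x" using \<epsilon> mg0[of x] v_pos[of x] by (simp add: powr_powr)
      finally have "y powr (1 / \<epsilon>) * v x < mg x" using v_pos[of x] by (simp add: field_simps)
      then obtain k where k: "y powr (1 / \<epsilon>) * v x < \<tau> (cell k x)"
        unfolding mg_def using bdd_\<tau> by (subst (asm) less_cSUP_iff) auto
      define Q where "Q = cell k x"
      have Q: "Q \<in> cells" by (simp add: Q_def)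
      define hQ where "hQ = measure \<mu> (G \<inter> Q) / measure \<mu> Q"
      have hQ: "0 \<le> hQ" by (simp add: hQ_def)
      have "measure M (G \<inter> Q) \<le> C1 * hQ powr (1 / p) * measure M Q"
        unfolding hQ_def using Q by (intro dominatedD[OF dom1 Q]) (auto simp: sets_\<mu>)
      then have "\<tau> Q \<le> C1 * hQ powr (1 / p)"
        using cell_measure_pos[OF cM Q] by (simp add: \<tau>_def field_simps)
      then have "y powr (1 / \<epsilon>) * v x < C1 * hQ powr (1 / p)" using k by (simp add: Q_def)
      then have "y powr (1 / \<epsilon>) / C1 * v x < hQ powr (1 / p)" using C1 by (simp add: field_simps)
      then have "(y powr (1 / \<epsilon>) / C1 * v x) powr p < (hQ powr (1 / p)) powr p"
        using y C1 v_pos[of x] p by (intro powr_less_mono2) auto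
      also have "\<dots> = hQ" using hQ p by (simp add: powr_powr)
      also have "(y powr (1 / \<epsilon>) / C1 * v x) powr p = s * v x powr p"
        unfolding s_def by (rule powr_mult)
      finally show "x \<in> ?B"
        using cell_measure_pos[OF c\<mu> Q] by (auto simp: hQ_def Q_def field_simps)
    qed
    moreover have "?B \<in> sets M"
    proof -
      have "?B = (\<Union>k. {x \<in> space M. s * v x powr p * measure \<mu> (cell k x) < measure \<mu> (G \<inter> cell k x)})"
        by (auto simp: space_M)
      moreover have "(\<lambda>x. measure \<mu> (cell k x)) \<in> borel_measurable M"
          "(\<lambda>x. measure \<mu> (G \<inter> cell k x)) \<in> borel_measurable M" for k
        using borel_measurable_cell_fun[of "measure \<mu>"] borel_measurable_cell_fun[of "\<lambda>Q. measure \<mu> (G \<inter> Q)"] by auto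
      ultimately show ?thesis by simp
    qed
    ultimately have "emeasure \<omega> {x. ennreal y < ennreal ((mg x / v x) powr \<epsilon>)} \<le> emeasure \<omega> ?B"
      by (intro emeasure_mono) (auto simp: sets_\<omega>)
    also have "\<dots> \<le> ennreal (K / s * m)"
      using weak[OF s G(1)] K s G by (simp add: ennreal_mult[symmetric])
    also have "K / s * m = K * C1 powr p * m * y powr (- q)"
      using y C1 \<epsilon> by (simp add: s_def powr_divide powr_powr powr_minus q_def field_simps)
    finally show "emeasure \<omega> {x. ennreal y < ennreal ((mg x / v x) powr \<epsilon>)}
        \<le> ennreal (K * C1 powr p * m * y powr (- q))" .
  qed measurable
  finally have main: "ennreal (t powr \<epsilon>) * emeasure \<omega> H \<le>
     4 * (ennreal C3 * ennreal (K2 * (K * C1 powr p * m) powr (1 / q) * h powr (1 - 1 / q)))"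
    by (simp add: mult_left_mono h_def)
  have K2: "0 \<le> K2"
    unfolding K2_def using q
    by (intro divide_nonneg_nonneg mult_nonneg_nonneg add_nonneg_nonneg)
       (auto simp: powr_less_one less_imp_le)
  define D where "D = 4 * C3 * K2 * (K * C1 powr p) powr (1 / q)"
  have D: "0 \<le> D" using C3 K2 by (simp add: D_def)
  have "emeasure \<omega> H = ennreal h" using H by (simp add: h_def emeasure_eq_ennreal_measure less_top)
  then have "ennreal (t powr \<epsilon> * h) \<le> ennreal (D * m powr (1 / q) * h powr (1 - 1 / q))"
    using main C3 K2 G K by (simp add: D_def ennreal_mult powr_mult mult_ac h_def)
  then have real: "t powr \<epsilon> * h \<le> D * m powr (1 / q) * h powr (1 - 1 / q)"
    using D by (subst (asm) ennreal_le_iff) auto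
  have "h * t powr p \<le> D powr q * m"
  proof (cases "h = 0")
    case True
    then show ?thesis using G by simp
  next
    case False
    then have h: "0 < h" by (simp add: h_def zero_less_measure_iff)
    have "h = h powr (1 / q) * h powr (1 - 1 / q)" using h by (simp add: powr_add[symmetric])
    then have "(t powr \<epsilon> * h powr (1 / q)) * h powr (1 - 1 / q) \<le> (D * m powr (1 / q)) * h powr (1 - 1 / q)"
      using real by (simp add: mult_ac)
    then have "t powr \<epsilon> * h powr (1 / q) \<le> D * m powr (1 / q)"
      using h by (simp add: mult_le_cancel_right)
    then have "(t powr \<epsilon> * h powr (1 / q)) powr q \<le> (D * m powr (1 / q)) powr q"
      using q by (intro powr_mono2) auto
    then show ?thesis
      using t h D G q \<epsilon> by (simp add: powr_mult powr_powr q_def mult.commute)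
  qed
  then show ?thesis by (simp add: D_def K2_def h_def)
qed

end

section \<open>The dual estimate on one grid\<close>

text \<open>
  This converts between bounds on weak norms and bounds on the measure of a level set.
\<close>

lemma ennreal_mult_pow_le_iff:
  assumes "0 < y" "0 \<le> z" "0 < r"
  shows "ennreal y * ennreal_pow b r \<le> ennreal z \<longleftrightarrow> b \<le> ennreal ((z / y) powr (1 / r))"
proof (cases b)
  case (real c)
  have "ennreal y * ennreal_pow b r = ennreal (y * c powr r)"
    using real assms by (simp add: ennreal_pow_def ennreal_mult)
  then have "ennreal y * ennreal_pow b r \<le> ennreal z \<longleftrightarrow> c powr r \<le> z / y"
    using assms by (simp add: ennreal_le_iff field_simps)
  also have "\<dots> \<longleftrightarrow> c \<le> (z / y) powr (1 / r)"
  proof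
    assume "c powr r \<le> z / y"
    then have "(c powr r) powr (1 / r) \<le> (z / y) powr (1 / r)" using assms by (intro powr_mono2) auto
    then show "c \<le> (z / y) powr (1 / r)" using assms real by (simp add: powr_powr)
  next
    assume "c \<le> (z / y) powr (1 / r)"
    then have "c powr r \<le> ((z / y) powr (1 / r)) powr r" using assms real by (intro powr_mono2) auto
    then show "c powr r \<le> z / y" using assms by (simp add: powr_powr)
  qed
  finally show ?thesis using real by (simp add: ennreal_le_iff)
next
  case top
  then show ?thesis using assms by (simp add: ennreal_pow_def ennreal_mult_top top_unique)
qed

lemma ennreal_pow_ennreal: "0 \<le> c \<Longrightarrow> ennreal_pow (ennreal c) r = ennreal (c powr r)"
  by (simp add: ennreal_pow_def)

lemma ennreal_pow_mono:
  assumes "a \<le> b" "0 \<le> r"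
  shows "ennreal_pow a r \<le> ennreal_pow b r"
proof (cases b)
  case (real d)
  then obtain c where c: "a = ennreal c" "0 \<le> c" using assms by (cases a) (auto simp: top_unique)
  then have "c \<le> d" using assms real by (simp add: ennreal_le_iff)
  then show ?thesis using c real assms by (simp add: ennreal_pow_ennreal ennreal_leI powr_mono2)
qed (simp add: ennreal_pow_def)

lemma (in sigma_finite_measure) emeasure_le_of_finite_subsets:
  assumes H: "H \<in> sets M"
    and le: "\<And>A. A \<in> sets M \<Longrightarrow> A \<subseteq> H \<Longrightarrow> emeasure M A < \<infinity> \<Longrightarrow> emeasure M A \<le> B"
  shows "emeasure M H \<le> B"
proof -
  obtain X :: "nat \<Rightarrow> 'a set" where X: "range X \<subseteq> sets M" "(\<Union>i. X i) = space M"
      "\<And>i. emeasure M (X i) \<noteq> \<infinity>" "incseq X"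
    by (rule sigma_finite_incseq) blast
  have "(\<Union>i. H \<inter> X i) = H" using X H sets.sets_into_space by auto
  moreover have "(SUP i. emeasure M (H \<inter> X i)) = emeasure M (\<Union>i. H \<inter> X i)"
  proof (rule SUP_emeasure_incseq)
    show "incseq (\<lambda>i. H \<inter> X i)" using X(4) unfolding incseq_def by blast
  qed (use X H in auto)
  moreover have "emeasure M (H \<inter> X i) \<le> B" for i
  proof (rule le)
    show "H \<inter> X i \<in> sets M" using X H by auto
    have "emeasure M (H \<inter> X i) \<le> emeasure M (X i)" using X H by (intro emeasure_mono) auto
    then show "emeasure M (H \<inter> X i) < \<infinity>" using X(3)[of i] by (auto simp: less_top[symmetric] top_unique)
  qed auto
  ultimately show ?thesis by (metis SUP_least)
qed

lemma borel_measurable_nn_integral_count_space: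
  fixes f :: "'i \<Rightarrow> 'a \<Rightarrow> ennreal"
  assumes I: "countable I" and [measurable]: "\<And>i. i \<in> I \<Longrightarrow> f i \<in> borel_measurable M"
  shows "(\<lambda>x. \<integral>\<^sup>+i. f i x \<partial>count_space I) \<in> borel_measurable M"
proof (cases "finite I")
  case True
  then show ?thesis by (simp add: nn_integral_count_space_finite)
next
  case False
  then have [simp]: "I \<noteq> {}" by auto
  have "(\<integral>\<^sup>+i. g i \<partial>count_space I) = (\<Sum>n. g (from_nat_into I n))" for g :: "'i \<Rightarrow> ennreal"
    by (simp add: nn_integral_bij_count_space[symmetric, OF bij_betw_from_nat_into[OF I False]]
        nn_integral_count_space_nat)
  moreover have [measurable]: "f (from_nat_into I n) \<in> borel_measurable M" for n
    by (simp add: from_nat_into)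
  ultimately show ?thesis by simp
qed

lemma borel_measurable_antimono:
  fixes F :: "real \<Rightarrow> ennreal"
  assumes "antimono F"
  shows "F \<in> borel_measurable borel"
proof (rule borel_measurableI_greater)
  fix y
  define S where "S = {x \<in> space borel. y < F x}"
  have down: "t \<in> S" if "s \<in> S" "t \<le> s" for s t
    using that less_le_trans[OF _ antimonoD[OF assms that(2)], of y] by (simp add: S_def)
  consider "S = {}" | "S \<noteq> {}" "\<not> bdd_above S" | "S \<noteq> {}" "bdd_above S" by argo
  then have "S \<in> sets borel"
  proof cases
    case 2
    have "t \<in> S" for t
    proof -
      obtain s where "s \<in> S" "t < s" using 2(2) by (auto simp: bdd_above_def not_le)
      then show ?thesis using down by simp
    qed
    then have "S = UNIV" by auto
    then show ?thesis by simp
  next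
    case 3
    have below: "t \<in> S" if "t < Sup S" for t
    proof -
      have "\<exists>s\<in>S. t < s" using \<open>t < Sup S\<close> 3 less_cSup_iff[of S t] by simp
      then obtain s where "s \<in> S" "t < s" by blast
      then show ?thesis using down by simp
    qed
    have above: "t \<le> Sup S" if "t \<in> S" for t using that 3 by (intro cSup_upper)
    show ?thesis
    proof (cases "Sup S \<in> S")
      case True
      obtain c where c: "c = Sup S" by simp
      have "S = {..c}" using True below above unfolding c[symmetric] by (intro set_eqI) (force simp: le_less)
      then show ?thesis by simp
    next
      case False
      obtain c where c: "c = Sup S" by simp
      have "S = {..<c}" using False below above unfolding c[symmetric] by (intro set_eqI) (force simp: less_le)
      then show ?thesis by simp
    qed
  qed simp
  then show "{x \<in> space borel. y < F x} \<in> sets borel" by (simp add: S_def)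
qed

text \<open>
  The constant of \<open>sparse_operator_weak_type\<close>, which does not depend on the grid.
\<close>

definition dual_const :: "real \<Rightarrow> real \<Rightarrow> real \<Rightarrow> real \<Rightarrow> real \<Rightarrow> real" where
  "dual_const p \<epsilon> C1 C3 K = (let q = p / \<epsilon> in
     (4 * C3 * ((1 + 2 / (1 - 2 powr (1 - q))) * 2 powr (1 - 1 / q) / (1 - 2 powr (- (1 / q))))
        * (K * C1 powr p) powr (1 / q)) powr q)"

lemma dual_const_pos:
  assumes "1 < p" "0 < \<epsilon>" "\<epsilon> \<le> 1" "0 < C1" "0 < C3" "0 < K"
  shows "0 < dual_const p \<epsilon> C1 C3 K"
proof -
  define q where "q = p / \<epsilon>"
  have q: "1 < q" using assms by (simp add: q_def)
  have "0 < 1 + 2 / (1 - 2 powr (1 - q))" "0 < 1 - 2 powr (- (1 / q))"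
    using q by (auto simp: powr_less_one less_imp_le intro!: add_pos_nonneg)
  then show ?thesis using assms by (simp add: dual_const_def Let_def q_def)
qed

context cell_grid
begin

lemma cell_measure_sigma_finite:
  assumes "cell_measure \<mu>"
  shows "sigma_finite_measure \<mu>"
proof
  have "space \<mu> = UNIV"
    using assms sets_eq_imp_space_eq[of \<mu> M] space_M by (simp add: cell_measure_def)
  moreover have "\<Union>(range (cell 0)) = UNIV" using cell_self by auto
  ultimately show "\<exists>A. countable A \<and> A \<subseteq> sets \<mu> \<and> \<Union>A = space \<mu> \<and> (\<forall>a\<in>A. emeasure \<mu> a \<noteq> \<infinity>)"
  proof (intro exI[of _ "range (cell 0)"] conjI ballI)
    fix Q assume "Q \<in> range (cell 0)"
    then have "Q \<in> cells" by auto
    then show "emeasure \<mu> Q \<noteq> \<infinity>" using assms by (auto simp: cell_measure_def)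
  qed (use assms countable_range_cell in \<open>auto simp: cell_measure_def\<close>)
qed

text \<open>
  Let \<open>\<kappa> Q\<close> be the logarithm of the average over \<open>Q\<close>, rounded down, and let \<open>R\<close> consist of the
  cells whose level exceeds that of every larger cell. Among the supercells of \<open>P\<close> with level at
  least that of \<open>P\<close>, a largest one of maximal level is in \<open>R\<close>, and rounding costs a factor
  \<open>a\<close>. Cells two levels deeper than \<open>Q\<close> have averages at least \<open>a\<close> times that of \<open>Q\<close>, so
  the weak type (1,1) bound shows that they cover at most the portion \<open>1/a\<close> of \<open>Q\<close>.
\<close>

lemma principal_cells:
  fixes I :: "'a set \<Rightarrow> real"
  assumes cM: "cell_measure M" and g [measurable]: "g \<in> borel_measurable M"
    and I: "\<And>Q. Q \<in> cells \<Longrightarrow> (\<integral>\<^sup>+x\<in>Q. g x \<partial>M) = ennreal (I Q)" "\<And>Q. 0 \<le> I Q"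
    and a: "1 < a"
  obtains R and \<kappa> :: "'a set \<Rightarrow> int" where "R \<subseteq> cells"
    and "\<And>P Q. P \<in> R \<Longrightarrow> Q \<in> R \<Longrightarrow> Q \<subset> P \<Longrightarrow> \<kappa> P < \<kappa> Q"
    and "\<And>Q. Q \<in> R \<Longrightarrow> measure M (\<Union>{Q' \<in> R. Q' \<subseteq> Q \<and> \<kappa> Q + int 2 \<le> \<kappa> Q'}) \<le> 1 / a * measure M Q"
    and "\<And>P. P \<in> cells \<Longrightarrow> 0 < I P \<Longrightarrow> \<exists>Q\<in>R. P \<subseteq> Q \<and> I P / measure M P \<le> a * (I Q / measure M Q)"
proof -
  note posM = cell_measure_pos[OF cM] and emM = cell_measure_emeasure[OF cM]
  define A where "A Q = I Q / measure M Q" for Q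
  define \<kappa> where "\<kappa> Q = \<lfloor>log a (A Q)\<rfloor>" for Q
  define R where "R = {Q \<in> cells. 0 < I Q \<and> (\<forall>P\<in>cells. Q \<subset> P \<longrightarrow> \<kappa> P < \<kappa> Q)}"
  have A_pos: "0 < A Q" if "Q \<in> cells" "0 < I Q" for Q using that posM[of Q] by (simp add: A_def)
  have I_mono: "I P \<le> I Q" if "P \<in> cells" "Q \<in> cells" "P \<subseteq> Q" for P Q
  proof -
    have "(\<integral>\<^sup>+x\<in>P. g x \<partial>M) \<le> (\<integral>\<^sup>+x\<in>Q. g x \<partial>M)"
      using that by (intro nn_integral_mono) (auto split: split_indicator)
    then show ?thesis using that I by (simp add: ennreal_le_iff)
  qed
  have Rc: "R \<subseteq> cells" by (auto simp: R_def)
  show thesis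
  proof (rule that[OF Rc])
    show "\<kappa> P < \<kappa> Q" if "P \<in> R" "Q \<in> R" "Q \<subset> P" for P Q using that by (auto simp: R_def)
  next
    fix Q assume "Q \<in> R"
    then have Q: "Q \<in> cells" "0 < I Q" by (auto simp: R_def)
    let ?F = "{Q' \<in> R. Q' \<subseteq> Q \<and> \<kappa> Q + int 2 \<le> \<kappa> Q'}"
    have Fc: "?F \<subseteq> cells" using Rc by auto
    have DQ: "\<Union>?F \<subseteq> Q" by auto
    let ?g = "density M g"
    have eg: "emeasure ?g Q' = ennreal (I Q')" if "Q' \<in> cells" for Q'
      using that I(1)[OF that] by (simp add: emeasure_density)
    have "emeasure M (\<Union>?F) \<le> ennreal (1 / (a * A Q)) * emeasure ?g (\<Union>?F)"
    proof (rule cover_le[OF Fc])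
      fix Q' assume "Q' \<in> ?F"
      then have Q': "Q' \<in> cells" "0 < I Q'" "\<kappa> Q + 2 \<le> \<kappa> Q'" by (auto simp: R_def)
      have "a * A Q \<le> a * a powr (of_int (\<kappa> Q) + 1)"
        using powr_floor_log(2)[OF a A_pos[OF Q]] a by (simp add: \<kappa>_def)
      also have "\<dots> = a powr (of_int (\<kappa> Q + 2))" using a by (simp add: powr_add power2_eq_square)
      also have "\<dots> \<le> a powr of_int (\<kappa> Q')" using Q'(3) a by (intro powr_mono) linarith+
      also have "\<dots> \<le> A Q'" using powr_floor_log(1)[OF a A_pos[OF Q'(1,2)]] by (simp add: \<kappa>_def)
      finally have "a * A Q * measure M Q' \<le> I Q'"
        using posM[OF Q'(1)] by (simp add: A_def field_simps)
      then have "measure M Q' \<le> 1 / (a * A Q) * I Q'"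
        using a A_pos[OF Q] by (simp add: field_simps)
      then show "emeasure M Q' \<le> ennreal (1 / (a * A Q)) * emeasure ?g Q'"
        unfolding eg[OF Q'(1)] emM[OF Q'(1) order_refl] using a A_pos[OF Q] I(2)[of Q']
        by (subst ennreal_mult[symmetric]) (auto intro: ennreal_leI)
    qed auto
    also have "\<dots> \<le> ennreal (1 / (a * A Q)) * emeasure ?g Q"
      using Q DQ by (intro mult_left_mono emeasure_mono) auto
    also have "\<dots> = ennreal (1 / a * measure M Q)"
      unfolding eg[OF Q(1)] using a A_pos[OF Q] I(2)[of Q] Q posM[OF Q(1)]
      by (subst ennreal_mult[symmetric]) (auto simp: A_def)
    finally show "measure M (\<Union>?F) \<le> 1 / a * measure M Q"
      using a posM[OF Q(1)] unfolding emM[OF Q(1) DQ] by (simp add: ennreal_le_iff)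
  next
    fix P assume P: "P \<in> cells" "0 < I P"
    define S where "S = {Q \<in> cells. P \<subseteq> Q \<and> \<kappa> P \<le> \<kappa> Q}"
    define k where "k = Max (\<kappa> ` S)"
    have fin: "finite S" using finite_supercells[OF P(1)] by (rule finite_subset[rotated]) (auto simp: S_def)
    have "P \<in> S" using P by (simp add: S_def)
    have kmax: "\<kappa> Q \<le> k" if "Q \<in> S" for Q unfolding k_def using fin that by simp
    have "k \<in> \<kappa> ` S" unfolding k_def using fin \<open>P \<in> S\<close> by (intro Max_in) auto
    then obtain Q0 where Q0: "Q0 \<in> S" "\<kappa> Q0 = k" by auto
    have "{Q \<in> S. \<kappa> Q = k} \<subseteq> cells" by (auto simp: S_def)
    moreover have "Q0 \<in> {Q \<in> S. \<kappa> Q = k}" using Q0 by simp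
    ultimately obtain Q where Q: "Q \<in> {Q \<in> S. \<kappa> Q = k}" "Q0 \<subseteq> Q"
        "\<And>Q'. Q' \<in> {Q \<in> S. \<kappa> Q = k} \<Longrightarrow> Q \<subseteq> Q' \<Longrightarrow> Q' = Q"
      by (rule ex_largest_cell) blast
    have Qc: "Q \<in> cells" "P \<subseteq> Q" "\<kappa> P \<le> \<kappa> Q" "\<kappa> Q = k" using Q(1) by (auto simp: S_def)
    have IQ: "0 < I Q" using I_mono[OF P(1) Qc(1,2)] P by simp
    have "Q \<in> R"
      unfolding R_def
    proof (intro CollectI conjI ballI impI Qc IQ)
      fix P' assume P': "P' \<in> cells" "Q \<subset> P'"
      show "\<kappa> P' < \<kappa> Q"
      proof (rule ccontr)
        assume "\<not> ?thesis"
        then have "P' \<in> S" using P' Qc by (auto simp: S_def)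
        then have "\<kappa> P' = k" using kmax[of P'] \<open>\<not> \<kappa> P' < \<kappa> Q\<close> Qc by simp
        then show False using Q(3)[of P'] P' \<open>P' \<in> S\<close> by auto
      qed
    qed
    moreover have "A P \<le> a * A Q"
    proof -
      have "A P \<le> a powr (of_int (\<kappa> P) + 1)"
        using powr_floor_log(2)[OF a A_pos[OF P]] by (simp add: \<kappa>_def)
      also have "\<dots> \<le> a powr (of_int (\<kappa> Q) + 1)" using Qc a by (intro powr_mono) auto
      also have "\<dots> = a * a powr (of_int (\<kappa> Q))" using a by (simp add: powr_add)
      also have "\<dots> \<le> a * A Q"
        using powr_floor_log(1)[OF a A_pos[OF Qc(1) IQ]] a by (simp add: \<kappa>_def)
      finally show ?thesis .
    qed
    ultimately show "\<exists>Q\<in>R. P \<subseteq> Q \<and> I P / measure M P \<le> a * (I Q / measure M Q)"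
      using Qc by (auto simp: A_def)
  qed
qed

end

context weighted_grid
begin

text \<open>
  The dual estimate under the finiteness assumptions that allow principal cells to be selected and
  \<open>\<mu>(G)^(1/p)\<close> to be cancelled. The function \<open>A\<close> is the result of moving the sparse sum that
  dominates the maximal function from \<open>g\<close> to the indicator of \<open>G\<close>.
\<close>

lemma dyadic_dual_finite:
  fixes f :: "'a \<Rightarrow> real" and I :: "'a set \<Rightarrow> real"
  assumes y: "0 < y" and f [measurable]: "f \<in> borel_measurable M" and f_nonneg: "\<And>x. 0 \<le> f x"
    and I: "\<And>Q. Q \<in> cells \<Longrightarrow> (\<integral>\<^sup>+x\<in>Q. ennreal (f x * u x * v x powr (p - 1)) \<partial>M) = ennreal (I Q)"
      "\<And>Q. 0 \<le> I Q"
    and G: "G \<in> sets M" "emeasure \<mu> G < \<infinity>"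
    and level: "\<And>x. x \<in> G \<Longrightarrow> \<exists>k. y * u x * measure M (cell k x) < I (cell k x)"
  shows "ennreal y * ennreal_pow (emeasure \<mu> G) (1 - 1 / p) \<le>
     ennreal (a * (1 + 2 / (1 - 2 powr (1 - p))) * dual_const p \<epsilon> C1 C3 K powr (1 / p)) *
      (\<integral>\<^sup>+s\<in>{0<..}. ennreal_pow (emeasure \<omega> {x. s < f x}) (1 - 1 / p) \<partial>lborel)"
proof (cases "measure \<mu> G = 0")
  case True
  then have "emeasure \<mu> G = 0" using G by (simp add: emeasure_eq_ennreal_measure less_top)
  then show ?thesis by (simp add: ennreal_pow_def)
next
  case False
  define m where "m = measure \<mu> G"
  have m: "0 < m" "emeasure \<mu> G = ennreal m"
    using False G by (auto simp: m_def zero_less_measure_iff emeasure_eq_ennreal_measure less_top)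
  define Kq where "Kq = 1 + 2 / (1 - 2 powr (1 - p))"
  have Kq: "0 < Kq" unfolding Kq_def using p by (intro add_pos_nonneg) (auto simp: powr_less_one less_imp_le)
  define D where "D = dual_const p \<epsilon> C1 C3 K"
  have D: "0 < D" unfolding D_def by (rule dual_const_pos[OF p \<epsilon> C1 C3 K])
  interpret \<omega>: sigma_finite_measure \<omega> by (rule cell_measure_sigma_finite[OF c\<omega>])
  note [measurable] = G(1)
  note posM = cell_measure_pos[OF cM] and emM = cell_measure_emeasure[OF cM]
  define g where "g x = ennreal (f x * u x * v x powr (p - 1))" for x
  have g [measurable]: "g \<in> borel_measurable M" unfolding g_def by measurable
  have Ig: "(\<integral>\<^sup>+x\<in>Q. g x \<partial>M) = ennreal (I Q)" if "Q \<in> cells" for Q using I(1)[OF that] by (simp add: g_def)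
  obtain R and \<kappa> :: "'a set \<Rightarrow> int" where R: "R \<subseteq> cells"
    and mono: "\<And>P Q. P \<in> R \<Longrightarrow> Q \<in> R \<Longrightarrow> Q \<subset> P \<Longrightarrow> \<kappa> P < \<kappa> Q"
    and small: "\<And>Q. Q \<in> R \<Longrightarrow> measure M (\<Union>{Q' \<in> R. Q' \<subseteq> Q \<and> \<kappa> Q + int 2 \<le> \<kappa> Q'}) \<le> 1 / a * measure M Q"
    and dom: "\<And>P. P \<in> cells \<Longrightarrow> 0 < I P \<Longrightarrow> \<exists>Q\<in>R. P \<subseteq> Q \<and> I P / measure M P \<le> a * (I Q / measure M Q)"
    by (rule principal_cells[OF cM g Ig I(2) a]) blast+
  have ctbl: "countable R" using R countable_cells by (rule countable_subset)
  have Rs [measurable]: "Q \<in> sets M" if "Q \<in> R" for Q using that R sets_cells by auto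
  define \<tau> where "\<tau> Q = measure M (G \<inter> Q) / measure M Q" for Q
  define A where "A x = (\<integral>\<^sup>+Q. ennreal (\<tau> Q) * indicator Q x \<partial>count_space R)" for x
  have A [measurable]: "A \<in> borel_measurable M"
    unfolding A_def using ctbl by (rule borel_measurable_nn_integral_count_space) measurable
  have sparse: "(\<integral>\<^sup>+Q. c Q * emeasure \<rho> Q \<partial>count_space R) \<le> 4 * (\<integral>\<^sup>+x. \<psi> x \<partial>\<rho>)"
    if c: "\<And>Q x. Q \<in> R \<Longrightarrow> x \<in> Q \<Longrightarrow> c Q \<le> \<psi> x" and \<psi>: "\<psi> \<in> borel_measurable M" for c and \<psi> :: "'a \<Rightarrow> ennreal"
  proof -
    have "(\<integral>\<^sup>+Q. c Q * emeasure \<rho> Q \<partial>count_space R) \<le> 2 * of_nat 2 * (\<integral>\<^sup>+x\<in>\<Union>R. \<psi> x \<partial>\<rho>)"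
    proof (rule sparse_sum[OF R c\<rho> mono _ c \<psi>])
      fix Q assume Q: "Q \<in> R"
      then have Qc: "Q \<in> cells" using R by auto
      let ?D = "\<Union>{Q' \<in> R. Q' \<subseteq> Q \<and> \<kappa> Q + int 2 \<le> \<kappa> Q'}"
      have DQ: "?D \<subseteq> Q" by auto
      have Dm: "?D \<in> sets M" using R by (intro sets_Union_cells) auto
      have frac: "measure M ?D / measure M Q \<le> 1 / a" using small[OF Q] posM[OF Qc] by (simp add: divide_le_eq)
      have "measure \<rho> ?D \<le> C4 * (measure M ?D / measure M Q) powr \<delta>4 * measure \<rho> Q"
        by (rule dominatedD[OF dom4 Qc Dm DQ])
      also have "\<dots> \<le> C4 * (1 / a) powr \<delta>4 * measure \<rho> Q"
        using frac C4 by (intro mult_right_mono mult_left_mono powr_mono2) auto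
      also have "\<dots> \<le> 1 / 2 * measure \<rho> Q" using aC by (intro mult_right_mono) auto
      finally show "emeasure \<rho> ?D \<le> ennreal (1 / 2) * emeasure \<rho> Q"
        unfolding cell_measure_emeasure[OF c\<rho> Qc DQ] cell_measure_emeasure[OF c\<rho> Qc order_refl]
        by (subst ennreal_mult[symmetric]) (auto intro: ennreal_leI)
    qed
    also have "\<dots> \<le> 4 * (\<integral>\<^sup>+x. \<psi> x \<partial>\<rho>)"
      by (simp, intro mult_left_mono nn_integral_mono) (auto split: split_indicator)
    finally show ?thesis .
  qed
  define \<phi> where "\<phi> x = A x * ennreal (1 / v x)" for x
  have \<phi> [measurable]: "\<phi> \<in> borel_measurable M" unfolding \<phi>_def by measurable
  have weak_A: "emeasure \<omega> {x \<in> space \<omega>. ennreal t < \<phi> x} \<le> ennreal (D * m * t powr (- p))" if t: "0 < t" for t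
  proof (rule \<omega>.emeasure_le_of_finite_subsets)
    show "{x \<in> space \<omega>. ennreal t < \<phi> x} \<in> sets \<omega>" by measurable
    fix H assume H: "H \<in> sets \<omega>" "H \<subseteq> {x \<in> space \<omega>. ennreal t < \<phi> x}" "emeasure \<omega> H < \<infinity>"
    have "measure \<omega> H * t powr p \<le> dual_const p \<epsilon> C1 C3 K * m"
      unfolding dual_const_def Let_def
    proof (rule sparse_operator_weak_type[OF t G(1) m(2) m(1) R sparse _ H(3)])
      show "H \<in> sets M" using H by (simp add: sets_\<omega>)
      fix x assume "x \<in> H"
      then have lt: "ennreal t < \<phi> x" using H by auto
      have "ennreal (t * v x) < A x"
      proof (rule ccontr)
        assume "\<not> ?thesis"
        then have "A x * ennreal (1 / v x) \<le> ennreal (t * v x) * ennreal (1 / v x)"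
          by (intro mult_right_mono) auto
        also have "\<dots> = ennreal t" using t v_pos[of x] by (simp add: ennreal_mult[symmetric])
        finally show False using lt by (simp add: \<phi>_def)
      qed
      then show "ennreal (t * v x) < (\<integral>\<^sup>+Q. ennreal (measure M (G \<inter> Q) / measure M Q) * indicator Q x \<partial>count_space R)"
        by (simp add: A_def \<tau>_def)
    qed
    then have "measure \<omega> H \<le> D * m * t powr (- p)"
      using t by (simp add: D_def powr_minus field_simps)
    then show "emeasure \<omega> H \<le> ennreal (D * m * t powr (- p))"
      using H by (simp add: emeasure_eq_ennreal_measure less_top ennreal_leI)
  qed
  \<comment> \<open>Linearisation: on \<open>G\<close> the weight \<open>y u\<close> is below the maximal function of \<open>g\<close>, and one term of
    the sparse sum already dominates the average that exceeds \<open>y u\<close>.\<close>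
  have pointwise: "ennreal (y * u x) \<le> (\<integral>\<^sup>+Q. ennreal (a * (I Q / measure M Q)) * indicator Q x \<partial>count_space R)"
    if x: "x \<in> G" for x
  proof -
    obtain k where k: "y * u x * measure M (cell k x) < I (cell k x)" using level[OF x] by auto
    let ?P = "cell k x"
    have P: "?P \<in> cells" by simp
    have "0 < y * u x * measure M ?P" using y u_pos[of x] posM[OF P] by simp
    then have "0 < I ?P" using k by linarith
    then obtain Q where Q: "Q \<in> R" "?P \<subseteq> Q" "I ?P / measure M ?P \<le> a * (I Q / measure M Q)"
      using dom[OF P] by auto
    have "y * u x \<le> I ?P / measure M ?P" using k posM[OF P] by (simp add: field_simps)
    then have "y * u x \<le> a * (I Q / measure M Q)" using Q(3) by linarith
    moreover have "x \<in> Q" using Q(2) cell_self[of x k] by blast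
    ultimately have "ennreal (y * u x) \<le> ennreal (a * (I Q / measure M Q)) * indicator Q x"
      by (simp add: ennreal_leI)
    also have "\<dots> \<le> (\<integral>\<^sup>+Q. ennreal (a * (I Q / measure M Q)) * indicator Q x \<partial>count_space R)"
      using Q(1) by (rule nn_integral_ge_point)
    finally show ?thesis .
  qed
  have "ennreal y * emeasure \<mu> G = (\<integral>\<^sup>+x. ennreal (y * u x) * indicator G x \<partial>M)"
    unfolding \<mu>_eq using y u_pos
    by (simp add: emeasure_density nn_integral_cmult[symmetric] ennreal_mult less_imp_le mult.assoc)
  also have "\<dots> \<le> (\<integral>\<^sup>+x. (\<integral>\<^sup>+Q. ennreal (a * (I Q / measure M Q)) * indicator (G \<inter> Q) x \<partial>count_space R) \<partial>M)"
  proof (rule nn_integral_mono)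
    fix x
    show "ennreal (y * u x) * indicator G x
      \<le> (\<integral>\<^sup>+Q. ennreal (a * (I Q / measure M Q)) * indicator (G \<inter> Q) x \<partial>count_space R)"
    proof (cases "x \<in> G")
      case True
      then have "indicator (G \<inter> Q) x = (indicator Q x :: ennreal)" for Q by (simp add: indicator_def)
      then show ?thesis using pointwise[OF True] True by simp
    qed simp
  qed
  also have "\<dots> = (\<integral>\<^sup>+Q. (\<integral>\<^sup>+x. ennreal (a * (I Q / measure M Q)) * indicator (G \<inter> Q) x \<partial>M) \<partial>count_space R)"
    by (rule nn_integral_count_space_nn_integral[OF ctbl]) measurable
  also have "\<dots> = (\<integral>\<^sup>+Q. (\<integral>\<^sup>+x. ennreal a * (g x * (ennreal (\<tau> Q) * indicator Q x)) \<partial>M) \<partial>count_space R)"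
  proof (rule nn_integral_cong)
    fix Q assume "Q \<in> space (count_space R)"
    then have Q: "Q \<in> R" "Q \<in> cells" using R by auto
    note [measurable] = Rs[OF Q(1)]
    have "(\<integral>\<^sup>+x. ennreal (a * (I Q / measure M Q)) * indicator (G \<inter> Q) x \<partial>M)
      = ennreal (a * (I Q / measure M Q)) * ennreal (measure M (G \<inter> Q))"
      by (subst nn_integral_cmult_indicator) (auto simp: emM[OF Q(2) Int_lower2])
    also have "\<dots> = ennreal a * (ennreal (\<tau> Q) * ennreal (I Q))"
      using a I(2)[of Q] by (simp add: ennreal_mult[symmetric] \<tau>_def)
    also have "ennreal (\<tau> Q) * ennreal (I Q) = (\<integral>\<^sup>+x. ennreal (\<tau> Q) * (g x * indicator Q x) \<partial>M)"
      unfolding Ig[OF Q(2), symmetric] by (rule nn_integral_cmult[symmetric]) measurable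
    also have "ennreal a * \<dots> = (\<integral>\<^sup>+x. ennreal a * (ennreal (\<tau> Q) * (g x * indicator Q x)) \<partial>M)"
      by (rule nn_integral_cmult[symmetric]) measurable
    finally show "(\<integral>\<^sup>+x. ennreal (a * (I Q / measure M Q)) * indicator (G \<inter> Q) x \<partial>M)
      = (\<integral>\<^sup>+x. ennreal a * (g x * (ennreal (\<tau> Q) * indicator Q x)) \<partial>M)"
      by (simp only: mult.left_commute)
  qed
  also have "\<dots> = (\<integral>\<^sup>+x. (\<integral>\<^sup>+Q. ennreal a * (g x * (ennreal (\<tau> Q) * indicator Q x)) \<partial>count_space R) \<partial>M)"
    by (rule nn_integral_count_space_nn_integral[OF ctbl, symmetric]) measurable
  also have "\<dots> = (\<integral>\<^sup>+x. ennreal a * (g x * A x) \<partial>M)"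
    by (intro nn_integral_cong) (simp add: A_def nn_integral_cmult)
  also have "\<dots> = ennreal a * (\<integral>\<^sup>+x. g x * A x \<partial>M)" by (rule nn_integral_cmult) measurable
  also have "(\<integral>\<^sup>+x. g x * A x \<partial>M) = (\<integral>\<^sup>+x. ennreal (f x) * \<phi> x \<partial>\<omega>)"
  proof -
    have "(\<integral>\<^sup>+x. ennreal (f x) * \<phi> x \<partial>\<omega>) = (\<integral>\<^sup>+x. ennreal (v x powr p) * (ennreal (f x) * \<phi> x) \<partial>\<mu>)"
      unfolding \<omega>_eq by (rule nn_integral_density) measurable
    also have "\<dots> = (\<integral>\<^sup>+x. ennreal (u x) * (ennreal (v x powr p) * (ennreal (f x) * \<phi> x)) \<partial>M)"
      unfolding \<mu>_eq by (rule nn_integral_density) measurable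
    also have "\<dots> = (\<integral>\<^sup>+x. g x * A x \<partial>M)"
    proof (rule nn_integral_cong)
      fix x
      have "ennreal (u x) * (ennreal (v x powr p) * (ennreal (f x) * \<phi> x))
        = (ennreal (u x) * ennreal (v x powr p) * ennreal (f x) * ennreal (1 / v x)) * A x"
        by (simp add: \<phi>_def mult_ac)
      also have "ennreal (u x) * ennreal (v x powr p) * ennreal (f x) * ennreal (1 / v x)
        = ennreal (u x * v x powr p * f x * (1 / v x))"
        using u_pos[of x] v_pos[of x] f_nonneg[of x] by (simp add: ennreal_mult[symmetric])
      also have "u x * v x powr p * f x * (1 / v x) = f x * u x * v x powr (p - 1)"
        using v_pos[of x] by (simp add: powr_diff)
      finally show "ennreal (u x) * (ennreal (v x powr p) * (ennreal (f x) * \<phi> x)) = g x * A x"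
        by (simp add: g_def)
    qed
    finally show ?thesis ..
  qed
  also have "\<dots> = (\<integral>\<^sup>+s\<in>{0<..}. (\<integral>\<^sup>+x\<in>{x \<in> space \<omega>. s < f x}. \<phi> x \<partial>\<omega>) \<partial>lborel)"
    by (rule nn_integral_layer_cake) (auto intro: \<omega>.sigma_finite_measure_axioms)
  also have "\<dots> \<le> (\<integral>\<^sup>+s. ennreal (Kq * (D * m) powr (1 / p)) *
      (ennreal_pow (emeasure \<omega> {x. s < f x}) (1 - 1 / p) * indicator {0<..} s) \<partial>lborel)"
  proof (rule nn_integral_mono)
    fix s :: real
    have Dm: "0 < Kq * (D * m) powr (1 / p)" using Kq D m by simp
    have "(\<integral>\<^sup>+x\<in>{x \<in> space \<omega>. s < f x}. \<phi> x \<partial>\<omega>)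
       \<le> ennreal (Kq * (D * m) powr (1 / p)) * ennreal_pow (emeasure \<omega> {x. s < f x}) (1 - 1 / p)"
    proof (cases "emeasure \<omega> {x. s < f x} = \<infinity>")
      case True
      then show ?thesis using Kq D m by (simp add: ennreal_pow_def ennreal_mult_top)
    next
      case fin: False
      have S: "{x \<in> space \<omega>. s < f x} = {x. s < f x}" by (simp add: space_\<omega>)
      have Sm: "{x \<in> space \<omega>. s < f x} \<in> sets \<omega>" by measurable
      have "(\<integral>\<^sup>+x\<in>{x \<in> space \<omega>. s < f x}. \<phi> x \<partial>\<omega>)
        \<le> ennreal (Kq * (D * m) powr (1 / p) * measure \<omega> {x \<in> space \<omega>. s < f x} powr (1 - 1 / p))"
        unfolding Kq_def
        by (rule weak_type_set_integral[OF _ Sm p]) (use D m fin weak_A S in \<open>auto simp: less_top\<close>)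
      also have "\<dots> = ennreal (Kq * (D * m) powr (1 / p)) * ennreal_pow (emeasure \<omega> {x. s < f x}) (1 - 1 / p)"
        using fin Dm by (simp add: S emeasure_eq_ennreal_measure ennreal_pow_ennreal ennreal_mult)
      finally show ?thesis .
    qed
    then show "(\<integral>\<^sup>+x\<in>{x \<in> space \<omega>. s < f x}. \<phi> x \<partial>\<omega>) * indicator {0<..} s \<le>
       ennreal (Kq * (D * m) powr (1 / p)) *
      (ennreal_pow (emeasure \<omega> {x. s < f x}) (1 - 1 / p) * indicator {0<..} s)"
      by (auto split: split_indicator)
  qed
  also have "\<dots> = ennreal (Kq * (D * m) powr (1 / p)) *
      (\<integral>\<^sup>+s\<in>{0<..}. ennreal_pow (emeasure \<omega> {x. s < f x}) (1 - 1 / p) \<partial>lborel)" (is "_ = _ * ?J")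
  proof (rule nn_integral_cmult)
    have "antimono (\<lambda>s. ennreal_pow (emeasure \<omega> {x. s < f x}) (1 - 1 / p))"
    proof (rule antimonoI)
      fix s t :: real assume "s \<le> t"
      have "{x \<in> space \<omega>. s < f x} \<in> sets \<omega>" by measurable
      then show "ennreal_pow (emeasure \<omega> {x. t < f x}) (1 - 1 / p) \<le> ennreal_pow (emeasure \<omega> {x. s < f x}) (1 - 1 / p)"
        using \<open>s \<le> t\<close> p by (intro ennreal_pow_mono emeasure_mono) (auto simp: space_\<omega>)
    qed
    then have "(\<lambda>s. ennreal_pow (emeasure \<omega> {x. s < f x}) (1 - 1 / p)) \<in> borel_measurable borel"
      by (rule borel_measurable_antimono)
    then show "(\<lambda>s. ennreal_pow (emeasure \<omega> {x. s < f x}) (1 - 1 / p) * indicator {0<..} s) \<in> borel_measurable lborel"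
      by simp
  qed
  finally have main: "ennreal y * emeasure \<mu> G \<le> ennreal a * (ennreal (Kq * (D * m) powr (1 / p)) * ?J)"
    by (simp add: mult_left_mono)
  have "ennreal (m powr (- (1 / p))) * (ennreal y * emeasure \<mu> G)
     \<le> ennreal (m powr (- (1 / p))) * (ennreal a * (ennreal (Kq * (D * m) powr (1 / p)) * ?J))"
    by (rule mult_left_mono[OF main]) simp
  also have "ennreal (m powr (- (1 / p))) * (ennreal y * emeasure \<mu> G) = ennreal (y * (m powr (- (1 / p)) * m))"
  proof -
    have "ennreal (m powr (- (1 / p))) * (ennreal y * emeasure \<mu> G) = ennreal (m powr (- (1 / p)) * (y * m))"
      using y m by (simp add: ennreal_mult)
    then show ?thesis by (simp only: mult.left_commute)
  qed
  also have "m powr (- (1 / p)) * m = m powr (1 - 1 / p)"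
    using m powr_add[of m "- (1 / p)" 1] by simp
  also have "ennreal (y * m powr (1 - 1 / p)) = ennreal y * ennreal_pow (emeasure \<mu> G) (1 - 1 / p)"
    using y m by (simp add: ennreal_pow_ennreal ennreal_mult)
  also have "ennreal (m powr (- (1 / p))) * (ennreal a * (ennreal (Kq * (D * m) powr (1 / p)) * ?J))
     = ennreal (m powr (- (1 / p)) * (a * (Kq * (D * m) powr (1 / p)))) * ?J"
    using a Kq by (simp add: ennreal_mult mult.assoc)
  also have "m powr (- (1 / p)) * (a * (Kq * (D * m) powr (1 / p))) = a * Kq * D powr (1 / p)"
  proof -
    have "(D * m) powr (1 / p) = D powr (1 / p) * m powr (1 / p)" by (rule powr_mult)
    moreover have "m powr (- (1 / p)) * m powr (1 / p) = 1" using m by (simp add: powr_add[symmetric])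
    ultimately show ?thesis by (simp add: mult.assoc mult.left_commute[of "m powr (- (1 / p))"])
  qed
  finally show ?thesis unfolding Kq_def D_def .
qed

text \<open>
  Truncating \<open>f\<close> to the set where \<open>f u v^(p-1) \<le> n\<close> makes all averages finite and exhausts the
  level set as \<open>n\<close> grows; \<open>\<sigma>\<close>-finiteness reduces to subsets of finite measure.
\<close>

lemma dyadic_dual:
  fixes f :: "'a \<Rightarrow> real"
  assumes y: "0 < y" and f [measurable]: "f \<in> borel_measurable M" and f_nonneg: "\<And>x. 0 \<le> f x"
  shows "{x. \<exists>k. ennreal (y * u x) * emeasure M (cell k x)
        < (\<integral>\<^sup>+z\<in>cell k x. ennreal (f z * u z * v z powr (p - 1)) \<partial>M)} \<in> sets M" (is "?G \<in> _")
    and "ennreal y * ennreal_pow (emeasure \<mu> {x. \<exists>k. ennreal (y * u x) * emeasure M (cell k x)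
        < (\<integral>\<^sup>+z\<in>cell k x. ennreal (f z * u z * v z powr (p - 1)) \<partial>M)}) (1 - 1 / p) \<le>
     ennreal (a * (1 + 2 / (1 - 2 powr (1 - p))) * dual_const p \<epsilon> C1 C3 K powr (1 / p)) *
      (\<integral>\<^sup>+s\<in>{0<..}. ennreal_pow (emeasure \<omega> {x. s < f x}) (1 - 1 / p) \<partial>lborel)"
      (is "_ \<le> ennreal ?C * ?J")
proof -
  interpret \<mu>: sigma_finite_measure \<mu> by (rule cell_measure_sigma_finite[OF c\<mu>])
  define g where "g x = f x * u x * v x powr (p - 1)" for x
  have g [measurable]: "g \<in> borel_measurable M" unfolding g_def by measurable
  have g0: "0 \<le> g x" for x using f_nonneg[of x] u_pos[of x] by (simp add: g_def)
  define fn where "fn n x = (if g x \<le> real n then f x else 0)" for n x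
  define gn where "gn n x = fn n x * u x * v x powr (p - 1)" for n x
  have fn [measurable]: "fn n \<in> borel_measurable M" for n unfolding fn_def by measurable
  have gn [measurable]: "gn n \<in> borel_measurable M" for n unfolding gn_def by measurable
  have gn_eq: "gn n x = (if g x \<le> real n then g x else 0)" for n x by (simp add: gn_def fn_def g_def)
  define Gn where "Gn n = {x. \<exists>k. ennreal (y * u x) * emeasure M (cell k x) < (\<integral>\<^sup>+z\<in>cell k x. ennreal (gn n z) \<partial>M)}" for n
  have level_sets: "{x. \<exists>k. ennreal (y * u x) * emeasure M (cell k x) < (\<integral>\<^sup>+z\<in>cell k x. ennreal (h z) \<partial>M)} \<in> sets M"
    for h :: "'a \<Rightarrow> real"
  proof -
    have [measurable]: "(\<lambda>x. emeasure M (cell k x)) \<in> borel_measurable M"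
      "(\<lambda>x. \<integral>\<^sup>+z\<in>cell k x. ennreal (h z) \<partial>M) \<in> borel_measurable M" for k
      using borel_measurable_cell_fun[of "emeasure M" k]
        borel_measurable_cell_fun[of "\<lambda>Q. \<integral>\<^sup>+z\<in>Q. ennreal (h z) \<partial>M" k] by auto
    have "{x \<in> space M. \<exists>k. ennreal (y * u x) * emeasure M (cell k x) < (\<integral>\<^sup>+z\<in>cell k x. ennreal (h z) \<partial>M)} \<in> sets M"
      by measurable
    then show ?thesis by (simp add: space_M)
  qed
  show "?G \<in> sets M" by (rule level_sets)
  have Gn_sets: "Gn n \<in> sets M" for n unfolding Gn_def by (rule level_sets)
  have cover: "?G \<subseteq> (\<Union>n. Gn n)"
  proof
    fix x assume "x \<in> ?G"
    then obtain k where k: "ennreal (y * u x) * emeasure M (cell k x) < (\<integral>\<^sup>+z\<in>cell k x. ennreal (g z) \<partial>M)"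
      by (auto simp: g_def)
    have "(\<integral>\<^sup>+z\<in>cell k x. ennreal (g z) \<partial>M) = (\<integral>\<^sup>+z. (SUP n. ennreal (gn n z) * indicator (cell k x) z) \<partial>M)"
    proof (rule nn_integral_cong)
      fix z
      obtain N where N: "g z \<le> real N" using real_arch_simple by blast
      show "ennreal (g z) * indicator (cell k x) z = (SUP n. ennreal (gn n z) * indicator (cell k x) z)"
      proof (rule antisym)
        have "ennreal (g z) * indicator (cell k x) z = ennreal (gn N z) * indicator (cell k x) z"
          using N by (simp add: gn_eq)
        also have "\<dots> \<le> (SUP n. ennreal (gn n z) * indicator (cell k x) z)" by (rule SUP_upper) simp
        finally show "ennreal (g z) * indicator (cell k x) z \<le> (SUP n. ennreal (gn n z) * indicator (cell k x) z)" .
        show "(SUP n. ennreal (gn n z) * indicator (cell k x) z) \<le> ennreal (g z) * indicator (cell k x) z"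
          using g0[of z] by (intro SUP_least mult_right_mono ennreal_leI) (auto simp: gn_eq)
      qed
    qed
    also have "\<dots> = (SUP n. \<integral>\<^sup>+z\<in>cell k x. ennreal (gn n z) \<partial>M)"
      using g0 by (intro nn_integral_monotone_convergence_SUP)
        (auto simp: incseq_def le_fun_def gn_eq intro!: mult_right_mono ennreal_leI)
    finally have "\<exists>n. ennreal (y * u x) * emeasure M (cell k x) < (\<integral>\<^sup>+z\<in>cell k x. ennreal (gn n z) \<partial>M)"
      using k by (simp add: less_SUP_iff)
    then show "x \<in> (\<Union>n. Gn n)" by (auto simp: Gn_def)
  qed
  have inc: "incseq Gn"
  proof (rule incseq_SucI, rule subsetI)
    fix n x assume "x \<in> Gn n"
    then obtain k where k: "ennreal (y * u x) * emeasure M (cell k x) < (\<integral>\<^sup>+z\<in>cell k x. ennreal (gn n z) \<partial>M)"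
      by (auto simp: Gn_def)
    also have "\<dots> \<le> (\<integral>\<^sup>+z\<in>cell k x. ennreal (gn (Suc n) z) \<partial>M)"
      using g0 by (intro nn_integral_mono mult_right_mono ennreal_leI) (auto simp: gn_eq)
    finally show "x \<in> Gn (Suc n)" by (auto simp: Gn_def)
  qed
  have J_mono: "(\<integral>\<^sup>+s\<in>{0<..}. ennreal_pow (emeasure \<omega> {x. s < fn n x}) (1 - 1 / p) \<partial>lborel) \<le> ?J" for n
  proof (intro nn_integral_mono mult_right_mono ennreal_pow_mono emeasure_mono)
    fix s
    show "{x. s < f x} \<in> sets \<omega>" using measurable_sets[of f \<omega> borel "{s<..}"] f
      by (simp add: space_\<omega> vimage_def)
    have "fn n x \<le> f x" for x using f_nonneg[of x] by (simp add: fn_def)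
    then show "{x. s < fn n x} \<subseteq> {x. s < f x}" by (auto intro: less_le_trans)
  qed (use p in auto)
  have bound: "ennreal y * ennreal_pow (emeasure \<mu> H) (1 - 1 / p) \<le> ennreal ?C * ?J"
    if H: "H \<in> sets M" "H \<subseteq> Gn n" "emeasure \<mu> H < \<infinity>" for H n
  proof -
    define I where "I Q = enn2real (\<integral>\<^sup>+z\<in>Q. ennreal (gn n z) \<partial>M)" for Q
    have I: "(\<integral>\<^sup>+z\<in>Q. ennreal (gn n z) \<partial>M) = ennreal (I Q)" if Q: "Q \<in> cells" for Q
    proof -
      have "(\<integral>\<^sup>+z\<in>Q. ennreal (gn n z) \<partial>M) \<le> (\<integral>\<^sup>+z. ennreal (real n) * indicator Q z \<partial>M)"
        by (intro nn_integral_mono mult_right_mono ennreal_leI) (auto simp: gn_eq)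
      also have "\<dots> = ennreal (real n) * emeasure M Q"
        using Q by (intro nn_integral_cmult_indicator) auto
      also have "\<dots> < \<infinity>" using cM Q by (auto simp: cell_measure_def ennreal_mult_less_top)
      finally show ?thesis by (simp add: I_def)
    qed
    have "ennreal y * ennreal_pow (emeasure \<mu> H) (1 - 1 / p) \<le> ennreal ?C *
      (\<integral>\<^sup>+s\<in>{0<..}. ennreal_pow (emeasure \<omega> {x. s < fn n x}) (1 - 1 / p) \<partial>lborel)"
    proof (rule dyadic_dual_finite[OF y fn _ _ _ H(1,3)])
      show "0 \<le> fn n x" for x using f_nonneg by (simp add: fn_def)
      show "(\<integral>\<^sup>+x\<in>Q. ennreal (fn n x * u x * v x powr (p - 1)) \<partial>M) = ennreal (I Q)" if "Q \<in> cells" for Q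
        using I[OF that] by (simp add: gn_def)
      show "0 \<le> I Q" for Q by (simp add: I_def)
      fix x assume "x \<in> H"
      then obtain k where k: "ennreal (y * u x) * emeasure M (cell k x) < (\<integral>\<^sup>+z\<in>cell k x. ennreal (gn n z) \<partial>M)"
        using H(2) by (auto simp: Gn_def)
      have "ennreal (y * u x * measure M (cell k x)) < ennreal (I (cell k x))"
        using k y u_pos[of x] I[of "cell k x"] cell_measure_emeasure[OF cM, of "cell k x" "cell k x"]
        by (simp add: ennreal_mult)
      then have "y * u x * measure M (cell k x) < I (cell k x)"
        using y u_pos[of x] by (subst (asm) ennreal_less_iff) (auto simp: less_imp_le)
      then show "\<exists>k. y * u x * measure M (cell k x) < I (cell k x)" by blast
    qed
    also have "\<dots> \<le> ennreal ?C * ?J" by (intro mult_left_mono J_mono) simp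
    finally show ?thesis .
  qed
  show "ennreal y * ennreal_pow (emeasure \<mu> ?G) (1 - 1 / p) \<le> ennreal ?C * ?J"
  proof (cases "ennreal ?C * ?J")
    case (real z)
    have p': "0 < 1 - 1 / p" using p by simp
    note iff = ennreal_mult_pow_le_iff[OF y real(1) p']
    define B where "B = ennreal ((z / y) powr (1 / (1 - 1 / p)))"
    have "emeasure \<mu> (Gn n) \<le> B" for n
    proof (rule \<mu>.emeasure_le_of_finite_subsets)
      fix A assume "A \<in> sets \<mu>" "A \<subseteq> Gn n" "emeasure \<mu> A < \<infinity>"
      then show "emeasure \<mu> A \<le> B" using bound[of A n] unfolding real(2) iff B_def by (simp add: sets_\<mu>)
    qed (simp add: sets_\<mu> Gn_sets)
    moreover have "(SUP n. emeasure \<mu> (Gn n)) = emeasure \<mu> (\<Union>n. Gn n)"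
      using inc Gn_sets by (intro SUP_emeasure_incseq) (auto simp: sets_\<mu>)
    ultimately have "emeasure \<mu> (\<Union>n. Gn n) \<le> B" by (metis SUP_least)
    moreover have "emeasure \<mu> ?G \<le> emeasure \<mu> (\<Union>n. Gn n)"
      using cover Gn_sets by (intro emeasure_mono) (auto simp: sets_\<mu>)
    ultimately have "emeasure \<mu> ?G \<le> B" by (rule order_trans[rotated])
    then show ?thesis unfolding real(2) iff B_def .
  qed simp
qed

end

section \<open>Reversing quantitative absolute continuity\<close>

lemma dominated_trans:
  assumes d1: "dominated \<Q> C1 \<delta>1 \<mu> \<nu>" and d2: "dominated \<Q> C2 \<delta>2 \<nu> \<xi>"
    and C: "0 < C1" "0 < \<delta>1" "0 < C2" "0 < \<delta>2" and sets: "sets \<mu> = sets \<nu>"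
    and pos: "\<And>Q. Q \<in> \<Q> \<Longrightarrow> 0 < measure \<nu> Q"
  shows "dominated \<Q> (C2 * C1 powr \<delta>2) (\<delta>1 * \<delta>2) \<mu> \<xi>"
  unfolding dominated_def
proof (intro ballI impI)
  fix Q E assume Q: "Q \<in> \<Q>" and E: "E \<in> sets \<mu>" "E \<subseteq> Q"
  have "measure \<nu> E / measure \<nu> Q \<le> C1 * (measure \<mu> E / measure \<mu> Q) powr \<delta>1"
    using dominatedD[OF d1 Q E] pos[OF Q] by (simp add: divide_le_eq)
  then have "(measure \<nu> E / measure \<nu> Q) powr \<delta>2 \<le> (C1 * (measure \<mu> E / measure \<mu> Q) powr \<delta>1) powr \<delta>2"
    using C by (intro powr_mono2) auto
  also have "\<dots> = C1 powr \<delta>2 * (measure \<mu> E / measure \<mu> Q) powr (\<delta>1 * \<delta>2)"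
    by (simp add: powr_mult powr_powr)
  finally have "C2 * (measure \<nu> E / measure \<nu> Q) powr \<delta>2 * measure \<xi> Q
     \<le> C2 * (C1 powr \<delta>2 * (measure \<mu> E / measure \<mu> Q) powr (\<delta>1 * \<delta>2)) * measure \<xi> Q"
    using C by (intro mult_right_mono mult_left_mono) auto
  moreover have "measure \<xi> E \<le> C2 * (measure \<nu> E / measure \<nu> Q) powr \<delta>2 * measure \<xi> Q"
    using E sets by (intro dominatedD[OF d2 Q]) auto
  ultimately show "measure \<xi> E \<le> C2 * C1 powr \<delta>2 * (measure \<mu> E / measure \<mu> Q) powr (\<delta>1 * \<delta>2) * measure \<xi> Q"
    by (simp add: mult.assoc)
qed

context cell_grid
begin

text \<open>
  An iterated stopping-time argument, with \<open>b = 2 N\<close>. Let \<open>G i\<close> be the union of the cells inside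
  \<open>Q\<close> in which \<open>U = \<Union>F\<close> has density more than \<open>b^i \<alpha>\<close>. A maximal such cell \<open>R\<close> has a parent
  with density at most \<open>b^i \<alpha>\<close>, so its own density is at most \<open>N b^i \<alpha>\<close>, and \<open>G (i + 1)\<close>
  fills at most half of \<open>R\<close>. The hypothesis \<open>half\<close> then reduces the \<open>\<mu>\<close>-measure by the factor
  \<open>\<theta>\<close> at each step. As \<open>U\<close> is a union of cells, in which it has density 1, it is contained in
  \<open>G j\<close> as long as \<open>b^j \<alpha> < 1\<close>.
\<close>

lemma measure_union_of_cells_decay:
  assumes cM: "cell_measure M" and c\<mu>: "cell_measure \<mu>"
    and N: "1 \<le> N" "\<And>k x. measure M (cell k x) \<le> N * measure M (cell (Suc k) x)"
    and \<theta>: "0 \<le> \<theta>"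
    and half: "\<And>R E. R \<in> cells \<Longrightarrow> E \<in> sets M \<Longrightarrow> E \<subseteq> R \<Longrightarrow> measure M E \<le> 1 / 2 * measure M R \<Longrightarrow>
        measure \<mu> E \<le> \<theta> * measure \<mu> R"
    and Q: "Q \<in> cells" and F: "F \<subseteq> cells" and FQ: "\<Union>F \<subseteq> Q"
    and \<alpha>: "0 < \<alpha>" "measure M (\<Union>F) \<le> \<alpha> * measure M Q" and j: "(2 * N) ^ j * \<alpha> < 1"
  shows "measure \<mu> (\<Union>F) \<le> \<theta> ^ j * measure \<mu> Q"
proof -
  define b where "b = 2 * N"
  have b: "1 < b" using N by (simp add: b_def)
  note posM = cell_measure_pos[OF cM] and emM = cell_measure_emeasure[OF cM]
  note pos\<mu> = cell_measure_pos[OF c\<mu>] and em\<mu> = cell_measure_emeasure[OF c\<mu>]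
  have sets_\<mu> [measurable_cong]: "sets \<mu> = sets M" using c\<mu> by (simp add: cell_measure_def)
  define U where "U = \<Union>F"
  have U [measurable]: "U \<in> sets M" unfolding U_def using F by (rule sets_Union_cells)
  define Fam where "Fam i = {R \<in> cells. R \<subseteq> Q \<and> b ^ i * \<alpha> * measure M R < measure M (U \<inter> R)}" for i
  define G where "G i = \<Union>(Fam i)" for i
  have Fam_c: "Fam i \<subseteq> cells" for i by (auto simp: Fam_def)
  have GQ: "G i \<subseteq> Q" for i by (auto simp: G_def Fam_def)
  have G [measurable]: "G i \<in> sets M" for i unfolding G_def using Fam_c by (rule sets_Union_cells)
  have Fam_Suc: "Fam (Suc i) \<subseteq> Fam i" for i
  proof
    fix R assume "R \<in> Fam (Suc i)"
    then have R: "R \<in> cells" "R \<subseteq> Q" "b ^ Suc i * \<alpha> * measure M R < measure M (U \<inter> R)" by (auto simp: Fam_def)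
    have "b ^ i * \<alpha> * measure M R \<le> b ^ Suc i * \<alpha> * measure M R"
      using b \<alpha>(1) by (intro mult_right_mono power_increasing) auto
    then show "R \<in> Fam i" using R by (auto simp: Fam_def)
  qed
  have Q_notin: "Q \<notin> Fam i" for i
  proof -
    have "U \<inter> Q = U" using FQ by (auto simp: U_def)
    then have "measure M (U \<inter> Q) \<le> \<alpha> * measure M Q" using \<alpha> by (simp add: U_def)
    also have "\<dots> \<le> b ^ i * \<alpha> * measure M Q"
      using b \<alpha>(1) one_le_power[of b i] by (intro mult_right_mono) auto
    finally show ?thesis by (auto simp: Fam_def)
  qed
  have step: "measure \<mu> (G (Suc i)) \<le> \<theta> * measure \<mu> (G i)" for i
  proof -
    define X where "X = {R \<in> Fam i. \<forall>R'\<in>Fam i. R \<subseteq> R' \<longrightarrow> R' = R}"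
    have Xc: "X \<subseteq> cells" using Fam_c by (auto simp: X_def)
    have UX: "\<Union>X = G i"
    proof
      show "G i \<subseteq> \<Union>X"
      proof
        fix x assume "x \<in> G i"
        then obtain R where R: "R \<in> Fam i" "x \<in> R" by (auto simp: G_def)
        obtain P where "P \<in> Fam i" "R \<subseteq> P" "\<And>R'. R' \<in> Fam i \<Longrightarrow> P \<subseteq> R' \<Longrightarrow> R' = P"
          using ex_largest_cell[OF Fam_c R(1)] by blast
        then show "x \<in> \<Union>X" using R by (auto simp: X_def)
      qed
    qed (auto simp: X_def G_def)
    have inner: "measure \<mu> (G (Suc i) \<inter> R) \<le> \<theta> * measure \<mu> R" if RX: "R \<in> X" for R
    proof (rule half)
      have R: "R \<in> Fam i" and Rmax: "\<And>R'. R' \<in> Fam i \<Longrightarrow> R \<subseteq> R' \<Longrightarrow> R' = R" using RX by (auto simp: X_def)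
      then have Rc: "R \<in> cells" and RQ: "R \<subseteq> Q" by (auto simp: Fam_def)
      show "R \<in> cells" "G (Suc i) \<inter> R \<in> sets M" "G (Suc i) \<inter> R \<subseteq> R" using Rc by auto
      have "R \<noteq> Q" using R Q_notin by auto
      obtain x where x: "x \<in> R" using cells_nonempty[OF Rc] by auto
      \<comment> \<open>A cell may coincide with its parent; the least generation in which \<open>R\<close> occurs gives a strictly larger
        parent.\<close>
      define k where "k = (LEAST k. R = cell k x)"
      have k: "R = cell k x" unfolding k_def using cells_at[OF Rc x] by (rule LeastI_ex)
      obtain k0 where k0: "Q = cell k0 x" using cells_at[OF Q] x RQ by blast
      have "k0 < k"
      proof (rule ccontr)
        assume "\<not> k0 < k"
        then have "Q \<subseteq> R" using cell_antimono[of k k0 x] k k0 by simp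
        then show False using RQ \<open>R \<noteq> Q\<close> by auto
      qed
      then obtain k' where k': "k = Suc k'" "k0 \<le> k'" by (cases k) auto
      define P where "P = cell k' x"
      have P: "P \<in> cells" "R \<subseteq> P" "P \<subseteq> Q"
        using cell_Suc[of k' x] cell_antimono[OF k'(2), of x] k k' k0 by (auto simp: P_def)
      have "P \<noteq> R" using not_less_Least[of k' "\<lambda>k. R = cell k x"] k' by (auto simp: P_def k_def)
      then have "P \<notin> Fam i" using Rmax P by auto
      then have "measure M (U \<inter> P) \<le> b ^ i * \<alpha> * measure M P" using P by (auto simp: Fam_def not_less)
      also have "\<dots> \<le> b ^ i * \<alpha> * (N * measure M R)"
        using N(2)[of k' x] b \<alpha>(1) k k' by (intro mult_left_mono) (auto simp: P_def)
      finally have UP: "measure M (U \<inter> P) \<le> b ^ i * \<alpha> * (N * measure M R)" .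
      have "measure M (U \<inter> R) \<le> measure M (U \<inter> P)"
        using P by (intro cell_measure_mono[OF cM P(1)]) auto
      then have UR: "measure M (U \<inter> R) \<le> b ^ i * \<alpha> * (N * measure M R)" using UP by linarith
      let ?F = "{R' \<in> Fam (Suc i). R' \<subseteq> R}"
      have Fc: "?F \<subseteq> cells" using Fam_c by auto
      have sub: "G (Suc i) \<inter> R \<subseteq> \<Union>?F"
      proof
        fix z assume z: "z \<in> G (Suc i) \<inter> R"
        then obtain R' where R': "R' \<in> Fam (Suc i)" "z \<in> R'" by (auto simp: G_def)
        then have "R' \<subseteq> R \<or> R \<subseteq> R'" using cells_laminar[of R' R z] Fam_c Rc z by auto
        then have "R' \<subseteq> R" using Rmax[of R'] R' Fam_Suc by auto
        then show "z \<in> \<Union>?F" using R' by auto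
      qed
      define c where "c = 1 / (b ^ Suc i * \<alpha>)"
      have c: "0 < c" using b \<alpha>(1) by (simp add: c_def)
      have "emeasure M (\<Union>?F) \<le> ennreal c * emeasure M (U \<inter> \<Union>?F)"
      proof (rule cover_le_inter[OF Fc refl refl U])
        fix R' assume "R' \<in> ?F"
        then have R': "R' \<in> cells" "b ^ Suc i * \<alpha> * measure M R' < measure M (U \<inter> R')" by (auto simp: Fam_def)
        then have "measure M R' \<le> c * measure M (U \<inter> R')"
          using b \<alpha>(1) by (simp add: c_def field_simps)
        then show "emeasure M R' \<le> ennreal c * emeasure M (U \<inter> R')"
          unfolding emM[OF R'(1) order_refl] emM[OF R'(1) Int_lower2] using c
          by (subst ennreal_mult[symmetric]) (auto intro: ennreal_leI)
      qed
      also have "\<dots> \<le> ennreal c * emeasure M (U \<inter> R)"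
        using Rc by (intro mult_left_mono emeasure_mono) auto
      finally have "ennreal (measure M (\<Union>?F)) \<le> ennreal (c * measure M (U \<inter> R))"
        unfolding emM[OF Rc Int_lower2]
        using c by (subst (asm) emM[OF Rc]) (auto simp: ennreal_mult)
      then have "measure M (\<Union>?F) \<le> c * measure M (U \<inter> R)" using c by (subst (asm) ennreal_le_iff) auto
      also have "\<dots> \<le> c * (b ^ i * \<alpha> * (N * measure M R))" using UR c by (intro mult_left_mono) auto
      also have "\<dots> = 1 / 2 * measure M R" using b \<alpha>(1) N by (simp add: c_def b_def field_simps)
      finally have "measure M (\<Union>?F) \<le> 1 / 2 * measure M R" .
      moreover have "measure M (G (Suc i) \<inter> R) \<le> measure M (\<Union>?F)"
        using sub sets_Union_cells[OF Fc] by (intro cell_measure_mono[OF cM Rc]) auto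
      ultimately show "measure M (G (Suc i) \<inter> R) \<le> 1 / 2 * measure M R" by linarith
    qed
    let ?\<nu> = "density \<mu> (indicator (G (Suc i)))"
    have e: "emeasure ?\<nu> A = emeasure \<mu> (G (Suc i) \<inter> A)" if "A \<in> sets M" for A
      using that by (simp add: emeasure_density indicator_inter_arith[symmetric] sets_\<mu>)
    have "emeasure ?\<nu> (\<Union>X) \<le> ennreal \<theta> * emeasure \<mu> (\<Union>X)"
    proof (rule cover_le[OF Xc sets_\<mu>])
      fix R assume R: "R \<in> X"
      then have Rc: "R \<in> cells" using Xc by auto
      show "emeasure ?\<nu> R \<le> ennreal \<theta> * emeasure \<mu> R"
        unfolding e[OF sets_cells[OF Rc]] em\<mu>[OF Rc Int_lower2] em\<mu>[OF Rc order_refl]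
        using inner[OF R] \<theta> by (subst ennreal_mult[symmetric]) (auto intro: ennreal_leI)
    qed (simp add: sets_\<mu>)
    moreover have "G (Suc i) \<inter> G i = G (Suc i)" using Fam_Suc by (auto simp: G_def)
    ultimately have "emeasure \<mu> (G (Suc i)) \<le> ennreal \<theta> * emeasure \<mu> (G i)"
      unfolding UX e[OF G] by simp
    then show ?thesis
      unfolding em\<mu>[OF Q GQ] using \<theta>
      by (subst (asm) ennreal_mult[symmetric]) (auto simp: ennreal_le_iff)
  qed
  have "measure \<mu> (G i) \<le> \<theta> ^ i * measure \<mu> Q" for i
  proof (induction i)
    case 0
    show ?case using Q GQ by (simp, intro cell_measure_mono[OF c\<mu> Q]) auto
  next
    case (Suc i)
    have "\<theta> * measure \<mu> (G i) \<le> \<theta> * (\<theta> ^ i * measure \<mu> Q)" using Suc \<theta> by (rule mult_left_mono)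
    then show ?case using step[of i] by simp
  qed
  moreover have "U \<subseteq> G j"
  proof
    fix z assume "z \<in> U"
    then obtain R where R: "R \<in> F" "z \<in> R" by (auto simp: U_def)
    then have "U \<inter> R = R" "R \<in> cells" "R \<subseteq> Q" using F FQ by (auto simp: U_def)
    moreover have "b ^ j * \<alpha> * measure M R < 1 * measure M R"
      using j posM[OF \<open>R \<in> cells\<close>] by (intro mult_strict_right_mono) (auto simp: b_def)
    ultimately show "z \<in> G j" using R by (auto simp: G_def Fam_def)
  qed
  then have "measure \<mu> U \<le> measure \<mu> (G j)" using GQ by (intro cell_measure_mono[OF c\<mu> Q]) auto
  ultimately show ?thesis using order_trans unfolding U_def by blast
qed

text \<open>
  The domination of \<open>M\<close> by \<open>\<mu>\<close>, applied to complements, shows that a subset of at most half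
  the \<open>M\<close>-measure of a cell has at most the portion \<open>\<theta> < 1\<close> of its \<open>\<mu>\<close>-measure. The decay lemma
  iterates this about \<open>log (1 / \<alpha>)\<close> times for sets of relative measure \<open>\<alpha>\<close>, which gives a power
  \<open>\<alpha>^\<delta>'\<close>. General sets are first covered by a union of cells of at most twice the measure.
\<close>

lemma reverse_dominated:
  assumes cM: "cell_measure M" and c\<mu>: "cell_measure \<mu>"
    and dom: "dominated cells C \<delta> \<mu> M" and C: "0 < C" "0 < \<delta>"
    and N: "1 \<le> N" "\<And>k x. measure M (cell k x) \<le> N * measure M (cell (Suc k) x)"
    and ac: "\<And>E. E \<in> sets M \<Longrightarrow> emeasure M E = 0 \<Longrightarrow> emeasure \<mu> E = 0"
    and reg: "\<And>E Q e. Q \<in> cells \<Longrightarrow> E \<in> sets M \<Longrightarrow> E \<subseteq> Q \<Longrightarrow> 0 < e \<Longrightarrow>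
       \<exists>F\<subseteq>cells. E \<subseteq> \<Union>F \<and> \<Union>F \<subseteq> Q \<and> measure M (\<Union>F) \<le> measure M E + e"
  defines "\<theta> \<equiv> max (1 / 2) (1 - (1 / (2 * C)) powr (1 / \<delta>))"
  defines "\<delta>' \<equiv> - log (2 * N) \<theta>"
  shows "dominated cells (2 powr \<delta>' / \<theta>) \<delta>' M \<mu>" and "0 < \<delta>'" and "0 < \<theta>"
proof -
  have \<theta>: "0 < \<theta>" "\<theta> < 1" using C by (auto simp: \<theta>_def)
  have b: "1 < 2 * N" using N by simp
  show "0 < \<theta>" by fact
  show \<delta>': "0 < \<delta>'" using \<theta> b by (simp add: \<delta>'_def)
  have b_\<theta>: "(2 * N) powr (- \<delta>') = \<theta>" using \<theta> b by (simp add: \<delta>'_def)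
  note posM = cell_measure_pos[OF cM] and emM = cell_measure_emeasure[OF cM]
  note pos\<mu> = cell_measure_pos[OF c\<mu>] and em\<mu> = cell_measure_emeasure[OF c\<mu>]
  have sets_\<mu> [measurable_cong]: "sets \<mu> = sets M" using c\<mu> by (simp add: cell_measure_def)
  have split: "measure \<nu> R = measure \<nu> E + measure \<nu> (R - E)"
    if "cell_measure \<nu>" "R \<in> cells" "E \<in> sets M" "E \<subseteq> R" for \<nu> R E
  proof -
    have "measure \<nu> (R - E) = measure \<nu> R - measure \<nu> E"
      using that cell_measure_emeasure[OF that(1,2) order_refl]
      by (intro measure_Diff) (auto simp: cell_measure_def)
    then show ?thesis by simp
  qed
  have half: "measure \<mu> E \<le> \<theta> * measure \<mu> R"
    if R: "R \<in> cells" and E: "E \<in> sets M" "E \<subseteq> R" and le: "measure M E \<le> 1 / 2 * measure M R" for R E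
  proof -
    define r where "r = measure \<mu> (R - E) / measure \<mu> R"
    have r0: "0 \<le> r" by (simp add: r_def)
    have "1 / 2 * measure M R \<le> measure M (R - E)" using split[OF cM R E] le by simp
    also have "\<dots> \<le> C * r powr \<delta> * measure M R"
      unfolding r_def using R E by (intro dominatedD[OF dom R]) (auto simp: sets_\<mu>)
    finally have "1 / 2 \<le> C * r powr \<delta>" using posM[OF R] by (simp add: mult_le_cancel_right)
    then have "1 / (2 * C) \<le> r powr \<delta>" using C by (simp add: field_simps)
    then have "(1 / (2 * C)) powr (1 / \<delta>) \<le> (r powr \<delta>) powr (1 / \<delta>)" using C by (intro powr_mono2) auto
    then have "(1 / (2 * C)) powr (1 / \<delta>) \<le> r" using C r0 by (simp add: powr_powr)
    then have "1 - r \<le> \<theta>" by (simp add: \<theta>_def)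
    then have "(1 - r) * measure \<mu> R \<le> \<theta> * measure \<mu> R" by (intro mult_right_mono) auto
    moreover have "(1 - r) * measure \<mu> R = measure \<mu> E"
      using split[OF c\<mu> R E] pos\<mu>[OF R] by (simp add: r_def field_simps)
    ultimately show ?thesis by simp
  qed
  show "dominated cells (2 powr \<delta>' / \<theta>) \<delta>' M \<mu>"
    unfolding dominated_def
  proof (intro ballI impI)
    fix Q E assume Q: "Q \<in> cells" and E: "E \<in> sets M" "E \<subseteq> Q"
    define \<alpha> where "\<alpha> = 2 * (measure M E / measure M Q)"
    have E_le: "measure \<mu> E \<le> measure \<mu> Q" using Q E by (intro cell_measure_mono[OF c\<mu> Q]) auto
    have goal: "measure \<mu> E \<le> \<alpha> powr \<delta>' / \<theta> * measure \<mu> Q"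
    proof (cases "measure M E = 0")
      case True
      then have "emeasure \<mu> E = 0" using emM[OF Q E(2)] by (intro ac E) simp
      then show ?thesis using \<theta> by (simp add: measure_def)
    next
      case False
      then have ME: "0 < measure M E" by (simp add: zero_less_measure_iff)
      have \<alpha>: "0 < \<alpha>" using ME posM[OF Q] by (simp add: \<alpha>_def)
      show ?thesis
      proof (cases "\<alpha> < 1")
        case False
        then have "1 \<le> \<alpha> powr \<delta>'" using \<delta>' by (simp add: ge_one_powr_ge_zero)
        then have "1 \<le> \<alpha> powr \<delta>' / \<theta>" using \<theta> by (simp add: field_simps)
        then have "1 * measure \<mu> Q \<le> \<alpha> powr \<delta>' / \<theta> * measure \<mu> Q" by (intro mult_right_mono) auto
        then show ?thesis using E_le by simp
      next
        case True
        define P where "P j \<longleftrightarrow> 1 \<le> (2 * N) ^ Suc j * \<alpha>" for j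
        obtain n where "1 / \<alpha> < (2 * N) ^ n" using real_arch_pow[OF b] by auto
        then have "1 < (2 * N) ^ n * \<alpha>" using \<alpha> by (simp add: field_simps)
        also have "\<dots> \<le> (2 * N) ^ Suc n * \<alpha>" using \<alpha> b by (intro mult_right_mono power_increasing) auto
        finally have "P n" by (simp add: P_def)
        define j where "j = (LEAST j. P j)"
        have Pj: "P j" unfolding j_def using \<open>P n\<close> by (rule LeastI)
        have j: "(2 * N) ^ j * \<alpha> < 1"
        proof (cases j)
          case (Suc i)
          then have "\<not> P i" unfolding j_def by (metis lessI not_less_Least)
          then show ?thesis using Suc by (simp add: P_def)
        qed (use True in simp)
        obtain F where F: "F \<subseteq> cells" "E \<subseteq> \<Union>F" "\<Union>F \<subseteq> Q" "measure M (\<Union>F) \<le> measure M E + measure M E"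
          using reg[OF Q E ME] by auto
        have "measure M (\<Union>F) \<le> \<alpha> * measure M Q" using F(4) posM[OF Q] by (simp add: \<alpha>_def)
        then have "measure \<mu> (\<Union>F) \<le> \<theta> ^ j * measure \<mu> Q"
          using \<theta> by (intro measure_union_of_cells_decay[OF cM c\<mu> N _ half Q F(1,3) \<alpha> _ j]) auto
        moreover have "measure \<mu> E \<le> measure \<mu> (\<Union>F)"
          using F sets_Union_cells[OF F(1)] by (intro cell_measure_mono[OF c\<mu> Q]) auto
        moreover have "\<theta> ^ j \<le> \<alpha> powr \<delta>' / \<theta>"
        proof -
          have "\<theta> ^ Suc j = ((2 * N) ^ Suc j) powr (- \<delta>')"
          proof -
            have "\<theta> ^ Suc j = \<theta> powr real (Suc j)" using \<theta> by (simp only: powr_realpow)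
            also have "\<dots> = (2 * N) powr (real (Suc j) * (- \<delta>'))"
              unfolding b_\<theta>[symmetric] by (simp only: powr_powr mult.commute)
            also have "\<dots> = ((2 * N) powr real (Suc j)) powr (- \<delta>')" by (simp only: powr_powr)
            finally show ?thesis using b by (simp only: powr_realpow)
          qed
          also have "\<dots> \<le> (1 / \<alpha>) powr (- \<delta>')"
            using Pj \<alpha> \<delta>' by (intro powr_mono2') (auto simp: P_def field_simps)
          also have "\<dots> = \<alpha> powr \<delta>'" using \<alpha> by (simp add: powr_minus powr_divide)
          finally show ?thesis using \<theta> by (simp add: field_simps)
        qed
        ultimately show ?thesis
          by (meson mult_right_mono measure_nonneg order_trans)
      qed
    qed
    also have "\<alpha> powr \<delta>' / \<theta> = 2 powr \<delta>' / \<theta> * (measure M E / measure M Q) powr \<delta>'"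
      by (simp only: \<alpha>_def powr_mult) simp
    finally show "measure \<mu> E \<le> 2 powr \<delta>' / \<theta> * (measure M E / measure M Q) powr \<delta>' * measure \<mu> Q" .
  qed
qed

end

section \<open>Cubes and shifted dyadic grids\<close>

text \<open>
  Half-open cubes tile space exactly; they differ from the closed cubes of the maximal operator by null sets.
\<close>

definition hcube :: "real ^ 'n \<Rightarrow> real \<Rightarrow> (real ^ 'n) set" where
  "hcube a l = {y. \<forall>i. a $ i \<le> y $ i \<and> y $ i < a $ i + l}"

definition hcubes :: "(real ^ 'n) set set" where
  "hcubes = {hcube a l | a l. 0 < l}"

definition ccube :: "real ^ 'n \<Rightarrow> real \<Rightarrow> (real ^ 'n) set" where
  "ccube a l = cbox a (\<chi> i. a $ i + l)"

lemma cubes_ccube: "cubes = {ccube a l | a l. 0 < l}"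
  by (simp add: cubes_def ccube_def)

lemma hcube_sets [measurable]: "hcube a l \<in> sets lebesgue"
proof -
  have "{y \<in> space borel. \<forall>i. a $ i \<le> y $ i \<and> y $ i < a $ i + l} \<in> sets borel" by measurable
  then have "hcube a l \<in> sets borel" by (simp add: hcube_def)
  then show ?thesis by simp
qed

lemma hcube_subset_ccube: "hcube a l \<subseteq> ccube a l"
  by (auto simp: hcube_def ccube_def mem_box_cart less_imp_le)

lemma ccube_minus_hcube_null: "ccube a l - hcube a l \<in> null_sets lebesgue"
proof -
  have "ccube a l - hcube a l \<subseteq> cbox a (\<chi> i. a $ i + l) - box a (\<chi> i. a $ i + l)"
    by (auto simp: hcube_def ccube_def mem_box_cart less_imp_le)
  then have "negligible (ccube a l - hcube a l)"
    using negligible_frontier_interval negligible_subset by blast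
  then show ?thesis by (simp add: negligible_iff_null_sets)
qed

lemma emeasure_ccube:
  fixes a :: "real ^ 'n"
  assumes "0 \<le> l"
  shows "emeasure lebesgue (ccube a l) = ennreal (l ^ CARD('n))"
proof -
  have *: "(\<chi> i. a $ i + l) - a = (\<chi> i. l)" by (simp add: vec_eq_iff)
  have "emeasure lebesgue (ccube a l) = ennreal (\<Prod>b\<in>Basis. ((\<chi> i. a $ i + l) - a) \<bullet> b)"
  proof -
    have "a \<bullet> b \<le> (\<chi> i. a $ i + l) \<bullet> b" if "b \<in> Basis" for b
      using that assms by (auto simp: Basis_vec_def inner_axis)
    then have "emeasure lborel (cbox a (\<chi> i. a $ i + l)) = ennreal (\<Prod>b\<in>Basis. ((\<chi> i. a $ i + l) - a) \<bullet> b)"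
      by (rule emeasure_lborel_cbox)
    then show ?thesis unfolding ccube_def by simp
  qed
  also have "(\<Prod>b\<in>Basis. ((\<chi> i. a $ i + l) - a) \<bullet> b) = (\<Prod>b\<in>(Basis :: (real ^ 'n) set). l)"
    unfolding * by (intro prod.cong) (auto simp: Basis_vec_def inner_axis)
  finally show ?thesis by simp
qed

lemma emeasure_hcube_eq:
  assumes sets: "sets \<mu> = sets lebesgue" and ac: "\<And>E. E \<in> null_sets lebesgue \<Longrightarrow> emeasure \<mu> E = 0"
  shows "emeasure \<mu> (hcube a l) = emeasure \<mu> (ccube a l)"
proof -
  have m: "hcube a l \<in> sets \<mu>" "ccube a l - hcube a l \<in> sets \<mu>"
    using sets ccube_minus_hcube_null[of a l] by auto
  have "hcube a l \<union> (ccube a l - hcube a l) = ccube a l" using hcube_subset_ccube by auto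
  then have "emeasure \<mu> (ccube a l) = emeasure \<mu> (hcube a l) + emeasure \<mu> (ccube a l - hcube a l)"
    using plus_emeasure[OF m] by auto
  then show ?thesis using ac[OF ccube_minus_hcube_null] by simp
qed

lemma emeasure_hcube:
  fixes a :: "real ^ 'n"
  assumes "0 \<le> l"
  shows "emeasure lebesgue (hcube a l) = ennreal (l ^ CARD('n))"
proof -
  have "emeasure lebesgue (hcube a l) = emeasure lebesgue (ccube a l)"
    by (rule emeasure_hcube_eq) (auto simp: null_sets_def simp del: emeasure_completion)
  then show ?thesis using emeasure_ccube[OF assms, of a] by (simp del: emeasure_completion)
qed

lemma measure_hcube: "0 \<le> l \<Longrightarrow> measure lebesgue (hcube a l :: (real ^ 'n) set) = l ^ CARD('n)"
  by (simp add: measure_def emeasure_hcube del: emeasure_completion)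

lemma dominated_hcubes:
  assumes dom: "dominated cubes C \<delta> \<mu> \<nu>"
    and sets: "sets \<mu> = sets lebesgue" "sets \<nu> = sets lebesgue"
    and ac: "\<And>E. E \<in> null_sets lebesgue \<Longrightarrow> emeasure \<mu> E = 0" "\<And>E. E \<in> null_sets lebesgue \<Longrightarrow> emeasure \<nu> E = 0"
  shows "dominated hcubes C \<delta> \<mu> \<nu>"
  unfolding dominated_def
proof (intro ballI impI)
  fix Q E assume Q: "Q \<in> hcubes" and E: "E \<in> sets \<mu>" "E \<subseteq> Q"
  obtain a l where al: "Q = hcube a l" "0 < l" using Q by (auto simp: hcubes_def)
  have "measure \<nu> E \<le> C * (measure \<mu> E / measure \<mu> (ccube a l)) powr \<delta> * measure \<nu> (ccube a l)"
    using al E hcube_subset_ccube by (intro dominatedD[OF dom]) (auto simp: cubes_ccube)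
  then show "measure \<nu> E \<le> C * (measure \<mu> E / measure \<mu> Q) powr \<delta> * measure \<nu> Q"
    by (simp add: al measure_def emeasure_hcube_eq[OF sets(1) ac(1)] emeasure_hcube_eq[OF sets(2) ac(2)])
qed

text \<open>
  The dyadic cells of side \<open>L / 2^k\<close> of the standard grid translated by \<open>t\<close>, with the top generation
  of side \<open>L\<close>.
\<close>

definition grid_cell :: "real ^ 'n \<Rightarrow> real \<Rightarrow> nat \<Rightarrow> real ^ 'n \<Rightarrow> (real ^ 'n) set" where
  "grid_cell t L k x = {y. \<forall>i. \<lfloor>(y $ i - t $ i) * 2 ^ k / L\<rfloor> = \<lfloor>(x $ i - t $ i) * 2 ^ k / L\<rfloor>}"

lemma grid_cell_eq_hcube:
  assumes L: "0 < L"
  shows "grid_cell t L k x = hcube (\<chi> i. t $ i + L / 2 ^ k * of_int \<lfloor>(x $ i - t $ i) * 2 ^ k / L\<rfloor>) (L / 2 ^ k)"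
proof -
  have "\<lfloor>(r - s) * 2 ^ k / L\<rfloor> = m \<longleftrightarrow> s + L / 2 ^ k * of_int m \<le> r \<and> r < s + L / 2 ^ k * of_int m + L / 2 ^ k"
    for r s :: real and m
  proof -
    have "\<lfloor>(r - s) * 2 ^ k / L\<rfloor> = m \<longleftrightarrow> of_int m \<le> (r - s) * 2 ^ k / L \<and> (r - s) * 2 ^ k / L < of_int m + 1"
      by (simp add: floor_eq_iff)
    also have "of_int m \<le> (r - s) * 2 ^ k / L \<longleftrightarrow> s + L / 2 ^ k * of_int m \<le> r"
      using L by (simp add: field_simps)
    also have "(r - s) * 2 ^ k / L < of_int m + 1 \<longleftrightarrow> r < s + L / 2 ^ k * of_int m + L / 2 ^ k"
      using L by (simp add: field_simps)
    finally show ?thesis .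
  qed
  then show ?thesis by (simp add: grid_cell_def hcube_def)
qed

lemma grid_cell_in_hcubes: "0 < L \<Longrightarrow> grid_cell t L k x \<in> hcubes"
  by (auto simp: grid_cell_eq_hcube hcubes_def intro!: exI)

lemma hcube_eq_grid_cell: "0 < l \<Longrightarrow> hcube a l = grid_cell a l 0 a"
  by (simp add: grid_cell_eq_hcube)

lemma floor_double_div_2: "\<lfloor>2 * z\<rfloor> div 2 = \<lfloor>z :: real\<rfloor>"
proof -
  define m where "m = \<lfloor>2 * z\<rfloor>"
  have m: "of_int m \<le> 2 * z" "2 * z < of_int m + 1" unfolding m_def by linarith+
  have "2 * (m div 2) \<le> m" "m < 2 * (m div 2) + 2" by linarith+
  then have "real_of_int (2 * (m div 2)) \<le> of_int m" "real_of_int m + 1 \<le> of_int (2 * (m div 2) + 2)"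
    by linarith+
  then have "of_int (m div 2) \<le> z" "z < of_int (m div 2) + 1" using m by auto
  then show ?thesis unfolding m_def[symmetric] by (intro floor_unique[symmetric])
qed

lemma cell_grid_grid_cell:
  fixes t :: "real ^ 'n"
  assumes L: "0 < L"
  shows "cell_grid lebesgue (grid_cell t L)"
proof
  show "x \<in> grid_cell t L k x" for k x by (simp add: grid_cell_def)
  show "grid_cell t L k y = grid_cell t L k x" if "y \<in> grid_cell t L k x" for k x y
    using that by (simp add: grid_cell_def)
  show "grid_cell t L (Suc k) x \<subseteq> grid_cell t L k x" for k x
  proof
    fix y assume y: "y \<in> grid_cell t L (Suc k) x"
    have "\<lfloor>(z $ i - t $ i) * 2 ^ k / L\<rfloor> = \<lfloor>(z $ i - t $ i) * 2 ^ Suc k / L\<rfloor> div 2" for z :: "real ^ 'n" and i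
      using floor_double_div_2[of "(z $ i - t $ i) * 2 ^ k / L"] by (simp add: mult_ac)
    then show "y \<in> grid_cell t L k x" using y by (simp add: grid_cell_def)
  qed
  show "countable (range (grid_cell t L k))" for k
  proof (rule countable_subset)
    let ?S = "\<lambda>m :: 'n \<Rightarrow> int. {y :: real ^ 'n. \<forall>i. \<lfloor>(y $ i - t $ i) * 2 ^ k / L\<rfloor> = m i}"
    show "range (grid_cell t L k) \<subseteq> range ?S"
    proof
      fix Q assume "Q \<in> range (grid_cell t L k)"
      then obtain x where "Q = grid_cell t L k x" by auto
      then show "Q \<in> range ?S"
        unfolding grid_cell_def by (intro image_eqI[where x = "\<lambda>i. \<lfloor>(x $ i - t $ i) * 2 ^ k / L\<rfloor>"]) simp_all
    qed
  qed simp
  show "grid_cell t L k x \<in> sets lebesgue" for k x by (simp add: grid_cell_eq_hcube[OF L] hcube_sets)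
qed simp

lemma grid_cells_subset: "0 < L \<Longrightarrow> cell_grid.cells (grid_cell t L) \<subseteq> hcubes"
  by (auto simp: cell_grid.cells_def[OF cell_grid_grid_cell] grid_cell_in_hcubes)

lemma dominated_subset: "dominated \<Q> C \<delta> \<mu> \<nu> \<Longrightarrow> \<Q>' \<subseteq> \<Q> \<Longrightarrow> dominated \<Q>' C \<delta> \<mu> \<nu>"
  by (auto simp: dominated_def)

text \<open>
  An open set is the union of the cells contained in it, so outer regularity by open sets is outer
  regularity by unions of cells.
\<close>

lemma grid_cell_regular:
  fixes t :: "real ^ 'n"
  assumes L: "0 < L" and Q: "Q \<in> cell_grid.cells (grid_cell t L)" and E: "E \<in> sets lebesgue" "E \<subseteq> Q" and e: "0 < e"
  shows "\<exists>F\<subseteq>cell_grid.cells (grid_cell t L). E \<subseteq> \<Union>F \<and> \<Union>F \<subseteq> Q \<and> measure lebesgue (\<Union>F) \<le> measure lebesgue E + e"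
proof -
  interpret cell_grid lebesgue "grid_cell t L" by (rule cell_grid_grid_cell[OF L])
  have "Q \<in> hcubes" using Q grid_cells_subset[OF L, of t] by blast
  then obtain b l where bl: "Q = hcube b l" "0 < l" by (auto simp: hcubes_def)
  have finQ: "emeasure lebesgue Q < \<infinity>" using bl emeasure_hcube[of l b] by (simp del: emeasure_completion)
  obtain T where T: "open T" "E \<subseteq> T" "T - E \<in> lmeasurable" "emeasure lebesgue (T - E) < ennreal e"
    using sets_lebesgue_outer_open[OF E(1) e] by blast
  define F where "F = {R \<in> cells. R \<subseteq> Q \<and> R \<subseteq> T}"
  have Fc: "F \<subseteq> cells" by (auto simp: F_def)
  have EF: "E \<subseteq> \<Union>F"
  proof
    fix x assume x: "x \<in> E"
    then obtain k0 where k0: "Q = grid_cell t L k0 x" using cells_at[OF Q] E by blast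
    obtain r where r: "0 < r" "ball x r \<subseteq> T" using T x by (meson openE subsetD)
    define n where "n = real CARD('n)"
    have n: "0 < n" by (simp add: n_def)
    obtain j where j: "L * n / r < 2 ^ j" using real_arch_pow[of 2 "L * n / r"] by auto
    define k where "k = max j k0"
    have "(2::real) ^ j \<le> 2 ^ k" by (rule power_increasing) (simp_all add: k_def)
    then have "L * n / r < 2 ^ k" using j by linarith
    then have small: "n * (L / 2 ^ k) < r" using r by (simp add: field_simps)
    have "grid_cell t L k x \<subseteq> ball x r"
    proof
      fix y assume y: "y \<in> grid_cell t L k x"
      have "x \<in> grid_cell t L k x" by (rule cell_self)
      with y have c: "\<bar>x $ i - y $ i\<bar> \<le> L / 2 ^ k" for i
        unfolding grid_cell_eq_hcube[OF L] hcube_def by (auto simp: abs_le_iff) (smt (verit))+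
      have "norm (x - y) \<le> (\<Sum>i\<in>UNIV. \<bar>(x - y) $ i\<bar>)" by (rule norm_le_l1_cart)
      also have "\<dots> \<le> (\<Sum>i\<in>(UNIV::'n set). L / 2 ^ k)" using c by (intro sum_mono) auto
      also have "\<dots> = n * (L / 2 ^ k)" by (simp add: n_def)
      finally show "y \<in> ball x r" using small by (simp add: dist_norm)
    qed
    moreover have "grid_cell t L k x \<subseteq> Q" unfolding k0 by (rule cell_antimono) (simp add: k_def)
    ultimately have "grid_cell t L k x \<in> F" using r by (auto simp: F_def)
    then show "x \<in> \<Union>F" using cell_self by blast
  qed

  have FQ: "\<Union>F \<subseteq> Q" by (auto simp: F_def)
  have em: "emeasure lebesgue A = ennreal (measure lebesgue A)" if "A \<subseteq> Q" for A
  proof -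
    have "emeasure lebesgue A \<le> emeasure lebesgue Q" using that Q by (intro emeasure_mono) auto
    then show ?thesis using finQ by (intro emeasure_eq_ennreal_measure) auto
  qed
  have "emeasure lebesgue (\<Union>F) \<le> emeasure lebesgue (E \<union> (T - E))"
    using E T by (intro emeasure_mono) (auto simp: F_def)
  also have "\<dots> \<le> emeasure lebesgue E + emeasure lebesgue (T - E)"
    using E T by (intro emeasure_subadditive) auto
  also have "\<dots> \<le> ennreal (measure lebesgue E) + ennreal e"
    using T em[OF E(2)] by (intro add_mono) auto
  finally have "ennreal (measure lebesgue (\<Union>F)) \<le> ennreal (measure lebesgue E + e)"
    using e em[OF FQ] by simp
  then have "measure lebesgue (\<Union>F) \<le> measure lebesgue E + e"
    using e by (subst (asm) ennreal_le_iff) auto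
  then show ?thesis using Fc EF FQ by blast
qed

lemma grid_cell_doubling:
  fixes t :: "real ^ 'n"
  assumes L: "0 < L"
  shows "measure lebesgue (grid_cell t L k x) \<le> 2 ^ CARD('n) * measure lebesgue (grid_cell t L (Suc k) x)"
  using L by (simp add: grid_cell_eq_hcube measure_hcube power_divide power_mult_distrib)

text \<open>
  The one-third trick. As \<open>3\<close> does not divide \<open>2^k\<close>, the end points of the standard grid
  of mesh \<open>s = L / 2^k\<close> and those of its translate by \<open>L / 3\<close> have mutual distance at least
  \<open>s / 3\<close>. An interval of length less than \<open>s / 3\<close> therefore contains end points of at most one
  of the two grids.
\<close>

lemma third_shift_floor_eq:
  fixes c l L s :: real and k :: nat
  assumes L: "0 < L" and s: "s = L / 2 ^ k" and l: "0 \<le> l" "l < s / 3"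
  shows "\<exists>\<tau>\<in>{0, L / 3}. \<forall>z. c \<le> z \<and> z \<le> c + l \<longrightarrow> \<lfloor>(z - \<tau>) * 2 ^ k / L\<rfloor> = \<lfloor>(c - \<tau>) * 2 ^ k / L\<rfloor>"
proof (rule ccontr)
  assume "\<not> ?thesis"
  then obtain z1 z2 where z: "c \<le> z1" "z1 \<le> c + l" "\<lfloor>(z1 - 0) * 2 ^ k / L\<rfloor> \<noteq> \<lfloor>(c - 0) * 2 ^ k / L\<rfloor>"
    "c \<le> z2" "z2 \<le> c + l" "\<lfloor>(z2 - L / 3) * 2 ^ k / L\<rfloor> \<noteq> \<lfloor>(c - L / 3) * 2 ^ k / L\<rfloor>" by auto
  have s0: "0 < s" using L s by simp
  have key: "\<exists>m::int. c < \<tau> + s * of_int m \<and> \<tau> + s * of_int m \<le> c + l"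
    if zz: "c \<le> z" "z \<le> c + l" "\<lfloor>(z - \<tau>) * 2 ^ k / L\<rfloor> \<noteq> \<lfloor>(c - \<tau>) * 2 ^ k / L\<rfloor>" for z \<tau>
  proof -
    have sc: "r * 2 ^ k / L = r / s" for r using L unfolding s by simp
    define m where "m = \<lfloor>(z - \<tau>) / s\<rfloor>"
    have "(c - \<tau>) / s \<le> (z - \<tau>) / s" using zz s0 by (simp add: divide_right_mono)
    then have "\<lfloor>(c - \<tau>) / s\<rfloor> \<le> m" unfolding m_def by (rule floor_mono)
    then have "\<lfloor>(c - \<tau>) / s\<rfloor> < m" using zz(3) unfolding sc m_def by simp
    then have "(c - \<tau>) / s < of_int m" by (simp add: floor_less_iff)
    moreover have "of_int m \<le> (z - \<tau>) / s" unfolding m_def by simp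
    ultimately have "c - \<tau> < s * of_int m" "s * of_int m \<le> z - \<tau>" using s0 by (simp_all add: field_simps)
    then show ?thesis using zz by (intro exI[of _ m]) auto
  qed
  obtain a :: int where a: "c < 0 + s * of_int a" "0 + s * of_int a \<le> c + l" using key[OF z(1,2,3)] by auto
  obtain b :: int where b: "c < L / 3 + s * of_int b" "L / 3 + s * of_int b \<le> c + l" using key[OF z(4,5,6)] by auto
  have Ls: "L = s * 2 ^ k" using s by simp
  have "\<bar>s * of_int a - (L / 3 + s * of_int b)\<bar> < s / 3" using a b l by linarith
  moreover have "s * of_int a - (L / 3 + s * of_int b) = s / 3 * of_int (3 * (a - b) - 2 ^ k)"
    unfolding Ls by (simp add: field_simps)
  ultimately have "s / 3 * \<bar>of_int (3 * (a - b) - 2 ^ k)\<bar> < s / 3 * (1::real)" using s0 by (simp add: abs_mult)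
  then have "\<bar>of_int (3 * (a - b) - 2 ^ k)\<bar> < (1::real)" using s0 by (subst (asm) mult_less_cancel_left_pos) auto
  then have "3 * (a - b) - 2 ^ k = (0::int)" by linarith
  then have "(3::int) dvd 2 ^ k" by (metis dvd_triv_left eq_iff_diff_eq_0)
  then have "(3::int) dvd 2" by (rule prime_dvd_power[rotated]) simp
  then show False by simp
qed

text \<open>
  The shift can be chosen separately in each coordinate, with the same generation \<open>k\<close>: the first one whose
  cells have side at most \<open>6 l\<close>, so that their side is still more than \<open>3 l\<close>.
\<close>

lemma cube_in_grid_cell:
  fixes a :: "real ^ 'n"
  assumes L: "0 < L" and l: "0 < l" "l < L / 3"
  shows "\<exists>t k. (\<forall>i. t $ i \<in> {0, L / 3}) \<and> ccube a l \<subseteq> grid_cell t L k a \<and> L / 2 ^ k \<le> 6 * l"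
proof -
  define P where "P k \<longleftrightarrow> L / 2 ^ k \<le> 6 * l" for k :: nat
  obtain n where "L / (6 * l) < 2 ^ n" using real_arch_pow[of 2 "L / (6 * l)"] by auto
  then have "P n" using l by (simp add: P_def field_simps)
  define k where "k = (LEAST k. P k)"
  have Pk: "P k" unfolding k_def using \<open>P n\<close> by (rule LeastI)
  have "l < L / 2 ^ k / 3"
  proof (cases k)
    case (Suc j)
    then have "\<not> P j" unfolding k_def by (metis lessI not_less_Least)
    then show ?thesis using Suc by (simp add: P_def field_simps)
  qed (use l in simp)
  then have "\<forall>i. \<exists>\<tau>. \<tau> \<in> {0, L / 3} \<and> (\<forall>z. a $ i \<le> z \<and> z \<le> a $ i + l \<longrightarrow> \<lfloor>(z - \<tau>) * 2 ^ k / L\<rfloor> = \<lfloor>(a $ i - \<tau>) * 2 ^ k / L\<rfloor>)"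
    using third_shift_floor_eq[OF L refl, of l k] l by (metis less_imp_le)
  then obtain \<tau> where \<tau>: "\<And>i. \<tau> i \<in> {0, L / 3}"
    "\<And>i z. a $ i \<le> z \<Longrightarrow> z \<le> a $ i + l \<Longrightarrow> \<lfloor>(z - \<tau> i) * 2 ^ k / L\<rfloor> = \<lfloor>(a $ i - \<tau> i) * 2 ^ k / L\<rfloor>"
    by (metis (no_types, lifting))
  show ?thesis
  proof (intro exI[of _ "\<chi> i. \<tau> i"] exI[of _ k] conjI)
    show "\<forall>i. (\<chi> i. \<tau> i) $ i \<in> {0, L / 3}" using \<tau>(1) by simp
    show "ccube a l \<subseteq> grid_cell (\<chi> i. \<tau> i) L k a"
      using \<tau>(2) by (auto simp: ccube_def mem_box_cart grid_cell_def)
    show "L / 2 ^ k \<le> 6 * l" using Pk by (simp add: P_def)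
  qed
qed

section \<open>Weights\<close>

abbreviation weight_measure :: "(real ^ 'n \<Rightarrow> real) \<Rightarrow> (real ^ 'n) measure" where
  "weight_measure w \<equiv> density lebesgue (\<lambda>x. ennreal (w x))"

lemma is_weight_measurable:
  fixes w :: "real ^ 'n \<Rightarrow> real"
  assumes "is_weight w"
  shows "w \<in> borel_measurable lebesgue"
proof (rule borel_measurable_LIMSEQ_real)
  fix n :: nat
  have "set_integrable lebesgue (cball 0 (real n)) w" using assms by (simp add: is_weight_def)
  then show "(\<lambda>x. indicator (cball 0 (real n)) x *\<^sub>R w x) \<in> borel_measurable lebesgue"
    unfolding set_integrable_def by (rule borel_measurable_integrable)
next
  fix x :: "real ^ 'n"
  obtain N where N: "norm x \<le> real N" using real_arch_simple by blast
  have "eventually (\<lambda>n. indicator (cball 0 (real n)) x *\<^sub>R w x = w x) sequentially"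
    using eventually_ge_at_top[of N] by eventually_elim (use N in \<open>auto simp: indicator_def dist_norm\<close>)
  then show "(\<lambda>n. indicator (cball 0 (real n)) x *\<^sub>R w x) \<longlonglongrightarrow> w x" by (rule tendsto_eventually)
qed

lemma is_weight_pos: "is_weight w \<Longrightarrow> 0 < w x"
  by (simp add: is_weight_def)

lemma weight_meas_eq:
  "is_weight w \<Longrightarrow> E \<in> sets lebesgue \<Longrightarrow> weight_meas w E = emeasure (weight_measure w) E"
  using is_weight_measurable[of w] by (subst emeasure_density) (auto simp: weight_meas_def)

lemma weight_null:
  assumes "is_weight w" "E \<in> null_sets lebesgue"
  shows "emeasure (weight_measure w) E = 0"
proof -
  have "absolutely_continuous lebesgue (weight_measure w)"
    using is_weight_measurable[OF assms(1)] by (intro absolutely_continuousI_density) measurable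
  then show ?thesis using assms(2) by (auto simp: absolutely_continuous_def)
qed

lemma weight_ccube_finite:
  assumes w: "is_weight w"
  shows "emeasure (weight_measure w) (ccube a l) < \<infinity>"
proof -
  have [measurable]: "w \<in> borel_measurable lebesgue" using w by (rule is_weight_measurable)
  have "set_integrable lebesgue (ccube a l) w" using w by (simp add: is_weight_def ccube_def)
  then have "(\<integral>\<^sup>+x. ennreal (norm (indicator (ccube a l) x *\<^sub>R w x)) \<partial>lebesgue) < \<infinity>"
    unfolding set_integrable_def by (simp add: integrable_iff_bounded)
  also have "(\<integral>\<^sup>+x. ennreal (norm (indicator (ccube a l) x *\<^sub>R w x)) \<partial>lebesgue) = emeasure (weight_measure w) (ccube a l)"
    using is_weight_pos[OF w]
    by (subst emeasure_density)
       (auto intro!: nn_integral_cong split: split_indicator simp: ccube_def less_imp_le)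
  finally show ?thesis .
qed

lemma weight_positive:
  assumes w: "is_weight w" and E: "E \<in> sets lebesgue" "emeasure lebesgue E \<noteq> 0"
  shows "emeasure (weight_measure w) E \<noteq> 0"
proof
  assume z: "emeasure (weight_measure w) E = 0"
  have [measurable]: "w \<in> borel_measurable lebesgue" using w by (rule is_weight_measurable)
  have "(\<integral>\<^sup>+x. ennreal (w x) * indicator E x \<partial>lebesgue) = 0" using z E by (simp add: emeasure_density)
  then have "AE x in lebesgue. ennreal (w x) * indicator E x = 0"
    using E by (subst (asm) nn_integral_0_iff_AE) auto
  then have "AE x in lebesgue. x \<notin> E"
  proof eventually_elim
    case (elim x)
    then show ?case using is_weight_pos[OF w, of x] by (auto simp: indicator_def ennreal_eq_0_iff)
  qed
  then show False using E AE_iff_null_sets by blast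
qed

lemma ccube_pos_finite:
  assumes w: "is_weight w" and l: "0 < l"
  shows "0 < measure (weight_measure w) (ccube a l)" "emeasure (weight_measure w) (ccube a l) = ennreal (measure (weight_measure w) (ccube a l))"
proof -
  show e: "emeasure (weight_measure w) (ccube a l) = ennreal (measure (weight_measure w) (ccube a l))"
    using weight_ccube_finite[OF w] by (intro emeasure_eq_ennreal_measure) (auto simp: less_top)
  have "emeasure lebesgue (ccube a l) \<noteq> 0" using l emeasure_ccube[of l a] by (simp del: emeasure_completion)
  then have "emeasure (weight_measure w) (ccube a l) \<noteq> 0" by (intro weight_positive[OF w]) (simp_all add: ccube_def)
  then show "0 < measure (weight_measure w) (ccube a l)" using e by (simp add: zero_less_measure_iff)
qed

lemma weight_subset_ccube:
  assumes w: "is_weight w" and E: "E \<subseteq> ccube a l"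
  shows "emeasure (weight_measure w) E = ennreal (measure (weight_measure w) E)"
proof -
  have "emeasure (weight_measure w) E \<le> emeasure (weight_measure w) (ccube a l)"
    using E by (intro emeasure_mono) (auto simp: ccube_def)
  then show ?thesis using weight_ccube_finite[OF w, of a l]
    by (intro emeasure_eq_ennreal_measure) (auto simp: less_top[symmetric] top_unique)
qed

lemma weight_hcube:
  assumes w: "is_weight w" and Q: "Q \<in> hcubes"
  shows "0 < emeasure (weight_measure w) Q" "emeasure (weight_measure w) Q < \<infinity>"
proof -
  obtain a l where al: "Q = hcube a l" "0 < l" using Q by (auto simp: hcubes_def)
  have "emeasure (weight_measure w) Q = emeasure (weight_measure w) (ccube a l)"
    unfolding al by (rule emeasure_hcube_eq) (auto intro: weight_null[OF w])
  then show "0 < emeasure (weight_measure w) Q" "emeasure (weight_measure w) Q < \<infinity>"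
    using ccube_pos_finite[OF w al(2), of a] by auto
qed

lemma is_weight_1: "is_weight (\<lambda>x. 1)"
  unfolding is_weight_def
proof (intro conjI allI impI)
  fix K :: "(real ^ 'n) set" assume "compact K"
  then have "K \<in> lmeasurable" by (rule lmeasurable_compact)
  then have "integrable lebesgue (indicator K :: _ \<Rightarrow> real)"
    by (intro integrable_real_indicator) (auto simp: fmeasurable_def)
  then show "set_integrable lebesgue K (\<lambda>x. 1)" by (simp add: set_integrable_def)
qed simp

lemma cubes_sets: "Q \<in> cubes \<Longrightarrow> Q \<in> sets lebesgue"
  by (auto simp: cubes_def)

lemma cube_weight:
  assumes "is_weight w" "Q \<in> cubes"
  shows "0 < measure (weight_measure w) Q"
    and "E \<subseteq> Q \<Longrightarrow> emeasure (weight_measure w) E = ennreal (measure (weight_measure w) E)"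
  using assms ccube_pos_finite(1) weight_subset_ccube unfolding cubes_ccube by blast+

lemma cube_lebesgue:
  assumes "Q \<in> cubes"
  shows "0 < measure lebesgue Q"
    and "E \<subseteq> Q \<Longrightarrow> emeasure lebesgue E = ennreal (measure lebesgue E)"
  using cube_weight[OF is_weight_1 assms] by (simp_all add: density_1 del: emeasure_completion)

lemma cube_avg_weight:
  assumes w: "is_weight w" and Q: "Q \<in> cubes"
  shows "cube_avg w Q = ennreal (measure (weight_measure w) Q / measure lebesgue Q)"
proof -
  have [measurable]: "w \<in> borel_measurable lebesgue" "Q \<in> sets lebesgue"
    using w Q by (auto intro: is_weight_measurable cubes_sets)
  have "(\<integral>\<^sup>+x\<in>Q. ennreal \<bar>w x\<bar> \<partial>lebesgue) = emeasure (weight_measure w) Q"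
    using is_weight_pos[OF w] by (subst emeasure_density) (auto simp: less_imp_le)
  then show ?thesis
    using cube_weight(2)[OF w Q order_refl] cube_lebesgue(1)[OF Q] cube_lebesgue(2)[OF Q order_refl]
    by (simp add: cube_avg_def divide_ennreal del: emeasure_completion)
qed

text \<open>
  The measure \<open>|E|\<close> is the integral of \<open>1/u\<close> over \<open>E\<close> against \<open>u\<close>. The \<open>A_p^R\<close> condition
  bounds the weak \<open>L^{p'}(u)\<close> norm of \<open>1/u\<close> on \<open>Q\<close>, and Kolmogorov's inequality bounds the
  integral.
\<close>

lemma ApR_dominated:
  fixes u :: "real ^ 'n \<Rightarrow> real"
  assumes p: "1 < p" and u: "u \<in> ApR p"
  shows "\<exists>C>0. dominated cubes C (1 / p) (weight_measure u) lebesgue"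
proof -
  have w: "is_weight u" and fin: "ApR_const p u < \<infinity>" using u by (auto simp: ApR_def)
  have [measurable]: "u \<in> borel_measurable lebesgue" using w by (rule is_weight_measurable)
  define q where "q = conj_exponent p"
  have q: "1 < q" and q_inv: "1 / q = 1 - 1 / p"
    using p by (auto simp: q_def conj_exponent_def field_simps)
  obtain K0 where K0: "ApR_const p u = ennreal K0" "0 \<le> K0" using fin by (cases "ApR_const p u") auto
  define K where "K = K0 + 1"
  have K: "0 < K" "ApR_const p u \<le> ennreal K" using K0 by (auto simp: K_def intro!: ennreal_leI)
  define Kq where "Kq = 1 + 2 / (1 - 2 powr (1 - q))"
  have Kq: "0 < Kq" unfolding Kq_def using q by (intro add_pos_nonneg) (auto simp: powr_less_one less_imp_le)
  show ?thesis
  proof (intro exI[of _ "Kq * K"] conjI)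
    show "0 < Kq * K" using Kq K by simp
    show "dominated cubes (Kq * K) (1 / p) (weight_measure u) lebesgue"
      unfolding dominated_def
    proof (intro ballI impI)
      fix Q E assume Q: "Q \<in> cubes" and E: "E \<in> sets (weight_measure u)" "E \<subseteq> Q"
      have [measurable]: "E \<in> sets lebesgue" "Q \<in> sets lebesgue" using E cubes_sets[OF Q] by auto
      define m where "m = measure (weight_measure u) Q"
      define V where "V = measure lebesgue Q"
      have m: "0 < m" "weight_meas u Q = ennreal m"
        using cube_weight(1)[OF w Q] cube_weight(2)[OF w Q order_refl] by (auto simp: m_def weight_meas_eq[OF w])
      have V: "0 < V" "emeasure lebesgue Q = ennreal V" using cube_lebesgue(1)[OF Q] cube_lebesgue(2)[OF Q order_refl] by (auto simp: V_def)
      let ?\<phi> = "\<lambda>x. indicator Q x * ennreal (1 / u x)"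
      define N where "N = lorentz_weak q u ?\<phi>"
      have "ennreal_pow (weight_meas u Q) (1 / p) * (N / emeasure lebesgue Q) \<le> ApR_const p u"
        unfolding ApR_const_def N_def q_def using Q by (rule SUP_upper)
      then have "ennreal (m powr (1 / p)) * (N / ennreal V) \<le> ennreal K"
        using K(2) m V by (simp add: ennreal_pow_ennreal del: emeasure_completion)
      then have "ennreal (V / m powr (1 / p)) * (ennreal (m powr (1 / p)) * (N / ennreal V))
          \<le> ennreal (V / m powr (1 / p)) * ennreal K"
        by (rule mult_left_mono) simp
      also have "\<dots> = ennreal (K * V / m powr (1 / p))"
        using K V by (simp add: ennreal_mult[symmetric] mult.commute)
      also have "ennreal (V / m powr (1 / p)) * (ennreal (m powr (1 / p)) * (N / ennreal V)) = N"
      proof -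
        have "ennreal (V / m powr (1 / p)) * (ennreal (m powr (1 / p)) * (N / ennreal V))
          = (ennreal (V / m powr (1 / p)) * ennreal (m powr (1 / p))) * N / ennreal V"
          by (simp add: mult.assoc ennreal_times_divide)
        also have "ennreal (V / m powr (1 / p)) * ennreal (m powr (1 / p)) = ennreal V"
          using m V by (simp add: ennreal_mult[symmetric])
        also have "ennreal V * N / ennreal V = N"
          using V by (simp add: ennreal_mult_divide_eq mult.commute[of "ennreal V"])
        finally show ?thesis .
      qed
      finally have N: "N \<le> ennreal (K * V / m powr (1 / p))" .
      define n0 where "n0 = K * V / m powr (1 / p)"
      have n0: "0 < n0" using K V m by (simp add: n0_def)
      have weak: "emeasure (weight_measure u) {x \<in> space (weight_measure u). ennreal y < ?\<phi> x} \<le> ennreal (n0 powr q * y powr (- q))"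
        if y: "0 < y" for y
      proof -
        have "ennreal y * ennreal_pow (distr_fun u ?\<phi> y) (1 / q) \<le> N"
          unfolding N_def lorentz_weak_def by (rule SUP_upper) (use y in auto)
        then have "ennreal y * ennreal_pow (distr_fun u ?\<phi> y) (1 / q) \<le> ennreal n0"
          using N by (simp add: n0_def)
        then have "distr_fun u ?\<phi> y \<le> ennreal ((n0 / y) powr (1 / (1 / q)))"
          using y n0 q by (subst (asm) ennreal_mult_pow_le_iff) auto
        moreover have "distr_fun u ?\<phi> y = emeasure (weight_measure u) {x \<in> space (weight_measure u). ennreal y < ?\<phi> x}"
        proof -
          have "{x \<in> space lebesgue. ennreal y < ?\<phi> x} \<in> sets lebesgue" by measurable
          then show ?thesis unfolding distr_fun_def by (simp add: weight_meas_eq[OF w])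
        qed
        ultimately show ?thesis using y n0 by (simp add: powr_divide powr_minus field_simps)
      qed
      have finE: "emeasure (weight_measure u) E < \<infinity>" using cube_weight(2)[OF w Q E(2)] by simp
      have "emeasure lebesgue E = (\<integral>\<^sup>+x\<in>E. ?\<phi> x \<partial>weight_measure u)"
      proof -
        have "(\<integral>\<^sup>+x\<in>E. ?\<phi> x \<partial>weight_measure u) = (\<integral>\<^sup>+x. ennreal (u x) * (?\<phi> x * indicator E x) \<partial>lebesgue)"
          by (rule nn_integral_density) measurable
        also have "\<dots> = (\<integral>\<^sup>+x. indicator E x \<partial>lebesgue)"
        proof (rule nn_integral_cong)
          fix x
          have "ennreal (u x) * ennreal (1 / u x) = 1"
            using is_weight_pos[OF w, of x] by (simp add: ennreal_mult[symmetric])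
          then show "ennreal (u x) * (?\<phi> x * indicator E x) = indicator E x"
            using E by (auto split: split_indicator)
        qed
        finally show ?thesis by simp
      qed
      also have "\<dots> \<le> ennreal (Kq * (n0 powr q) powr (1 / q) * measure (weight_measure u) E powr (1 - 1 / q))"
        unfolding Kq_def
        by (rule weak_type_set_integral[OF _ _ q _ weak finE]) (use n0 in simp_all)
      also have "(n0 powr q) powr (1 / q) = n0" using n0 q by (simp add: powr_powr)
      finally have "measure lebesgue E \<le> Kq * n0 * measure (weight_measure u) E powr (1 / p)"
        using Kq n0 q_inv by (simp add: measure_def enn2real_leI del: emeasure_completion)
      also have "\<dots> = Kq * K * (measure (weight_measure u) E / m) powr (1 / p) * V"
        by (simp add: n0_def powr_divide)
      finally show "measure lebesgue E \<le> Kq * K * (measure (weight_measure u) E / measure (weight_measure u) Q) powr (1 / p) * measure lebesgue Q"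
        by (simp add: m_def V_def)
    qed
  qed
qed

text \<open>
  The average of \<open>w\<close> over \<open>Q\<close> is at most \<open>C w\<close> almost everywhere on \<open>Q\<close>; integrate over
  \<open>E\<close>.
\<close>

lemma A1_dominated:
  fixes w :: "real ^ 'n \<Rightarrow> real"
  assumes w: "is_weight w" and A1: "AE x in lebesgue. HL_maximal w x \<le> ennreal (C * w x)"
  shows "\<exists>C>0. dominated cubes C 1 (weight_measure w) lebesgue"
proof (intro exI[of _ "\<bar>C\<bar> + 1"] conjI)
  show "0 < \<bar>C\<bar> + 1" by simp
  have [measurable]: "w \<in> borel_measurable lebesgue" using w by (rule is_weight_measurable)
  show "dominated cubes (\<bar>C\<bar> + 1) 1 (weight_measure w) lebesgue"
    unfolding dominated_def
  proof (intro ballI impI)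
    fix Q E assume Q: "Q \<in> cubes" and E: "E \<in> sets (weight_measure w)" "E \<subseteq> Q"
    have [measurable]: "E \<in> sets lebesgue" "Q \<in> sets lebesgue" using E cubes_sets[OF Q] by auto
    define m where "m = measure (weight_measure w) Q"
    define V where "V = measure lebesgue Q"
    have m: "0 < m" using cube_weight(1)[OF w Q] by (simp add: m_def)
    have V: "0 < V" "emeasure lebesgue Q = ennreal V" using cube_lebesgue(1)[OF Q] cube_lebesgue(2)[OF Q order_refl] by (auto simp: V_def)
    have avg: "cube_avg w Q = ennreal (m / V)" using cube_avg_weight[OF w Q] by (simp add: m_def V_def)
    have "AE x in lebesgue. ennreal (m / V) * indicator E x \<le> ennreal (\<bar>C\<bar> + 1) * (ennreal (w x) * indicator E x)"
      using A1
    proof eventually_elim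
      case (elim x)
      show ?case
      proof (cases "x \<in> E")
        case True
        then have "cube_avg w Q \<le> HL_maximal w x" unfolding HL_maximal_def using Q E by (intro SUP_upper) auto
        then have "ennreal (m / V) \<le> ennreal (C * w x)" using elim avg by simp
        also have "\<dots> \<le> ennreal ((\<bar>C\<bar> + 1) * w x)"
          using is_weight_pos[OF w, of x] by (intro ennreal_leI mult_right_mono) auto
        also have "\<dots> = ennreal (\<bar>C\<bar> + 1) * ennreal (w x)" by (rule ennreal_mult'') (use is_weight_pos[OF w, of x] in simp)
        finally show ?thesis using True by simp
      qed simp
    qed
    then have "(\<integral>\<^sup>+x. ennreal (m / V) * indicator E x \<partial>lebesgue)
       \<le> (\<integral>\<^sup>+x. ennreal (\<bar>C\<bar> + 1) * (ennreal (w x) * indicator E x) \<partial>lebesgue)"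
      by (rule nn_integral_mono_AE)
    also have "\<dots> = ennreal (\<bar>C\<bar> + 1) * emeasure (weight_measure w) E"
      by (subst nn_integral_cmult) (auto simp: emeasure_density)
    also have "\<dots> = ennreal ((\<bar>C\<bar> + 1) * measure (weight_measure w) E)"
      using cube_weight(2)[OF w Q E(2)] by (simp add: ennreal_mult)
    also have "(\<integral>\<^sup>+x. ennreal (m / V) * indicator E x \<partial>lebesgue) = ennreal (m / V) * emeasure lebesgue E"
      by (rule nn_integral_cmult_indicator) simp
    also have "emeasure lebesgue E = ennreal (measure lebesgue E)" by (rule cube_lebesgue(2)[OF Q E(2)])
    finally have "m / V * measure lebesgue E \<le> (\<bar>C\<bar> + 1) * measure (weight_measure w) E"
      using m V by (subst (asm) ennreal_mult[symmetric]) (auto simp: ennreal_le_iff)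
    then have "measure lebesgue E \<le> (\<bar>C\<bar> + 1) * (measure (weight_measure w) E / m) * V"
      using m V by (simp add: field_simps)
    then show "measure lebesgue E \<le> (\<bar>C\<bar> + 1) * (measure (weight_measure w) E / measure (weight_measure w) Q) powr 1 * measure lebesgue Q"
      by (simp add: m_def V_def)
  qed
qed

text \<open>
  Hoelder's inequality up to a factor 2: the pointwise bound \<open>1 \<le> s w + (s w)^(-e)\<close> with
  \<open>e = 1 / (q - 1)\<close> is integrated over \<open>E\<close> and optimised in \<open>s\<close>. Here \<open>S\<close> is the bound
  that the \<open>A_q\<close> condition gives for the integral of \<open>w^(-e)\<close> over \<open>Q\<close>.
\<close>

lemma Aq_dominated:
  fixes w :: "real ^ 'n \<Rightarrow> real"
  assumes w: "is_weight w" and q: "1 < q" and fin: "Aq_const q w < \<infinity>"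
  shows "\<exists>C>0. dominated cubes C (1 / q) (weight_measure w) lebesgue"
proof -
  have [measurable]: "w \<in> borel_measurable lebesgue" using w by (rule is_weight_measurable)
  define e where "e = 1 / (q - 1)"
  have e: "0 < e" "1 - conj_exponent q = - e" "1 / e = q - 1"
    using q by (auto simp: e_def conj_exponent_def field_simps)
  obtain K0 where K0: "Aq_const q w = ennreal K0" "0 \<le> K0" using fin by (cases "Aq_const q w") auto
  define K where "K = K0 + 1"
  have K: "0 < K" "Aq_const q w \<le> ennreal K" using K0 by (auto simp: K_def intro!: ennreal_leI)
  show ?thesis
  proof (intro exI[of _ "2 * K powr (1 / q)"] conjI)
    show "0 < 2 * K powr (1 / q)" using K by simp
    show "dominated cubes (2 * K powr (1 / q)) (1 / q) (weight_measure w) lebesgue"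
      unfolding dominated_def
    proof (intro ballI impI)
      fix Q E assume Q: "Q \<in> cubes" and E: "E \<in> sets (weight_measure w)" "E \<subseteq> Q"
      have [measurable]: "E \<in> sets lebesgue" "Q \<in> sets lebesgue" using E cubes_sets[OF Q] by auto
      define m where "m = measure (weight_measure w) Q"
      define V where "V = measure lebesgue Q"
      have m: "0 < m" using cube_weight(1)[OF w Q] by (simp add: m_def)
      have V: "0 < V" "emeasure lebesgue Q = ennreal V" using cube_lebesgue(1)[OF Q] cube_lebesgue(2)[OF Q order_refl] by (auto simp: V_def)
      have avg: "cube_avg w Q = ennreal (m / V)" using cube_avg_weight[OF w Q] by (simp add: m_def V_def)
      define \<sigma> where "\<sigma> = (\<integral>\<^sup>+x\<in>Q. ennreal (w x powr (- e)) \<partial>lebesgue)"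
      define S where "S = V * (K * V / m) powr e"
      have S: "0 < S" using V K m by (simp add: S_def)
      have \<sigma>: "\<sigma> \<le> ennreal S"
      proof -
        have "cube_avg w Q * ennreal_pow (cube_avg (\<lambda>x. w x powr (1 - conj_exponent q)) Q) (q - 1) \<le> Aq_const q w"
          unfolding Aq_const_def using Q by (rule SUP_upper)
        moreover have "cube_avg (\<lambda>x. w x powr (1 - conj_exponent q)) Q = \<sigma> / ennreal V"
          unfolding e(2) cube_avg_def V(2) \<sigma>_def by simp
        ultimately have "ennreal (m / V) * ennreal_pow (\<sigma> / ennreal V) (q - 1) \<le> ennreal K"
          using order_trans[OF _ K(2)] unfolding avg by simp
        then have "\<sigma> / ennreal V \<le> ennreal ((K / (m / V)) powr (1 / (q - 1)))"
          using m V K q by (subst (asm) ennreal_mult_pow_le_iff) auto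
        then have "ennreal V * (\<sigma> / ennreal V) \<le> ennreal V * ennreal ((K * V / m) powr e)"
          by (intro mult_left_mono) (auto simp: e_def)
        also have "\<dots> = ennreal S" using V by (simp add: S_def ennreal_mult)
        also have "ennreal V * (\<sigma> / ennreal V) = \<sigma>"
          using V by (simp add: ennreal_times_divide mult.commute[of "ennreal V"] ennreal_mult_divide_eq)
        finally show ?thesis .
      qed
      define b where "b = measure (weight_measure w) E"
      have emE: "emeasure (weight_measure w) E = ennreal b" using cube_weight(2)[OF w Q E(2)] by (simp add: b_def)
      have emLE: "emeasure lebesgue E = ennreal (measure lebesgue E)" by (rule cube_lebesgue(2)[OF Q E(2)])
      have "measure lebesgue E \<le> 2 * (S powr (1 - 1 / q) * b powr (1 / q))"
      proof (cases "b = 0")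
        case True
        then have "emeasure lebesgue E = 0" using weight_positive[OF w, of E] emE by auto
        then show ?thesis using S by (simp add: measure_def del: emeasure_completion)
      next
        case False
        then have b: "0 < b" by (simp add: b_def zero_less_measure_iff)
        define s where "s = (S / b) powr (1 - 1 / q)"
        have s: "0 < s" using S b by (simp add: s_def)
        have "emeasure lebesgue E = (\<integral>\<^sup>+x. indicator E x \<partial>lebesgue)" by simp
        also have "\<dots> \<le> (\<integral>\<^sup>+x. ennreal s * (ennreal (w x) * indicator E x)
            + ennreal (s powr (- e)) * (ennreal (w x powr (- e)) * indicator Q x) \<partial>lebesgue)"
        proof (rule nn_integral_mono)
          fix x
          show "indicator E x \<le> ennreal s * (ennreal (w x) * indicator E x)
            + ennreal (s powr (- e)) * (ennreal (w x powr (- e)) * indicator Q x)"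
          proof (cases "x \<in> E")
            case True
            have wx: "0 < w x" by (rule is_weight_pos[OF w])
            have "1 \<le> s * w x + s powr (- e) * w x powr (- e)"
            proof (cases "1 \<le> s * w x")
              case True
              then show ?thesis by (simp add: add_increasing2)
            next
              case False
              then have "1 powr (- e) \<le> (s * w x) powr (- e)" using s wx e by (intro powr_mono2') auto
              then show ?thesis using s wx by (simp add: powr_mult add_increasing)
            qed
            then have "ennreal 1 \<le> ennreal (s * w x + s powr (- e) * w x powr (- e))" by (rule ennreal_leI)
            also have "\<dots> = ennreal s * ennreal (w x) + ennreal (s powr (- e)) * ennreal (w x powr (- e))"
              using s wx by (simp add: ennreal_plus ennreal_mult)
            finally show ?thesis using True E by auto
          qed simp
        qed
        also have "\<dots> = ennreal s * emeasure (weight_measure w) E + ennreal (s powr (- e)) * \<sigma>"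
          unfolding \<sigma>_def by (subst nn_integral_add) (auto simp: nn_integral_cmult emeasure_density)
        also have "\<dots> \<le> ennreal s * ennreal b + ennreal (s powr (- e)) * ennreal S"
          unfolding emE using \<sigma> by (intro add_mono mult_left_mono) auto
        also have "\<dots> = ennreal (s * b + s powr (- e) * S)"
          using s b S by (simp add: ennreal_plus ennreal_mult)
        finally have "measure lebesgue E \<le> s * b + s powr (- e) * S"
          unfolding emLE using s b S by (subst (asm) ennreal_le_iff) auto
        also have "s * b = S powr (1 - 1 / q) * b powr (1 / q)"
          unfolding s_def using S b by (simp add: powr_divide powr_diff)
        also have "s powr (- e) * S = S powr (1 - 1 / q) * b powr (1 / q)"
        proof -
          have "(1 - 1 / q) * (- e) = - (1 / q)" using q by (simp add: e_def field_simps)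
          then have "s powr (- e) = (S / b) powr (- (1 / q))" unfolding s_def powr_powr by simp
          also have "(S / b) powr (- (1 / q)) = S powr (- (1 / q)) * b powr (1 / q)"
            using S b by (simp add: powr_divide powr_minus field_simps)
          finally have "s powr (- e) * S = S powr (- (1 / q)) * S * b powr (1 / q)" by simp
          also have "S powr (- (1 / q)) * S = S powr (1 - 1 / q)"
            using S powr_add[of S "- (1 / q)" 1] by simp
          finally show ?thesis .
        qed
        finally show ?thesis by (simp add: mult.commute)
      qed
      also have "S powr (1 - 1 / q) = V * (K / m) powr (1 / q)"
      proof -
        have "e * (1 - 1 / q) = 1 / q" using q by (simp add: e_def field_simps)
        then have "S powr (1 - 1 / q) = V powr (1 - 1 / q) * (K * V / m) powr (1 / q)"
          unfolding S_def powr_mult powr_powr by simp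
        also have "(K * V / m) powr (1 / q) = (K / m) powr (1 / q) * V powr (1 / q)"
          by (simp add: powr_mult[symmetric])
        also have "V powr (1 - 1 / q) * ((K / m) powr (1 / q) * V powr (1 / q)) = V * (K / m) powr (1 / q)"
          using V by (simp add: powr_diff)
        finally show ?thesis .
      qed
      also have "2 * (V * (K / m) powr (1 / q) * b powr (1 / q)) = 2 * K powr (1 / q) * (b / m) powr (1 / q) * V"
        by (simp add: powr_divide)
      finally show "measure lebesgue E \<le> 2 * K powr (1 / q) * (measure (weight_measure w) E / measure (weight_measure w) Q) powr (1 / q) * measure lebesgue Q"
        by (simp add: m_def b_def V_def)
    qed
  qed
qed

lemma A_infty_dominated:
  assumes "w \<in> A_infty"
  shows "\<exists>C \<delta>. 0 < C \<and> 0 < \<delta> \<and> dominated cubes C \<delta> (weight_measure w) lebesgue"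
proof -
  obtain q where q: "1 \<le> q" "w \<in> Aq q" using assms by (auto simp: A_infty_def)
  then have w: "is_weight w" by (simp add: Aq_def)
  show ?thesis
  proof (cases "q = 1")
    case True
    then obtain C where "AE x in lebesgue. HL_maximal w x \<le> ennreal (C * w x)" using q by (auto simp: Aq_def)
    from A1_dominated[OF w this] show ?thesis using zero_less_one by blast
  next
    case False
    then have "1 < q" "Aq_const q w < \<infinity>" using q by (auto simp: Aq_def)
    obtain C where "0 < C" "dominated cubes C (1 / q) (weight_measure w) lebesgue"
      using Aq_dominated[OF w \<open>1 < q\<close> \<open>Aq_const q w < \<infinity>\<close>] by auto
    then show ?thesis using \<open>1 < q\<close> by (intro exI[of _ C] exI[of _ "1 / q"]) simp
  qed
qed

text \<open>
  On \<open>Q\<close> the function \<open>g\<close> is at most a constant times its \<open>w\<close>-average almost everywhere; integrate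
  over \<open>E\<close>.
\<close>

lemma RH_infty_dominated:
  fixes w g :: "real ^ 'n \<Rightarrow> real"
  assumes w: "is_weight w" and wg: "is_weight (\<lambda>x. w x * g x)"
    and g [measurable]: "g \<in> borel_measurable lebesgue" and g_pos: "\<And>x. 0 < g x"
    and fin: "RH_infty_const w g < \<infinity>"
  shows "\<exists>C>0. dominated cubes C 1 (weight_measure w) (weight_measure (\<lambda>x. w x * g x))"
proof -
  have [measurable]: "w \<in> borel_measurable lebesgue" using w by (rule is_weight_measurable)
  obtain K0 where K0: "RH_infty_const w g = ennreal K0" "0 \<le> K0" using fin by (cases "RH_infty_const w g") auto
  define K where "K = K0 + 1"
  have K: "0 < K" "RH_infty_const w g \<le> ennreal K" using K0 by (auto simp: K_def intro!: ennreal_leI)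
  let ?\<rho> = "weight_measure (\<lambda>x. w x * g x)"
  show ?thesis
  proof (intro exI[of _ K] conjI)
    show "0 < K" by fact
    show "dominated cubes K 1 (weight_measure w) ?\<rho>"
      unfolding dominated_def
    proof (intro ballI impI)
      fix Q E assume Q: "Q \<in> cubes" and E: "E \<in> sets (weight_measure w)" "E \<subseteq> Q"
      have [measurable]: "E \<in> sets lebesgue" "Q \<in> sets lebesgue" using E cubes_sets[OF Q] by auto
      define m where "m = measure (weight_measure w) Q"
      define r where "r = measure ?\<rho> Q"
      have m: "0 < m" "weight_meas w Q = ennreal m"
        using cube_weight(1)[OF w Q] cube_weight(2)[OF w Q order_refl] by (auto simp: m_def weight_meas_eq[OF w])
      have r: "0 < r" "weight_meas (\<lambda>x. w x * g x) Q = ennreal r"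
        using cube_weight(1)[OF wg Q] cube_weight(2)[OF wg Q order_refl] by (auto simp: r_def weight_meas_eq[OF wg])
      define N where "N = linfty_norm w (\<lambda>x. indicator Q x * ennreal (g x))"
      have "(weight_meas w Q / weight_meas (\<lambda>x. w x * g x) Q) * N \<le> RH_infty_const w g"
        unfolding RH_infty_const_def N_def using Q by (rule SUP_upper)
      then have "ennreal (m / r) * N \<le> ennreal K" using K(2) m r by (simp add: divide_ennreal)
      then have "ennreal (r / m) * (ennreal (m / r) * N) \<le> ennreal (r / m) * ennreal K"
        by (rule mult_left_mono) simp
      also have "ennreal (r / m) * (ennreal (m / r) * N) = ennreal (r / m * (m / r)) * N"
        using m r by (simp only: mult.assoc[symmetric]) (simp add: ennreal_mult[symmetric])
      also have "\<dots> = N" using m r by simp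
      also have "ennreal (r / m) * ennreal K = ennreal (K * r / m)"
        using m r K by (simp add: ennreal_mult[symmetric] mult.commute)
      finally have N: "N \<le> ennreal (K * r / m)" .
      have "AE x in weight_measure w. indicator Q x * ennreal (g x) \<le> N"
        unfolding N_def linfty_norm_def by (rule esssup_AE)
      then have ae: "AE x in weight_measure w. ennreal (g x) * indicator E x \<le> ennreal (K * r / m) * indicator E x"
        by eventually_elim (use E N in \<open>auto split: split_indicator\<close>)
      have "emeasure ?\<rho> E = (\<integral>\<^sup>+x. ennreal (w x * g x) * indicator E x \<partial>lebesgue)"
        by (rule emeasure_density) measurable
      also have "\<dots> = (\<integral>\<^sup>+x. ennreal (w x) * (ennreal (g x) * indicator E x) \<partial>lebesgue)"
        using is_weight_pos[OF w] g_pos by (intro nn_integral_cong) (simp add: ennreal_mult less_imp_le mult.assoc)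
      also have "\<dots> = (\<integral>\<^sup>+x. ennreal (g x) * indicator E x \<partial>weight_measure w)"
        by (rule nn_integral_density[symmetric]) measurable
      also have "\<dots> \<le> (\<integral>\<^sup>+x. ennreal (K * r / m) * indicator E x \<partial>weight_measure w)"
        using ae by (rule nn_integral_mono_AE)
      also have "\<dots> = ennreal (K * r / m) * emeasure (weight_measure w) E"
        by (rule nn_integral_cmult_indicator) simp
      also have "\<dots> = ennreal (K * r / m * measure (weight_measure w) E)"
        using cube_weight(2)[OF w Q E(2)] K r m by (simp add: ennreal_mult[symmetric])
      finally have "measure ?\<rho> E \<le> K * r / m * measure (weight_measure w) E"
        using K r m cube_weight(2)[OF wg Q E(2)] by (simp add: ennreal_le_iff)
      then show "measure ?\<rho> E \<le> K * (measure (weight_measure w) E / measure (weight_measure w) Q) powr 1 * measure ?\<rho> Q"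
        using m r by (simp add: m_def r_def mult_ac)
    qed
  qed
qed

lemma grid_cell_measure:
  assumes w: "is_weight w" and L: "0 < L"
  shows "cell_grid.cell_measure lebesgue (grid_cell t L) (weight_measure w)"
proof -
  interpret cell_grid lebesgue "grid_cell t L" by (rule cell_grid_grid_cell[OF L])
  show ?thesis
    unfolding cell_measure_def using weight_hcube[OF w] grid_cells_subset[OF L, of t] by auto
qed

lemma grid_cell_measure_lebesgue:
  assumes L: "0 < L"
  shows "cell_grid.cell_measure lebesgue (grid_cell t L) lebesgue"
  using grid_cell_measure[OF is_weight_1 L] by (simp add: density_1)

text \<open>
  Every half-open cube is a cell of its own grid, and the constants of the reversal depend on the grid only
  through the doubling constant \<open>2^n\<close>.
\<close>

lemma weight_reverse_dominated:
  fixes w :: "real ^ 'n \<Rightarrow> real"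
  assumes w: "is_weight w" and dom: "dominated hcubes C \<delta> (weight_measure w) lebesgue" and C: "0 < C" "0 < \<delta>"
  shows "\<exists>C' \<delta>'. 0 < C' \<and> 0 < \<delta>' \<and> dominated hcubes C' \<delta>' lebesgue (weight_measure w)"
proof -
  define N where "N = (2::real) ^ CARD('n)"
  have N: "1 \<le> N" by (simp add: N_def)
  define \<theta> where "\<theta> = max (1 / 2) (1 - (1 / (2 * C)) powr (1 / \<delta>))"
  define \<delta>' where "\<delta>' = - log (2 * N) \<theta>"
  have rev: "dominated (cell_grid.cells (grid_cell t L)) (2 powr \<delta>' / \<theta>) \<delta>' lebesgue (weight_measure w)" "0 < \<delta>'" "0 < \<theta>"
    if L: "0 < L" for t :: "real ^ 'n" and L
  proof -
    interpret cell_grid lebesgue "grid_cell t L" by (rule cell_grid_grid_cell[OF L])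
    note rd = reverse_dominated[OF grid_cell_measure_lebesgue[OF L] grid_cell_measure[OF w L]
        dominated_subset[OF dom grid_cells_subset[OF L]] C N, folded \<theta>_def \<delta>'_def]
    have dbl: "measure lebesgue (grid_cell t L k x) \<le> N * measure lebesgue (grid_cell t L (Suc k) x)" for k x
      unfolding N_def by (rule grid_cell_doubling[OF L])
    have ac: "emeasure (weight_measure w) E = 0" if "E \<in> sets lebesgue" "emeasure lebesgue E = 0" for E
      by (intro weight_null[OF w] null_setsI that)
    show "dominated cells (2 powr \<delta>' / \<theta>) \<delta>' lebesgue (weight_measure w)" "0 < \<delta>'" "0 < \<theta>"
      by (rule rd[OF dbl ac grid_cell_regular[OF L]]; assumption)+
  qed
  have "dominated hcubes (2 powr \<delta>' / \<theta>) \<delta>' lebesgue (weight_measure w)"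
    unfolding dominated_def
  proof (intro ballI impI)
    fix Q E :: "(real ^ 'n) set" assume Q: "Q \<in> hcubes" and E: "E \<in> sets lebesgue" "E \<subseteq> Q"
    obtain a l where al: "Q = hcube a l" "0 < l" using Q by (auto simp: hcubes_def)
    interpret cell_grid lebesgue "grid_cell a l" by (rule cell_grid_grid_cell[OF al(2)])
    have "Q \<in> cells" unfolding al(1) hcube_eq_grid_cell[OF al(2)] by simp
    then show "measure (weight_measure w) E \<le> 2 powr \<delta>' / \<theta> * (measure lebesgue E / measure lebesgue Q) powr \<delta>' * measure (weight_measure w) Q"
      using E by (intro dominatedD[OF rev(1)[OF al(2)]]) auto
  qed
  then show ?thesis using rev(2,3)[of 1] by (intro exI[of _ "2 powr \<delta>' / \<theta>"] exI[of _ \<delta>']) auto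
qed

section \<open>From one grid to the maximal operator\<close>

definition grid_level :: "(real ^ 'n \<Rightarrow> real) \<Rightarrow> (real ^ 'n \<Rightarrow> real) \<Rightarrow> real ^ 'n \<Rightarrow> real \<Rightarrow> real \<Rightarrow> (real ^ 'n) set" where
  "grid_level u g t L y = {x. \<exists>k. ennreal (y * u x) * emeasure lebesgue (grid_cell t L k x)
        < (\<integral>\<^sup>+z\<in>grid_cell t L k x. ennreal (g z) \<partial>lebesgue)}"

text \<open>
  The constants come from the domination relations over all half-open cubes, so one constant serves all grids.
  The chains are: \<open>w\<close> to \<open>u\<close> and \<open>u\<close> to \<open>w\<close> through Lebesgue measure, and Lebesgue
  measure to \<open>\<rho>\<close> through \<open>w\<close>.
\<close>

lemma uniform_grid_bound:
  fixes p \<epsilon> :: real and u v :: "real ^ 'n \<Rightarrow> real"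
  assumes p: "1 < p"
    and u: "is_weight u" and v: "is_weight v"
    and uR: "u \<in> ApR p"
    and wA: "(\<lambda>x. u x * v x powr p) \<in> A_infty"
    and \<epsilon>: "0 < \<epsilon>" "\<epsilon> \<le> 1"
    and \<rho>w: "is_weight (\<lambda>x. u x * v x powr (p - \<epsilon>))"
    and RH: "RH_infty_const (\<lambda>x. u x * v x powr p) (\<lambda>x. v x powr (- \<epsilon>)) < \<infinity>"
  shows "\<exists>K>0. \<forall>t L y f. 0 < L \<longrightarrow> 0 < y \<longrightarrow> f \<in> borel_measurable lebesgue \<longrightarrow> (\<forall>x. 0 \<le> f x) \<longrightarrow>
     grid_level u (\<lambda>x. f x * u x * v x powr (p - 1)) t L y \<in> sets lebesgue \<and>
     ennreal y * ennreal_pow (emeasure (weight_measure u) (grid_level u (\<lambda>x. f x * u x * v x powr (p - 1)) t L y)) (1 - 1 / p)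
      \<le> ennreal K * (\<integral>\<^sup>+s\<in>{0<..}. ennreal_pow (emeasure (weight_measure (\<lambda>x. u x * v x powr p)) {x. s < f x}) (1 - 1 / p) \<partial>lborel)"
proof -
  define w where "w = (\<lambda>x. u x * v x powr p)"
  define r where "r = (\<lambda>x. w x * v x powr (- \<epsilon>))"
  have r_eq: "r = (\<lambda>x. u x * v x powr (p - \<epsilon>))"
    using is_weight_pos[OF v] by (simp add: r_def w_def fun_eq_iff powr_diff powr_minus divide_inverse mult.assoc)
  have w: "is_weight w" using wA by (auto simp: A_infty_def Aq_def w_def)
  have r: "is_weight r" using \<rho>w by (simp add: r_eq)
  have um [measurable]: "u \<in> borel_measurable lebesgue" and vm [measurable]: "v \<in> borel_measurable lebesgue"
    using u v by (auto intro: is_weight_measurable)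
  note upos = is_weight_pos[OF u] and vpos = is_weight_pos[OF v]
  let ?\<mu> = "weight_measure u" and ?\<omega> = "weight_measure w" and ?\<rho> = "weight_measure r"
  have \<omega>_eq: "?\<omega> = density ?\<mu> (\<lambda>x. ennreal (v x powr p))"
    using upos by (subst density_density_eq) (auto simp: w_def ennreal_mult less_imp_le)
  have \<rho>_eq: "?\<rho> = density ?\<omega> (\<lambda>x. ennreal (v x powr (- \<epsilon>)))"
    using is_weight_pos[OF w] is_weight_measurable[OF w]
    by (subst density_density_eq) (auto simp: r_def ennreal_mult less_imp_le)
  have pos: "0 < measure (weight_measure a) Q" if "is_weight a" "Q \<in> hcubes" for a :: "real ^ 'n \<Rightarrow> real" and Q
    using weight_hcube[OF that] by (auto simp: measure_def enn2real_positive_iff)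
  have posL: "0 < measure lebesgue Q" if "Q \<in> hcubes" for Q :: "(real ^ 'n) set"
    using that by (auto simp: hcubes_def measure_hcube)
  have trL: "dominated hcubes C \<delta> (weight_measure a) lebesgue" if "dominated cubes C \<delta> (weight_measure a) lebesgue" "is_weight a"
    for C \<delta> and a :: "real ^ 'n \<Rightarrow> real"
    using that weight_null[OF that(2)] by (intro dominated_hcubes) (auto simp: null_sets_def simp del: emeasure_completion)
  obtain Cu where Cu: "0 < Cu" "dominated hcubes Cu (1 / p) ?\<mu> lebesgue"
    using ApR_dominated[OF p uR] trL[OF _ u] by blast
  obtain Cw \<delta>w where Cw: "0 < Cw" "0 < \<delta>w" "dominated hcubes Cw \<delta>w ?\<omega> lebesgue"
    using A_infty_dominated[OF wA] trL[OF _ w] unfolding w_def by blast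
  obtain Cu' \<delta>u' where Cu': "0 < Cu'" "0 < \<delta>u'" "dominated hcubes Cu' \<delta>u' lebesgue ?\<mu>"
    using weight_reverse_dominated[OF u Cu(2,1)] p by auto
  obtain Cw' \<delta>w' where Cw': "0 < Cw'" "0 < \<delta>w'" "dominated hcubes Cw' \<delta>w' lebesgue ?\<omega>"
    using weight_reverse_dominated[OF w Cw(3,1,2)] by auto
  obtain C3 where C3: "0 < C3" "dominated hcubes C3 1 ?\<omega> ?\<rho>"
  proof -
    obtain C where C: "0 < C" "dominated cubes C 1 ?\<omega> ?\<rho>"
    proof -
      have "0 < v x powr (- \<epsilon>)" for x using vpos[of x] by simp
      moreover have "(\<lambda>x. v x powr (- \<epsilon>)) \<in> borel_measurable lebesgue" by measurable
      moreover have "RH_infty_const w (\<lambda>x. v x powr (- \<epsilon>)) < \<infinity>" using RH by (simp add: w_def)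
      ultimately show ?thesis
        using RH_infty_dominated[OF w r[unfolded r_def]] that unfolding r_def by blast
    qed
    have "dominated hcubes C 1 ?\<omega> ?\<rho>"
      by (rule dominated_hcubes[OF C(2)]) (auto intro: weight_null[OF w] weight_null[OF r])
    with C(1) that show ?thesis by blast
  qed
  define C1 \<delta>1 where "C1 = Cu' * Cw powr \<delta>u'" and "\<delta>1 = \<delta>w * \<delta>u'"
  have d1: "dominated hcubes C1 \<delta>1 ?\<omega> ?\<mu>" "0 < C1" "0 < \<delta>1"
    unfolding C1_def \<delta>1_def using Cw Cu' posL by (auto intro!: dominated_trans[OF Cw(3) Cu'(3)])
  define C2 \<delta>2 where "C2 = Cw' * Cu powr \<delta>w'" and "\<delta>2 = 1 / p * \<delta>w'"
  have d2: "dominated hcubes C2 \<delta>2 ?\<mu> ?\<omega>" "0 < C2" "0 < \<delta>2"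
  proof -
    show "dominated hcubes C2 \<delta>2 ?\<mu> ?\<omega>"
      unfolding C2_def \<delta>2_def using Cu Cw' posL p by (intro dominated_trans[OF Cu(2) Cw'(3)]) auto
  qed (use Cu Cw' p in \<open>auto simp: C2_def \<delta>2_def\<close>)
  define C4 \<delta>4 where "C4 = C3 * Cw' powr 1" and "\<delta>4 = \<delta>w' * 1"
  have d4: "dominated hcubes C4 \<delta>4 lebesgue ?\<rho>" "0 < C4" "0 < \<delta>4"
  proof -
    show "dominated hcubes C4 \<delta>4 lebesgue ?\<rho>"
      unfolding C4_def \<delta>4_def using C3 Cw' pos[OF w] by (intro dominated_trans[OF Cw'(3) C3(2)]) auto
  qed (use C3 Cw' in \<open>auto simp: C4_def \<delta>4_def\<close>)
  have ex_a: "\<exists>a>1. C * (1 / a) powr \<delta> \<le> 1 / 2" if "0 < C" "0 < \<delta>" for C \<delta> :: real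
  proof (intro exI[of _ "max 2 ((2 * C) powr (1 / \<delta>))"] conjI)
    let ?a = "max 2 ((2 * C) powr (1 / \<delta>))"
    have "2 * C = ((2 * C) powr (1 / \<delta>)) powr \<delta>" using that by (simp add: powr_powr)
    also have "\<dots> \<le> ?a powr \<delta>" using that by (intro powr_mono2) auto
    finally have "2 * C \<le> ?a powr \<delta>" .
    then show "C * (1 / ?a) powr \<delta> \<le> 1 / 2" by (simp add: powr_divide field_simps)
  qed simp
  obtain a where a: "1 < a" "C2 * (1 / a) powr \<delta>2 \<le> 1 / 2" using ex_a[OF d2(2,3)] by auto
  obtain b where b: "1 < b" "C4 * (1 / b) powr \<delta>4 \<le> 1 / 2" using ex_a[OF d4(2,3)] by auto
  define K where "K = 1 + 6 * C1 * a powr (2 + \<delta>1) / (1 - a powr (- \<delta>1))"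
  have K: "0 < K" unfolding K_def using a d1 by (intro add_pos_nonneg) (auto simp: powr_less_one less_imp_le)
  define K' where "K' = b * (1 + 2 / (1 - 2 powr (1 - p))) * dual_const p \<epsilon> Cu C3 K powr (1 / p)"
  have "0 < 1 + 2 / (1 - 2 powr (1 - p))"
    using p by (intro add_pos_nonneg) (auto simp: powr_less_one less_imp_le)
  then have K': "0 < K'" unfolding K'_def using b dual_const_pos[OF p \<epsilon> Cu(1) C3(1) K] by simp
  show ?thesis
  proof (intro exI[of _ K'] conjI allI impI K')
    fix t :: "real ^ 'n" and L y :: real and f :: "real ^ 'n \<Rightarrow> real"
    assume L: "0 < L" and y: "0 < y" and f: "f \<in> borel_measurable lebesgue" "\<forall>x. 0 \<le> f x"
    interpret cell_grid lebesgue "grid_cell t L" by (rule cell_grid_grid_cell[OF L])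
    note sub = dominated_subset[OF _ grid_cells_subset[OF L, of t]]
    note cm = grid_cell_measure[OF _ L, of _ t] and cL = grid_cell_measure_lebesgue[OF L, of t]
    have weak: "emeasure ?\<omega> {x. \<exists>k. s * v x powr p * measure ?\<mu> (grid_cell t L k x) < measure ?\<mu> (G \<inter> grid_cell t L k x)}
       \<le> ennreal (K / s) * emeasure ?\<mu> G" if "0 < s" "G \<in> sets lebesgue" for s G
      unfolding K_def
      by (rule mixed_weak_type[OF cm[OF u] cm[OF w] \<omega>_eq _ _ sub[OF d1(1)] d1(2,3) sub[OF d2(1)] d2(2,3) a that(2,1)]) auto
    interpret weighted_grid lebesgue "grid_cell t L" u v p \<epsilon> Cu C3 C4 \<delta>4 b K ?\<mu> ?\<omega> ?\<rho>
      by unfold_locales (fact p \<epsilon> um upos vm vpos cL cm[OF u] cm[OF w] cm[OF r] refl \<omega>_eq \<rho>_eq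
        sub[OF Cu(2)] Cu(1) sub[OF C3(2)] C3(1) sub[OF d4(1)] d4(2,3) b K weak)+
    note dd = dyadic_dual[OF y f(1) f(2)[rule_format]]
    show "grid_level u (\<lambda>x. f x * u x * v x powr (p - 1)) t L y \<in> sets lebesgue"
      unfolding grid_level_def by (rule dd(1))
    show "ennreal y * ennreal_pow (emeasure (weight_measure u) (grid_level u (\<lambda>x. f x * u x * v x powr (p - 1)) t L y)) (1 - 1 / p)
      \<le> ennreal K' * (\<integral>\<^sup>+s\<in>{0<..}. ennreal_pow (emeasure (weight_measure (\<lambda>x. u x * v x powr p)) {x. s < f x}) (1 - 1 / p) \<partial>lborel)"
      unfolding grid_level_def K'_def by (rule dd(2)[unfolded w_def])
  qed
qed

text \<open>
  A cube around \<open>x\<close> with a large average lies in a cell of one of the shifted grids whose side is at most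
  six times as large. This works for every top side \<open>L\<close> beyond three times the side of the cube, so
  the level set is exhausted as \<open>L\<close> grows.
\<close>

lemma maximal_level_subset:
  fixes u g :: "real ^ 'n \<Rightarrow> real"
  assumes upos: "\<And>x. 0 < u x" and y: "0 < y" and x: "ennreal y < HL_maximal g x / ennreal (u x)"
  shows "\<exists>L0. \<forall>L>L0. \<exists>t. (\<forall>i. t $ i \<in> {0, L / 3}) \<and>
     x \<in> grid_level u (\<lambda>z. \<bar>g z\<bar>) t L (y / 6 ^ CARD('n))"
proof -
  have ux: "0 < u x" by (rule upos)
  have "ennreal (y * u x) < HL_maximal g x"
  proof (rule ccontr)
    assume "\<not> ?thesis"
    then have "HL_maximal g x / ennreal (u x) \<le> ennreal (y * u x) / ennreal (u x)"
      by (intro divide_right_mono_ennreal) auto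
    also have "\<dots> = ennreal y" using ux y by (simp add: divide_ennreal)
    finally show False using x by simp
  qed
  then obtain Q where Q: "Q \<in> cubes" "x \<in> Q" "ennreal (y * u x) < cube_avg g Q"
    unfolding HL_maximal_def by (auto simp: less_SUP_iff)
  obtain a l where al: "Q = ccube a l" "0 < l" using Q by (auto simp: cubes_ccube)
  define V where "V = l ^ CARD('n)"
  have V: "0 < V" "emeasure lebesgue Q = ennreal V" using al emeasure_ccube[of l a] by (auto simp: V_def)
  let ?I = "\<lambda>Q. \<integral>\<^sup>+z\<in>Q. ennreal \<bar>g z\<bar> \<partial>lebesgue"
  have IQ: "ennreal (y * u x * V) < ?I Q"
  proof (rule ccontr)
    assume "\<not> ?thesis"
    then have "cube_avg g Q \<le> ennreal (y * u x * V) / ennreal V"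
      unfolding cube_avg_def V by (intro divide_right_mono_ennreal) auto
    also have "\<dots> = ennreal (y * u x)" using ux y V by (simp add: divide_ennreal)
    finally show False using Q(3) by simp
  qed
  show ?thesis
  proof (intro exI[of _ "3 * l"] allI impI)
    fix L assume "3 * l < L"
    then have L: "0 < L" "l < L / 3" using al(2) by auto
    obtain t k where t: "\<forall>i. t $ i \<in> {0, L / 3}" and sub: "Q \<subseteq> grid_cell t L k a" and le: "L / 2 ^ k \<le> 6 * l"
      using cube_in_grid_cell[OF L(1) al(2) L(2), of a] al(1) by blast
    interpret cell_grid lebesgue "grid_cell t L" by (rule cell_grid_grid_cell[OF L(1)])
    have eq: "grid_cell t L k x = grid_cell t L k a" using Q(2) sub by (intro cell_eq) auto
    have "emeasure lebesgue (grid_cell t L k x) = ennreal ((L / 2 ^ k) ^ CARD('n))"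
      unfolding grid_cell_eq_hcube[OF L(1)] using L by (intro emeasure_hcube) simp
    also have "\<dots> \<le> ennreal ((6 * l) ^ CARD('n))" using le L by (intro ennreal_leI power_mono) auto
    finally have "ennreal (y / 6 ^ CARD('n) * u x) * emeasure lebesgue (grid_cell t L k x)
       \<le> ennreal (y / 6 ^ CARD('n) * u x) * ennreal ((6 * l) ^ CARD('n))"
      by (rule mult_left_mono) simp
    also have "\<dots> = ennreal (y / 6 ^ CARD('n) * u x * (6 * l) ^ CARD('n))"
      using y ux al by (intro ennreal_mult[symmetric]) auto
    also have "y / 6 ^ CARD('n) * u x * (6 * l) ^ CARD('n) = y * u x * V"
      by (simp add: V_def power_mult_distrib)
    also have "ennreal (y * u x * V) < ?I Q" by (rule IQ)
    also have "?I Q \<le> ?I (grid_cell t L k x)"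
      unfolding eq using sub by (intro nn_integral_mono) (auto split: split_indicator)
    finally have "x \<in> grid_level u (\<lambda>z. \<bar>g z\<bar>) t L (y / 6 ^ CARD('n))"
      unfolding grid_level_def by (intro CollectI exI[of _ k])
    then show "\<exists>t. (\<forall>i. t $ i \<in> {0, L / 3}) \<and> x \<in> grid_level u (\<lambda>z. \<bar>g z\<bar>) t L (y / 6 ^ CARD('n))"
      using t by blast
  qed
qed

theorem theorem4p8:
  fixes p \<epsilon> :: real and u v :: "real ^ 'n \<Rightarrow> real"
  assumes "1 < p"
    and "is_weight u" and "is_weight v"
    and "u \<in> ApR p"
    and "(\<lambda>x. u x * v x powr p) \<in> A_infty"
    and "0 < \<epsilon>" and "\<epsilon> \<le> 1"
    and "is_weight (\<lambda>x. u x * v x powr (p - \<epsilon>))"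
    and "RH_infty_const (\<lambda>x. u x * v x powr p) (\<lambda>x. v x powr (- \<epsilon>)) < \<infinity>"
  shows "\<exists>C::real. 0 < C \<and>
    (\<forall>f :: real ^ 'n \<Rightarrow> real. f \<in> borel_measurable lebesgue \<longrightarrow>
      lorentz_weak (conj_exponent p) u
          (\<lambda>x. HL_maximal (\<lambda>z. f z * u z * v z powr (p - 1)) x / ennreal (u x))
        \<le> ennreal C *
          lorentz_strong (conj_exponent p) (\<lambda>x. u x * v x powr p) (\<lambda>x. ennreal \<bar>f x\<bar>))"
proof -
  define q where "q = conj_exponent p"
  have q: "1 < q" and q_inv: "1 / q = 1 - 1 / p" and q_pos: "0 < 1 - 1 / p"
    using assms(1) by (auto simp: q_def conj_exponent_def field_simps)
  define w where "w = (\<lambda>x. u x * v x powr p)"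
  have w: "is_weight w" using assms(5) by (auto simp: A_infty_def Aq_def w_def)
  note upos = is_weight_pos[OF assms(2)]
  obtain K where K: "0 < K" and bound: "\<And>t L y f. 0 < L \<Longrightarrow> 0 < y \<Longrightarrow> f \<in> borel_measurable lebesgue \<Longrightarrow> (\<forall>x. 0 \<le> f x) \<Longrightarrow>
     grid_level u (\<lambda>x. f x * u x * v x powr (p - 1)) t L y \<in> sets lebesgue \<and>
     ennreal y * ennreal_pow (emeasure (weight_measure u) (grid_level u (\<lambda>x. f x * u x * v x powr (p - 1)) t L y)) (1 - 1 / p)
      \<le> ennreal K * (\<integral>\<^sup>+s\<in>{0<..}. ennreal_pow (emeasure (weight_measure w) {x. s < f x}) (1 - 1 / p) \<partial>lborel)"
    using uniform_grid_bound[OF assms] unfolding w_def by blast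
  define n where "n = real CARD('n set)"
  have n: "0 < n" by (simp add: n_def)
  define d where "d = (6::real) ^ CARD('n)"
  have d: "0 < d" by (simp add: d_def)
  define C where "C = n powr (1 - 1 / p) * d * K"
  have C: "0 < C" using n d K by (simp add: C_def)
  show ?thesis
  proof (intro exI[of _ C] conjI allI impI C)
    fix f :: "real ^ 'n \<Rightarrow> real"
    assume f [measurable]: "f \<in> borel_measurable lebesgue"
    define g where "g x = f x * u x * v x powr (p - 1)" for x
    define J where "J = (\<integral>\<^sup>+s\<in>{0<..}. ennreal_pow (emeasure (weight_measure w) {x. s < \<bar>f x\<bar>}) (1 - 1 / p) \<partial>lborel)"
    have g_abs: "(\<lambda>z. \<bar>g z\<bar>) = (\<lambda>x. \<bar>f x\<bar> * u x * v x powr (p - 1))"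
      using upos by (simp add: g_def abs_mult less_imp_le fun_eq_iff)
    have strong: "J \<le> lorentz_strong q w (\<lambda>x. ennreal \<bar>f x\<bar>)"
    proof -
      have "J = (\<integral>\<^sup>+s\<in>{0<..}. ennreal_pow (distr_fun w (\<lambda>x. ennreal \<bar>f x\<bar>) s) (1 / q) \<partial>lborel)"
        unfolding J_def q_inv
      proof (intro nn_integral_cong)
        fix s :: real
        have "{x \<in> space lebesgue. s < \<bar>f x\<bar>} \<in> sets lebesgue" by measurable
        then have "emeasure (weight_measure w) {x. s < \<bar>f x\<bar>} = distr_fun w (\<lambda>x. ennreal \<bar>f x\<bar>) s" if "0 < s"
          using that unfolding distr_fun_def by (simp add: ennreal_less_iff weight_meas_eq[OF w])
        then show "ennreal_pow (emeasure (weight_measure w) {x. s < \<bar>f x\<bar>}) (1 - 1 / p) * indicator {0<..} s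
          = ennreal_pow (distr_fun w (\<lambda>x. ennreal \<bar>f x\<bar>) s) (1 - 1 / p) * indicator {0<..} s"
          by (auto split: split_indicator)
      qed
      also have "\<dots> \<le> lorentz_strong q w (\<lambda>x. ennreal \<bar>f x\<bar>)"
      proof -
        have "ennreal 1 * b \<le> ennreal q * b" for b using q by (intro mult_right_mono ennreal_leI) auto
        then show ?thesis unfolding lorentz_strong_def by simp
      qed
      finally show ?thesis .
    qed
    have "lorentz_weak q u (\<lambda>x. HL_maximal g x / ennreal (u x)) \<le> ennreal C * J"
      unfolding lorentz_weak_def
    proof (rule SUP_least)
      fix y :: real assume "y \<in> {0<..}"
      then have y: "0 < y" by simp
      define S where "S = {x. ennreal y < HL_maximal g x / ennreal (u x)}"
      show "ennreal y * ennreal_pow (distr_fun u (\<lambda>x. HL_maximal g x / ennreal (u x)) y) (1 / q) \<le> ennreal C * J"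
      proof (cases J)
        case top
        then show ?thesis using C by (simp add: ennreal_mult_top)
      next
        case (real j)
        define c where "c = (K * j / (y / d)) powr (1 / (1 - 1 / p))"
        define shift where "shift L X = (\<chi> i. if i \<in> X then L / 3 else 0)" for L :: real and X :: "'n set"
        define B where "B N = (\<Union>X. grid_level u (\<lambda>z. \<bar>g z\<bar>) (shift (real (Suc N)) X) (real (Suc N)) (y / d))" for N :: nat
        have G: "grid_level u (\<lambda>z. \<bar>g z\<bar>) t L (y / d) \<in> sets lebesgue"
            "emeasure (weight_measure u) (grid_level u (\<lambda>z. \<bar>g z\<bar>) t L (y / d)) \<le> ennreal c" if "0 < L" for t L
        proof -
          have b: "grid_level u (\<lambda>z. \<bar>g z\<bar>) t L (y / d) \<in> sets lebesgue \<and>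
            ennreal (y / d) * ennreal_pow (emeasure (weight_measure u) (grid_level u (\<lambda>z. \<bar>g z\<bar>) t L (y / d))) (1 - 1 / p) \<le> ennreal K * J"
            unfolding J_def g_abs by (rule bound) (use that y d in auto)
          then show "grid_level u (\<lambda>z. \<bar>g z\<bar>) t L (y / d) \<in> sets lebesgue" by simp
          have "ennreal K * J = ennreal (K * j)" using K real by (simp add: ennreal_mult)
          then show "emeasure (weight_measure u) (grid_level u (\<lambda>z. \<bar>g z\<bar>) t L (y / d)) \<le> ennreal c"
            using b y d K real q_pos by (simp add: ennreal_mult_pow_le_iff c_def)
        qed
        have Bm: "B N \<in> sets lebesgue" for N
          unfolding B_def by (intro sets.countable_UN' ) (auto intro: G countable_finite)
        have B_le: "emeasure (weight_measure u) (B N) \<le> ennreal (n * c)" for N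
        proof -
          have "emeasure (weight_measure u) (B N) \<le> (\<Sum>X\<in>(UNIV::'n set set).
              emeasure (weight_measure u) (grid_level u (\<lambda>z. \<bar>g z\<bar>) (shift (real (Suc N)) X) (real (Suc N)) (y / d)))"
            unfolding B_def by (intro emeasure_subadditive_finite) (auto intro: G)
          also have "\<dots> \<le> (\<Sum>X\<in>(UNIV::'n set set). ennreal c)" by (intro sum_mono G) simp
          also have "\<dots> = ennreal (n * c)"
            by (simp add: n_def c_def ennreal_mult ennreal_of_nat_eq_real_of_nat)
          finally show ?thesis .
        qed
        \<comment> \<open>The sets \<open>B N\<close> need not increase with the top side \<open>N + 1\<close>, but each point of the level set is
          in all but finitely many of them. Their limit inferior \<open>\<Union>N. D N\<close> is measurable and obeys the same bound.\<close>
        define D where "D N = (\<Inter>N'\<in>{N..}. B N')" for N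
        have Dm: "D N \<in> sets lebesgue" for N unfolding D_def by (intro sets.countable_INT'') (auto intro: Bm)
        have D_inc: "incseq D" unfolding incseq_def D_def by fastforce
        have S_sub: "S \<subseteq> (\<Union>N. D N)"
        proof
          fix x assume "x \<in> S"
          then have "ennreal y < HL_maximal g x / ennreal (u x)" by (simp add: S_def)
          then obtain L0 where L0: "\<And>L. L0 < L \<Longrightarrow> \<exists>t. (\<forall>i. t $ i \<in> {0, L / 3}) \<and> x \<in> grid_level u (\<lambda>z. \<bar>g z\<bar>) t L (y / d)"
            using maximal_level_subset[of u y g x, OF upos y] unfolding d_def by blast
          obtain N where N: "L0 < real N" using reals_Archimedean2 by blast
          have "x \<in> B N'" if "N \<le> N'" for N'
          proof -
            obtain t where t: "\<forall>i. t $ i \<in> {0, real (Suc N') / 3}"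
              "x \<in> grid_level u (\<lambda>z. \<bar>g z\<bar>) t (real (Suc N')) (y / d)"
            proof -
              have "L0 < real (Suc N')" using N \<open>N \<le> N'\<close> by simp
              from L0[OF this] show ?thesis using that by blast
            qed
            have "t = shift (real (Suc N')) {i. t $ i \<noteq> 0}" using t(1) by (auto simp: shift_def vec_eq_iff)
            then show ?thesis using t(2) unfolding B_def by (metis UN_I UNIV_I)
          qed
          then show "x \<in> (\<Union>N. D N)" by (auto simp: D_def)
        qed
        have "distr_fun u (\<lambda>x. HL_maximal g x / ennreal (u x)) y \<le> weight_meas u (\<Union>N. D N)"
          unfolding distr_fun_def weight_meas_def using S_sub
          by (intro nn_integral_mono) (auto split: split_indicator simp: S_def)
        also have "\<dots> = emeasure (weight_measure u) (\<Union>N. D N)"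
          using Dm by (intro weight_meas_eq[OF assms(2)]) auto
        also have "\<dots> = (SUP N. emeasure (weight_measure u) (D N))"
          using D_inc Dm by (intro SUP_emeasure_incseq[symmetric]) auto
        also have "\<dots> \<le> ennreal (n * c)"
        proof (rule SUP_least)
          fix N
          have "emeasure (weight_measure u) (D N) \<le> emeasure (weight_measure u) (B N)"
            using Bm by (intro emeasure_mono) (auto simp: D_def)
          then show "emeasure (weight_measure u) (D N) \<le> ennreal (n * c)" using B_le order_trans by blast
        qed
        also have "n * c = (C * j / y) powr (1 / (1 - 1 / p))"
        proof -
          have "n = (n powr (1 - 1 / p)) powr (1 / (1 - 1 / p))" using n assms(1) by (simp add: powr_powr)
          then have "n * c = (n powr (1 - 1 / p) * (K * j / (y / d))) powr (1 / (1 - 1 / p))"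
            unfolding c_def powr_mult by simp
          also have "n powr (1 - 1 / p) * (K * j / (y / d)) = C * j / y" by (simp add: C_def)
          finally show ?thesis .
        qed
        finally have "ennreal y * ennreal_pow (distr_fun u (\<lambda>x. HL_maximal g x / ennreal (u x)) y) (1 - 1 / p) \<le> ennreal (C * j)"
          using y C real q_pos by (subst ennreal_mult_pow_le_iff) auto
        then show ?thesis using real C by (simp add: q_inv ennreal_mult)
      qed
    qed
    also have "\<dots> \<le> ennreal C * lorentz_strong q w (\<lambda>x. ennreal \<bar>f x\<bar>)"
      by (intro mult_left_mono strong) simp
    finally show "lorentz_weak (conj_exponent p) u
          (\<lambda>x. HL_maximal (\<lambda>z. f z * u z * v z powr (p - 1)) x / ennreal (u x))
        \<le> ennreal C *
          lorentz_strong (conj_exponent p) (\<lambda>x. u x * v x powr p) (\<lambda>x. ennreal \<bar>f x\<bar>)"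
      unfolding q_def w_def g_def .
  qed
qed

end
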